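(* Fix $n\ge 1$. The wiggly fan (the fan in $\mathbb{H}_{2n}=\{\mathbf{x}\in\mathbb{R}^{2n}:\sum_k x_k=0\}$ whose cones are $\mathbb{R}_{\ge0}\{\mathbf{g}(\alpha):\alpha\in D\}$ for all sets $D$ of pairwise compatible internal wiggly arcs) is the normal fan of a simple $(2n-1)$-dimensional polytope $W_n\subset\mathbb{H}_{2n}$ (the wigglyhedron), which can be described equivalently as (1) the intersection of the halfspaces $\{\mathbf{x}\in\mathbb{H}_{2n} : \langle \mathbf{g}(\alpha),\mathbf{x}\rangle \le \kappa(\alpha)\}$ over all internal wiggly arcs $\alpha$, and (2) the convex hull of the points $\mathbf{p}(T)=\sum_{\alpha} \kappa(\alpha)\,\mathbf{c}(\alpha,T)$ (sum over the internal wiggly arcs $\alpha$ of $T$), over all wiggly pseudotriangulations $T$.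
   Context: Consider the points $0,\dots,n+1$ on a horizontal line. A wiggly arc is a quadruple $\alpha=(i,j,A,B)$ with $0\le i<j\le n+1$ and $A,B$ a partition of $\{i+1,\dots,j-1\}$ (curve from $i$ to $j$ passing above $A$ and below $B$). External arcs: $(0,n+1,[n],\varnothing)$ and $(0,n+1,\varnothing,[n])$; others are internal. Arcs $(i,j,A,B)$, $(i',j',A',B')$ are non pointed if $i=j'$ or $i'=j$; crossing if $(A\cap B')\cup(\{i,j\}\cap B')\cup(A\cap\{i',j'\})\ne\varnothing\ne(A'\cap B)\cup(\{i',j'\}\cap B)\cup(A'\cap\{i,j\})$; compatible if neither. A wiggly pseudotriangulation is an inclusion-maximal set of pairwise compatible wiggly arcs containing both external arcs (it has exactly $2n-1$ internal arcs). $\mathbf{g}$-vectors: for $\alpha=(i,j,A,B)$, $\alpha^+=(\{2i-1,2j\}\setminus\{-1,2n+2\})\cup\{2a-1,2a:a\in A\}$, $\alpha^-=(\{2i,2j-1\}\setminus\{0,2n+1\})\cup\{2b-1,2b:b\in B\}$, $\mathbf{g}(\alpha)=\pi(\mathbf{1}_{\alpha^+}-\mathbf{1}_{\alpha^-})$ with $\pi$ the orthogonal projection of $\mathbb{R}^{2n}$ onto $\mathbb{H}_{2n}$. For a wiggly pseudotriangulation $T$ the vectors $\mathbf{g}(\alpha)$, $\alpha\in T$ internal, form a basis of $\mathbb{H}_{2n}$, and the $\mathbf{c}$-vectors $\mathbf{c}(\alpha,T)\in\mathbb{H}_{2n}$ form the dual basis: $\langle\mathbf{c}(\alpha,T),\mathbf{g}(\alpha)\rangle=1$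 and $\langle\mathbf{c}(\alpha,T),\mathbf{g}(\alpha')\rangle=0$ for internal $\alpha'\ne\alpha$ in $T$. Incompatibility degree $\delta(\alpha,\alpha')$: $0$ if $\alpha,\alpha'$ compatible; $1$ if non pointed; otherwise (crossing) the number of $p\in\{0,\dots,n\}$ such that either $p\in(A\cap B')\cup(\{i,j\}\cap B')\cup(A\cap\{i',j'\})$ and $p+1\in(A'\cap B)\cup(\{i',j'\}\cap B)\cup(A'\cap\{i,j\})$, or the same with the roles of $\alpha$ and $\alpha'$ exchanged. The incompatibility number is $\kappa(\alpha)=\sum_{\alpha'}\delta(\alpha,\alpha')$, summed over all wiggly arcs $\alpha'$.
   Formalization: For crossing arcs, the incompatibility degree counts p whose order is reversed at the next point q>p where the arcs are separated, instead of requiring q=p+1; with the literal p+1 formula the claim fails for every n≥3 (the two agree for n≤2). *)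

theory Defs
  imports "HOL-Analysis.Analysis"
begin

section \<open>Wiggly arcs\<close>

text \<open>The quadruple \<open>(i, j, A, B)\<close> is the curve from \<open>i\<close> to \<open>j\<close> passing above the
  points of \<open>A\<close> and below the points of \<open>B\<close>. The two parts of the partition may be empty.\<close>

type_synonym arc = "nat \<times> nat \<times> nat set \<times> nat set"

definition wiggly_arcs :: "nat \<Rightarrow> arc set" where
  "wiggly_arcs n = {(i, j, A, B). i < j \<and> j \<le> n + 1 \<and> A \<union> B = {i<..<j} \<and> A \<inter> B = {}}"

definition external_arcs :: "nat \<Rightarrow> arc set" where
  "external_arcs n = {(0, n + 1, {1..n}, {}), (0, n + 1, {}, {1..n})}"

definition internal_arcs :: "nat \<Rightarrow> arc set" where
  "internal_arcs n = wiggly_arcs n - external_arcs n"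

definition non_pointed :: "arc \<Rightarrow> arc \<Rightarrow> bool" where
  "non_pointed = (\<lambda>(i, j, A, B) (i', j', A', B'). i = j' \<or> i' = j)"

text \<open>The points \<open>p\<close> at which the first arc lies above the second one. Exchanging the two arcs
  gives \<open>(A' \<inter> B) \<union> ({i', j'} \<inter> B) \<union> (A' \<inter> {i, j})\<close>.\<close>

definition above_at :: "arc \<Rightarrow> arc \<Rightarrow> nat set" where
  "above_at = (\<lambda>(i, j, A, B) (i', j', A', B').
     (A \<inter> B') \<union> ({i, j} \<inter> B') \<union> (A \<inter> {i', j'}))"

definition crossing :: "arc \<Rightarrow> arc \<Rightarrow> bool" where
  "crossing \<alpha> \<beta> \<longleftrightarrow> above_at \<alpha> \<beta> \<noteq> {} \<and> above_at \<beta> \<alpha> \<noteq> {}"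

definition compatible :: "arc \<Rightarrow> arc \<Rightarrow> bool" where
  "compatible \<alpha> \<beta> \<longleftrightarrow> \<not> non_pointed \<alpha> \<beta> \<and> \<not> crossing \<alpha> \<beta>"

definition pairwise_compatible :: "arc set \<Rightarrow> bool" where
  "pairwise_compatible D \<longleftrightarrow> (\<forall>\<alpha>\<in>D. \<forall>\<beta>\<in>D. compatible \<alpha> \<beta>)"

definition wiggly_pseudotriangulation :: "nat \<Rightarrow> arc set \<Rightarrow> bool" where
  "wiggly_pseudotriangulation n T \<longleftrightarrow>
     T \<subseteq> wiggly_arcs n \<and> external_arcs n \<subseteq> T \<and> pairwise_compatible T \<and>
     (\<forall>T'. T' \<subseteq> wiggly_arcs n \<and> external_arcs n \<subseteq> T' \<and> pairwise_compatible T' \<and> T \<subseteq> T'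
        \<longrightarrow> T' = T)"

section \<open>Incompatibility degree and incompatibility number\<close>

text \<open>For crossing arcs, the degree is the number of crossings, that is, the number of points \<open>p\<close>
  such that the relative order of the two arcs at \<open>p\<close> is opposite to their relative order at the
  next point \<open>q\<close> where they are separated. The points strictly between \<open>p\<close> and \<open>q\<close> lie on the
  same side of both arcs. They have to be skipped: counting only the pairs with \<open>q = p + 1\<close> would
  give degree 0 to crossing arcs such as \<open>(0, 3, {1, 2}, {})\<close> and \<open>(0, 4, {2, 3}, {1})\<close>, which
  are separated only at \<open>1\<close> and \<open>3\<close>.\<close>

definition incompatibility_degree :: "nat \<Rightarrow> arc \<Rightarrow> arc \<Rightarrow> nat" where
  "incompatibility_degree n \<alpha> \<beta> =
     (if compatible \<alpha> \<beta> then 0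
      else if non_pointed \<alpha> \<beta> then 1
      else card {p \<in> {0..n}. \<exists>q>p.
        (\<forall>r. p < r \<and> r < q \<longrightarrow> r \<notin> above_at \<alpha> \<beta> \<union> above_at \<beta> \<alpha>) \<and>
        (p \<in> above_at \<alpha> \<beta> \<and> q \<in> above_at \<beta> \<alpha> \<or> p \<in> above_at \<beta> \<alpha> \<and> q \<in> above_at \<alpha> \<beta>)})"

definition incompatibility_number :: "nat \<Rightarrow> arc \<Rightarrow> nat" where
  "incompatibility_number n \<alpha> = (\<Sum>\<beta>\<in>wiggly_arcs n. incompatibility_degree n \<alpha> \<beta>)"

section \<open>g-vectors and c-vectors\<close>

text \<open>The space \<open>\<real>\<^sup>2\<^sup>n\<close> is \<open>real ^ 'd\<close> together with a bijection \<open>lbl\<close> from \<open>'d\<close> to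
  \<open>{1..2 * n}\<close>, which says which coordinate is the \<open>k\<close>-th one.\<close>

definition sum_zero_space :: "(real ^ 'd) set" where
  "sum_zero_space = {x. (\<Sum>k\<in>UNIV. x $ k) = 0}"

definition orthogonal_projection :: "'a::real_inner set \<Rightarrow> 'a \<Rightarrow> 'a" where
  "orthogonal_projection V x = (THE y. y \<in> V \<and> (\<forall>z\<in>V. orthogonal (x - y) z))"

text \<open>Natural subtraction truncates, so for \<open>i = 0\<close> the index \<open>2 * i - 1\<close>, meant to be \<open>-1\<close>, is
  \<open>0\<close>; this is why \<open>0\<close> is removed in place of \<open>-1\<close>. No other index is affected, because
  \<open>1 \<le> j\<close> and \<open>1 \<le> a\<close> for \<open>a \<in> A \<union> B\<close>.\<close>

definition arc_plus :: "nat \<Rightarrow> arc \<Rightarrow> nat set" where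
  "arc_plus n = (\<lambda>(i, j, A, B).
     ({2 * i - 1, 2 * j} - {0, 2 * n + 2}) \<union> (\<Union>a\<in>A. {2 * a - 1, 2 * a}))"

definition arc_minus :: "nat \<Rightarrow> arc \<Rightarrow> nat set" where
  "arc_minus n = (\<lambda>(i, j, A, B).
     ({2 * i, 2 * j - 1} - {0, 2 * n + 1}) \<union> (\<Union>b\<in>B. {2 * b - 1, 2 * b}))"

definition indicator_vector :: "('d \<Rightarrow> nat) \<Rightarrow> nat set \<Rightarrow> real ^ 'd" where
  "indicator_vector lbl S = (\<chi> k. if lbl k \<in> S then 1 else 0)"

definition g_vector :: "('d::finite \<Rightarrow> nat) \<Rightarrow> nat \<Rightarrow> arc \<Rightarrow> real ^ 'd" where
  "g_vector lbl n \<alpha> = orthogonal_projection sum_zero_space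
     (indicator_vector lbl (arc_plus n \<alpha>) - indicator_vector lbl (arc_minus n \<alpha>))"

definition c_vector :: "('d::finite \<Rightarrow> nat) \<Rightarrow> nat \<Rightarrow> arc \<Rightarrow> arc set \<Rightarrow> real ^ 'd" where
  "c_vector lbl n \<alpha> T = (THE v. v \<in> sum_zero_space \<and> v \<bullet> g_vector lbl n \<alpha> = 1 \<and>
     (\<forall>\<beta> \<in> T \<inter> internal_arcs n. \<beta> \<noteq> \<alpha> \<longrightarrow> v \<bullet> g_vector lbl n \<beta> = 0))"

definition p_point :: "('d::finite \<Rightarrow> nat) \<Rightarrow> nat \<Rightarrow> arc set \<Rightarrow> real ^ 'd" where
  "p_point lbl n T = (\<Sum>\<alpha> \<in> T \<inter> internal_arcs n.
     real (incompatibility_number n \<alpha>) *\<^sub>R c_vector lbl n \<alpha> T)"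

section \<open>Fans and polytopes\<close>

definition wiggly_fan :: "('d::finite \<Rightarrow> nat) \<Rightarrow> nat \<Rightarrow> (real ^ 'd) set set" where
  "wiggly_fan lbl n = {convex_cone hull (g_vector lbl n ` D) |D.
     D \<subseteq> internal_arcs n \<and> pairwise_compatible D}"

definition normal_cone :: "'a::real_inner set \<Rightarrow> 'a set \<Rightarrow> 'a set \<Rightarrow> 'a set" where
  "normal_cone V P F = {u \<in> V. \<forall>x\<in>F. \<forall>y\<in>P. u \<bullet> y \<le> u \<bullet> x}"

text \<open>The (outer) normal fan of \<open>P \<subseteq> V\<close>, taken in the linear space \<open>V\<close>.\<close>

definition normal_fan :: "'a::real_inner set \<Rightarrow> 'a set \<Rightarrow> 'a set set" where
  "normal_fan V P = {normal_cone V P F |F. F face_of P \<and> F \<noteq> {}}"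

definition simple_polytope :: "'a::euclidean_space set \<Rightarrow> bool" where
  "simple_polytope P \<longleftrightarrow> polytope P \<and>
     (\<forall>v. v extreme_point_of P \<longrightarrow> int (card {F. F facet_of P \<and> v \<in> F}) = aff_dim P)"

end

theory Submission
  imports Defs
begin

text \<open>Incompatible arcs can be exchanged: exchanging the tails of two arcs after a crossing, or joining two
  arcs at a common point in the two possible ways, gives arcs \<open>\<gamma>\<close>, \<open>\<delta>\<close> with
  \<open>g \<gamma> + g \<delta> = c (g \<alpha> + g \<beta>)\<close> and \<open>\<kappa> \<gamma> + \<kappa> \<delta> < c (\<kappa> \<alpha> + \<kappa> \<beta>)\<close>, where \<open>c\<close> is 1 or 2. Hence the arcs whose
  inequalities are tight at a given point of the polytope are pairwise compatible. Conversely, a nonnegative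
  combination of the \<open>g\<close> vectors of compatible arcs determines its coefficients, because a weighted compatible
  family is a stack of strands, which can be reconstructed from left to right. By Farkas' lemma these two facts
  identify the sets of compatible arcs with the sets of inequalities that are exactly the tight ones at some
  point of the polytope; neither flips nor wall-crossing inequalities are needed.\<close>

section \<open>Polytopes with an exchange property\<close>

text \<open>The difficulty is to control the degree against an arbitrary third arc. An arc is
  therefore replaced by its \<open>height\<close> at each point, and the degree becomes the number
  of sign changes of a height difference plus the number of coincidences of a start with an end. If
  two arcs are cut between consecutive points of opposite order, they agree strictly between these
  points, so a third arc cannot change sides more often with the new arcs than with the old ones;
  the strict loss comes from the degree against one of the two exchanged arcs themselves. The factor
  2 belongs to joining: the heights at the common point cancel only if the arc passing above it and
  the arc passing below it are taken together, and these contain \<alpha> and \<beta> twice. An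
  exchange may produce external arcs, which is harmless because their \<open>g\<close> vectors have
  inner product 0 with every point of the space. Completeness of the fan needs no separate argument:
  every linear functional attains its maximum on the bounded polytope. Reconstruction of the weights
  is an induction on \<open>n\<close> because compatibility survives when arcs are cut at their last
  point.\<close>

lemma strict_halfspaces_perturb:
  fixes g :: "'i \<Rightarrow> 'a::euclidean_space"
  assumes "finite J" "\<And>i. i \<in> J \<Longrightarrow> g i \<bullet> x < \<kappa> i"
  shows "\<exists>e>0. \<forall>i\<in>J. g i \<bullet> (x + e *\<^sub>R y) < \<kappa> i \<and> g i \<bullet> (x - e *\<^sub>R y) < \<kappa> i"
proof -
  have "open (\<Inter>i\<in>J. {z. g i \<bullet> z < \<kappa> i})"
    using assms(1) by (intro open_INT ballI open_halfspace_lt) auto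
  then obtain r where r: "0 < r" "ball x r \<subseteq> (\<Inter>i\<in>J. {z. g i \<bullet> z < \<kappa> i})"
    using assms(2) openE[of _ x] by (metis (mono_tags, lifting) INT_I mem_Collect_eq)
  \<comment> \<open>The summand 1 keeps the denominator positive when \<open>y = 0\<close>; in all
    cases \<open>e *\<^sub>R y\<close> is shorter than \<open>r\<close>.\<close>
  define e where "e = r / (2 * (norm y + 1))"
  have e: "0 < e" using r by (simp add: e_def add_nonneg_pos)
  have "norm (e *\<^sub>R y) = r * (norm y / (2 * (norm y + 1)))" using r by (simp add: e_def)
  also have "\<dots> < r * 1"
    using r(1) by (intro mult_strict_left_mono) (auto simp: divide_simps add_nonneg_pos intro: add_nonneg_pos)
  finally have "norm (e *\<^sub>R y) < r" by simp
  then have "x + e *\<^sub>R y \<in> ball x r" "x - e *\<^sub>R y \<in> ball x r" by (auto simp: dist_norm)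
  then show ?thesis using r e by blast
qed

section \<open>Finitely generated cones and linear functionals on a subspace\<close>

text \<open>Coefficients are attached to indices rather than to vectors, which is the form in which
  \<open>unique\<close> compares two combinations even where \<open>g\<close> is not
  injective.\<close>

lemma in_convex_cone_hull_image_iff:
  fixes g :: "'i \<Rightarrow> 'a::real_vector"
  assumes "finite D"
  shows "u \<in> convex_cone hull (g ` D) \<longleftrightarrow> (\<exists>c. (\<forall>i\<in>D. 0 \<le> c i) \<and> u = (\<Sum>i\<in>D. c i *\<^sub>R g i))"
proof -
  let ?S = "{u. \<exists>c. (\<forall>i\<in>D. 0 \<le> c i) \<and> u = (\<Sum>i\<in>D. c i *\<^sub>R g i)}"
  have "u \<in> convex_cone hull (g ` D) \<longleftrightarrow> u \<in> ?S"
proof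
  show "u \<in> ?S" if "u \<in> convex_cone hull (g ` D)"
  proof -
    have "convex_cone ?S"
      unfolding convex_cone_iff
    proof (intro conjI ballI allI impI)
      show "0 \<in> ?S" by (auto intro!: exI[of _ "\<lambda>_. 0"])
    next
      fix x y assume "x \<in> ?S" "y \<in> ?S"
      then obtain c c' where "\<forall>i\<in>D. 0 \<le> c i" "x = (\<Sum>i\<in>D. c i *\<^sub>R g i)"
        "\<forall>i\<in>D. 0 \<le> c' i" "y = (\<Sum>i\<in>D. c' i *\<^sub>R g i)" by auto
      then show "x + y \<in> ?S"
        by (auto intro!: exI[of _ "\<lambda>i. c i + c' i"] simp: scaleR_add_left sum.distrib)
    next
      fix x and t :: real assume "x \<in> ?S" "0 \<le> t"
      then obtain c where "\<forall>i\<in>D. 0 \<le> c i" "x = (\<Sum>i\<in>D. c i *\<^sub>R g i)" by auto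
      then show "t *\<^sub>R x \<in> ?S" using \<open>0 \<le> t\<close>
        by (auto intro!: exI[of _ "\<lambda>i. t * c i"] simp: scaleR_sum_right)
    qed
    moreover have "g ` D \<subseteq> ?S"
    proof (intro image_subsetI)
      fix j assume j: "j \<in> D"
      have "(\<Sum>i\<in>D. (if i = j then 1 else 0::real) *\<^sub>R g i) = (\<Sum>i\<in>D. if j = i then g i else 0)"
        by (intro sum.cong) auto
      then have "g j = (\<Sum>i\<in>D. (if i = j then 1 else 0::real) *\<^sub>R g i)"
        using j assms by simp
      then show "g j \<in> ?S" by (auto intro!: exI[of _ "\<lambda>i. if i = j then 1 else 0::real"])
    qed
    ultimately show ?thesis using that hull_minimal[of "g ` D" ?S convex_cone] by blast
  qed
next
  assume "u \<in> ?S"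
  then obtain c where c: "\<forall>i\<in>D. 0 \<le> c i" "u = (\<Sum>i\<in>D. c i *\<^sub>R g i)" by auto
  have "(\<Sum>i\<in>E. c i *\<^sub>R g i) \<in> convex_cone hull (g ` D)" if "E \<subseteq> D" for E
    using finite_subset[OF that assms] that
  proof (induction E rule: finite_induct)
    case empty
    then show ?case by (simp add: convex_cone_hull_contains_0)
  next
    case (insert i E)
    then have "c i *\<^sub>R g i \<in> convex_cone hull (g ` D)"
      using c(1) by (intro convex_cone_hull_mul hull_inc) auto
    then show ?case using insert by (simp add: convex_cone_hull_add)
  qed
  then show "u \<in> convex_cone hull (g ` D)" using c by blast
qed
  then show ?thesis by simp
qed

text \<open>The vector from the closest point \<open>z\<close> of the cone to \<open>u\<close>
  separates. It is orthogonal to \<open>z\<close> because the cone contains both 0 and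
  \<open>2 *\<^sub>R z\<close>, hence its product with \<open>u\<close> is its squared norm. It has
  to lie in \<open>V\<close>, since it will serve as a direction of motion inside
  \<open>V\<close>.\<close>

lemma not_in_convex_cone_hull_separation:
  fixes S :: "'a::euclidean_space set"
  assumes "finite S" "u \<notin> convex_cone hull S" "subspace V" "S \<subseteq> V" "u \<in> V"
  obtains y where "y \<in> V" "0 < y \<bullet> u" "\<And>s. s \<in> S \<Longrightarrow> y \<bullet> s \<le> 0"
proof -
  let ?K = "convex_cone hull S"
  have cl: "closed ?K" "?K \<noteq> {}" "convex ?K"
    using assms(1) by (simp_all add: closed_convex_cone_hull convex_cone_hull_nonempty convex_convex_cone_hull)
  define z where "z = closest_point ?K u"
  define y where "y = u - z"
  have z: "z \<in> ?K" unfolding z_def using cl by (intro closest_point_in_set)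
  have dot: "y \<bullet> (k - z) \<le> 0" if "k \<in> ?K" for k
    unfolding y_def z_def using closest_point_dot[OF cl(3,1) that] .
  have "y \<bullet> z = 0"
  proof -
    have "2 *\<^sub>R z \<in> ?K" using z by (intro convex_cone_hull_mul) auto
    then have "y \<bullet> z \<le> 0" using dot[of "2 *\<^sub>R z"] by (simp add: scaleR_2)
    moreover have "y \<bullet> z \<ge> 0" using dot[OF convex_cone_hull_contains_0] by simp
    ultimately show ?thesis by simp
  qed
  moreover have "y \<noteq> 0" using z assms(2) by (auto simp: y_def)
  ultimately have "0 < y \<bullet> u"
    by (metis add.right_neutral diff_add_cancel inner_add_right inner_gt_zero_iff y_def)
  moreover have "y \<in> V"
  proof -
    have "?K \<subseteq> V" using assms(3,4) by (simp add: hull_minimal subspace_imp_convex_cone)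
    then show ?thesis using z assms by (auto simp: y_def intro: subspace_diff)
  qed
  moreover have "y \<bullet> s \<le> 0" if "s \<in> S" for s
    using dot[of "z + s"] z that by (simp add: convex_cone_hull_add hull_inc)
  ultimately show ?thesis using that by blast
qed

text \<open>Riesz representation inside \<open>V\<close>: the vector representing \<open>L\<close>
  on the whole space is projected onto \<open>V\<close>.\<close>

lemma subspace_inner_representation:
  fixes V :: "'a::euclidean_space set" and L :: "'a \<Rightarrow> real"
  assumes "linear L" "subspace V"
  shows "\<exists>y\<in>V. \<forall>x\<in>V. x \<bullet> y = L x"
proof -
  define w where "w = adjoint L 1"
  obtain y z where yz: "y \<in> span V" "\<And>v. v \<in> span V \<Longrightarrow> orthogonal z v" "w = y + z"
    using orthogonal_subspace_decomp_exists[of V w] by blast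
  have "x \<bullet> y = L x" if "x \<in> V" for x
  proof -
    have "L x = x \<bullet> w" using adjoint_works[OF assms(1), of x 1] by (simp add: w_def)
    also have "\<dots> = x \<bullet> y" using yz(2)[of x] that
      by (simp add: yz(3) inner_add_right orthogonal_def inner_commute span_base)
    finally show ?thesis by simp
  qed
  then show ?thesis using yz(1) assms(2) by (auto simp: span_eq_iff[THEN iffD2])
qed

section \<open>The abstract polytope and its active sets\<close>

text \<open>\<open>exchange\<close> speaks only of points of the polytope, so any argument with
  valid inequalities may establish it. \<open>unique\<close> says at once that the cones of
  compatible sets are simplicial and that two of them meet in the cone of the common
  generators.\<close>

locale exchange_fan =
  fixes V :: "'a::euclidean_space set" and I :: "'i set" and g :: "'i \<Rightarrow> 'a"
    and \<kappa> :: "'i \<Rightarrow> real" and compat :: "'i \<Rightarrow> 'i \<Rightarrow> bool"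
  assumes subspace: "subspace V" and finite_I: "finite I"
    and g_in: "\<And>i. i \<in> I \<Longrightarrow> g i \<in> V"
    and \<kappa>_pos: "\<And>i. i \<in> I \<Longrightarrow> 0 < \<kappa> i"
    and compat_refl: "\<And>i. i \<in> I \<Longrightarrow> compat i i"
    and bounded_halfspaces: "bounded {x \<in> V. \<forall>i\<in>I. g i \<bullet> x \<le> \<kappa> i}"
    and exchange: "\<And>x i j. \<lbrakk>x \<in> V; \<forall>k\<in>I. g k \<bullet> x \<le> \<kappa> k; i \<in> I; j \<in> I;
          g i \<bullet> x = \<kappa> i; g j \<bullet> x = \<kappa> j\<rbrakk> \<Longrightarrow> compat i j"
    and unique: "\<And>c d i. \<lbrakk>\<forall>i\<in>I. 0 \<le> c i; \<forall>i\<in>I. 0 \<le> d i;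
          \<forall>i\<in>I. \<forall>j\<in>I. c i \<noteq> 0 \<and> c j \<noteq> 0 \<longrightarrow> compat i j;
          \<forall>i\<in>I. \<forall>j\<in>I. d i \<noteq> 0 \<and> d j \<noteq> 0 \<longrightarrow> compat i j;
          (\<Sum>i\<in>I. c i *\<^sub>R g i) = (\<Sum>i\<in>I. d i *\<^sub>R g i); i \<in> I\<rbrakk> \<Longrightarrow> c i = d i"
begin

definition W :: "'a set" where
  "W = {x \<in> V. \<forall>i\<in>I. g i \<bullet> x \<le> \<kappa> i}"

definition active :: "'a \<Rightarrow> 'i set" where
  "active x = {i \<in> I. g i \<bullet> x = \<kappa> i}"

definition compatible_set :: "'i set \<Rightarrow> bool" where
  "compatible_set D \<longleftrightarrow> D \<subseteq> I \<and> (\<forall>i\<in>D. \<forall>j\<in>D. compat i j)"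

lemma in_WD: "x \<in> W \<Longrightarrow> x \<in> V" "x \<in> W \<Longrightarrow> i \<in> I \<Longrightarrow> g i \<bullet> x \<le> \<kappa> i"
  by (auto simp: W_def)

lemma compatible_setD: "compatible_set D \<Longrightarrow> D \<subseteq> I" "compatible_set D \<Longrightarrow> finite D"
  using finite_I by (auto simp: compatible_set_def dest: finite_subset)

lemma active_subset: "active x \<subseteq> I" and finite_active: "finite (active x)"
  using finite_I by (auto simp: active_def)

lemma compatible_set_active: "x \<in> W \<Longrightarrow> compatible_set (active x)"
  using exchange[of x] by (auto simp: compatible_set_def active_def W_def)

lemma W_eq: "W = V \<inter> (\<Inter>i\<in>I. {x. g i \<bullet> x \<le> \<kappa> i})"
  by (auto simp: W_def)

lemma polytope_W: "polytope W"
proof -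
  have "polyhedron (\<Inter>i\<in>I. {x. g i \<bullet> x \<le> \<kappa> i})"
    using finite_I by (intro polyhedron_Inter) (auto simp: polyhedron_halfspace_le)
  moreover have "polyhedron V" using subspace by (simp add: subspace_imp_affine affine_imp_polyhedron)
  ultimately have "polyhedron W" unfolding W_eq by (rule polyhedron_Int[rotated])
  then show ?thesis using bounded_halfspaces unfolding polytope_eq_bounded_polyhedron W_def by blast
qed

lemmas compact_W = polytope_imp_compact[OF polytope_W]
lemmas convex_W = polytope_imp_convex[OF polytope_W]

lemma zero_in_W: "0 \<in> W"
  using subspace \<kappa>_pos by (auto simp: W_def subspace_0 less_imp_le)

text \<open>Only the active inequalities can obstruct a small motion within \<open>V\<close>. Both
  directions are provided, because a vertex is tested by moving to and fro.\<close>

lemma perturb: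
  assumes "x \<in> W" "y \<in> V"
  shows "\<exists>e>0. (\<forall>i\<in>I - active x. g i \<bullet> (x + e *\<^sub>R y) < \<kappa> i \<and> g i \<bullet> (x - e *\<^sub>R y) < \<kappa> i) \<and>
    x + e *\<^sub>R y \<in> V \<and> x - e *\<^sub>R y \<in> V"
proof -
  have "g i \<bullet> x < \<kappa> i" if "i \<in> I - active x" for i
    using that in_WD(2)[OF assms(1), of i] by (auto simp: active_def)
  then obtain e where "0 < e"
    "\<forall>i\<in>I - active x. g i \<bullet> (x + e *\<^sub>R y) < \<kappa> i \<and> g i \<bullet> (x - e *\<^sub>R y) < \<kappa> i"
    using strict_halfspaces_perturb[of "I - active x" g x \<kappa> y] finite_I by auto
  moreover have "x + e *\<^sub>R y \<in> V" "x - e *\<^sub>R y \<in> V"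
    using subspace assms in_WD(1) by (simp_all add: subspace_add subspace_diff subspace_scale)
  ultimately show ?thesis by blast
qed

text \<open>If \<open>u\<close> were outside the cone, a separating direction \<open>y\<close> would
  increase \<open>u\<close> without violating any active inequality, and a short step along
  \<open>y\<close> would stay in \<open>W\<close>, contradicting the maximality of
  \<open>x\<close>.\<close>

lemma farkas:
  assumes "x \<in> W" "u \<in> V" "\<And>y. y \<in> W \<Longrightarrow> u \<bullet> y \<le> u \<bullet> x"
  shows "u \<in> convex_cone hull (g ` active x)"
proof (rule ccontr)
  assume neg: "\<not> ?thesis"
  have gV: "g ` active x \<subseteq> V" using g_in active_subset by auto
  obtain y where y: "y \<in> V" "0 < y \<bullet> u" "\<And>s. s \<in> g ` active x \<Longrightarrow> y \<bullet> s \<le> 0"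
    using not_in_convex_cone_hull_separation[OF finite_imageI[OF finite_active] neg subspace gV assms(2)] by blast
  obtain e where e: "0 < e" "\<forall>i\<in>I - active x. g i \<bullet> (x + e *\<^sub>R y) < \<kappa> i"
    "\<forall>i\<in>I - active x. g i \<bullet> (x - e *\<^sub>R y) < \<kappa> i" "x + e *\<^sub>R y \<in> V" "x - e *\<^sub>R y \<in> V"
    using perturb[OF assms(1) y(1)] by blast
  have "x + e *\<^sub>R y \<in> W"
    unfolding W_def
  proof (intro CollectI conjI ballI e(4))
    fix i assume "i \<in> I"
    show "g i \<bullet> (x + e *\<^sub>R y) \<le> \<kappa> i"
    proof (cases "i \<in> active x")
      case True
      then have "g i \<bullet> y \<le> 0" using y(3)[of "g i"] by (simp add: inner_commute)
      then have "e * (g i \<bullet> y) \<le> 0" using e(1) by (simp add: mult_nonneg_nonpos)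
      then show ?thesis using True by (simp add: inner_add_right active_def)
    qed (use e(2) \<open>i \<in> I\<close> in \<open>simp add: less_imp_le\<close>)
  qed
  then have "e * (u \<bullet> y) \<le> 0" using assms(3) by (fastforce simp: inner_add_right)
  then show False using y(2) e(1) by (simp add: inner_commute mult_le_0_iff)
qed

lemma unique_on:
  assumes "compatible_set D" "compatible_set E" "\<And>i. i \<in> D \<Longrightarrow> 0 \<le> c i" "\<And>i. i \<in> E \<Longrightarrow> 0 \<le> d i"
    and eq: "(\<Sum>i\<in>D. c i *\<^sub>R g i) = (\<Sum>i\<in>E. d i *\<^sub>R g i)" and "i \<in> D \<union> E"
  shows "(if i \<in> D then c i else 0) = (if i \<in> E then d i else 0)"
proof (rule unique)
  have *: "(\<Sum>i\<in>I. (if i \<in> X then f i else 0) *\<^sub>R g i) = (\<Sum>i\<in>X. f i *\<^sub>R g i)" if "X \<subseteq> I"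
    for X :: "'i set" and f :: "'i \<Rightarrow> real"
    using that finite_I by (intro sum.mono_neutral_cong_right) auto
  show "(\<Sum>i\<in>I. (if i \<in> D then c i else 0) *\<^sub>R g i) = (\<Sum>i\<in>I. (if i \<in> E then d i else 0) *\<^sub>R g i)"
    using eq assms(1,2) by (simp add: * compatible_setD(1))
qed (use assms in \<open>auto simp: compatible_set_def\<close>)

text \<open>The positive and the negative part of the coefficients give two nonnegative combinations
  over the same compatible set. By uniqueness the parts agree, and a number whose positive and
  negative parts agree is 0.\<close>

lemma linear_independence:
  assumes "compatible_set D" "(\<Sum>i\<in>D. c i *\<^sub>R g i) = 0" "i \<in> D"
  shows "c i = 0"
proof -
  have "(\<Sum>i\<in>D. c i *\<^sub>R g i) = (\<Sum>i\<in>D. max (c i) 0 *\<^sub>R g i) - (\<Sum>i\<in>D. max (- c i) 0 *\<^sub>R g i)"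
    unfolding sum_subtractf[symmetric] by (intro sum.cong) (auto simp: max_def simp flip: scaleR_left_diff_distrib)
  then have "(\<Sum>i\<in>D. max (c i) 0 *\<^sub>R g i) = (\<Sum>i\<in>D. max (- c i) 0 *\<^sub>R g i)"
    using assms(2) by simp
  then have "max (c i) 0 = max (- c i) 0"
    using unique_on[OF assms(1,1), of "\<lambda>i. max (c i) 0" "\<lambda>i. max (- c i) 0" i] assms(3) by auto
  then show ?thesis by auto
qed

lemma inj_on_g:
  assumes "compatible_set D"
  shows "inj_on g D"
proof (rule inj_onI, rule ccontr)
  fix i j assume ij: "i \<in> D" "j \<in> D" "g i = g j" "i \<noteq> j"
  have "(\<Sum>k\<in>D. (if k = i then 1 else if k = j then - 1 else 0::real) *\<^sub>R g k)
      = (\<Sum>k\<in>{i, j}. (if k = i then 1 else if k = j then - 1 else 0::real) *\<^sub>R g k)"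
    using ij assms by (intro sum.mono_neutral_right) (auto simp: compatible_setD)
  also have "\<dots> = 0" using ij by simp
  finally show False using linear_independence[OF assms _ ij(1)] by fastforce
qed

lemma independent_g:
  assumes "compatible_set D"
  shows "independent (g ` D)"
proof -
  have "u (g i) = 0" if "(\<Sum>v\<in>g ` D. u v *\<^sub>R v) = 0" "i \<in> D" for u i
    using linear_independence[OF assms, of "u \<circ> g" i] that
    by (simp add: sum.reindex[OF inj_on_g[OF assms]])
  then show ?thesis
    using assms by (auto simp: dependent_finite compatible_setD)
qed

text \<open>Linear independence allows the products with the \<open>g i\<close>,
  \<open>i \<in> D\<close>, to be chosen freely. This yields directions that relax any chosen
  inequalities while keeping the others tight, and also the dual basis.\<close>

lemma prescribed_inner:
  assumes "compatible_set D"
  shows "\<exists>y\<in>V. \<forall>i\<in>D. g i \<bullet> y = f i"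
proof -
  obtain L :: "'a \<Rightarrow> real" where L: "linear L" "\<forall>x\<in>g ` D. L x = f (inv_into D g x)"
    using linear_independent_extend[OF independent_g[OF assms], of "\<lambda>x. f (inv_into D g x)"] by auto
  obtain y where y: "y \<in> V" "\<forall>x\<in>V. x \<bullet> y = L x"
    using subspace_inner_representation[OF L(1) subspace] by auto
  then have "g i \<bullet> y = f i" if "i \<in> D" for i
    using that L(2) g_in compatible_setD(1)[OF assms] inj_on_g[OF assms]
    by (auto simp: inv_into_f_f)
  then show ?thesis using y by blast
qed

lemma card_le_dim: "compatible_set D \<Longrightarrow> card D \<le> dim V"
  using independent_card_le_dim[OF _ independent_g] g_in compatible_setD(1) card_image[OF inj_on_g]
  by (metis image_subset_iff subset_iff)

section \<open>Vertices and their active sets\<close>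

lemma extreme_point_in_W: "v extreme_point_of W \<Longrightarrow> v \<in> W"
  by (simp add: extreme_point_of_def)

text \<open>Otherwise \<open>v\<close> would be the midpoint of two points of \<open>W\<close>:
  moving along \<open>y\<close> in either direction leaves the active inequalities tight.\<close>

lemma extreme_point_orthogonal:
  assumes "v extreme_point_of W" "y \<in> V" "\<And>i. i \<in> active v \<Longrightarrow> g i \<bullet> y = 0"
  shows "y = 0"
proof (rule ccontr)
  assume "y \<noteq> 0"
  have v: "v \<in> W" using assms(1) by (rule extreme_point_in_W)
  obtain e where e: "0 < e" "\<forall>i\<in>I - active v. g i \<bullet> (v + e *\<^sub>R y) < \<kappa> i"
    "\<forall>i\<in>I - active v. g i \<bullet> (v - e *\<^sub>R y) < \<kappa> i" "v + e *\<^sub>R y \<in> V" "v - e *\<^sub>R y \<in> V"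
    using perturb[OF v assms(2)] by blast
  have "g i \<bullet> (v + e *\<^sub>R y) \<le> \<kappa> i \<and> g i \<bullet> (v - e *\<^sub>R y) \<le> \<kappa> i" if "i \<in> I" for i
  proof (cases "i \<in> active v")
    case True
    then show ?thesis using assms(3)[of i] in_WD(2)[OF v that] by (simp add: inner_add_right inner_diff_right)
  qed (use e(2,3) that in \<open>simp add: less_imp_le\<close>)
  then have "v + e *\<^sub>R y \<in> W" "v - e *\<^sub>R y \<in> W" using e(4,5) by (auto simp: W_def)
  moreover have "v \<in> open_segment (v - e *\<^sub>R y) (v + e *\<^sub>R y)"
  proof -
    have "v = midpoint (v - e *\<^sub>R y) (v + e *\<^sub>R y)"
      by (simp add: midpoint_def algebra_simps flip: scaleR_2)
    moreover have "v - e *\<^sub>R y \<noteq> v + e *\<^sub>R y"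
    proof
      assume "v - e *\<^sub>R y = v + e *\<^sub>R y"
      then have "(2 * e) *\<^sub>R y = 0" by (metis add_diff_cancel_left' diff_add_cancel minus_diff_eq scaleR_2 scaleR_scaleR diff_self add_diff_eq)
      then show False using e(1) \<open>y \<noteq> 0\<close> by simp
    qed
    ultimately show ?thesis by (metis midpoint_in_open_segment)
  qed
  ultimately show False using assms(1) unfolding extreme_point_of_def by blast
qed

lemma span_active_extreme:
  assumes "v extreme_point_of W"
  shows "V \<subseteq> span (g ` active v)"
proof
  fix x assume "x \<in> V"
  obtain y z where yz: "y \<in> span (g ` active v)" "\<And>w. w \<in> span (g ` active v) \<Longrightarrow> orthogonal z w" "x = y + z"
    using orthogonal_subspace_decomp_exists[of "g ` active v" x] by blast
  have "span (g ` active v) \<subseteq> V" using subspace g_in active_subset by (intro span_minimal) auto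
  then have "z \<in> V" using yz \<open>x \<in> V\<close> subspace_diff[OF subspace, of x y] by auto
  moreover have "g i \<bullet> z = 0" if "i \<in> active v" for i
    using yz(2)[of "g i"] that by (simp add: span_base orthogonal_def inner_commute)
  ultimately have "z = 0" using extreme_point_orthogonal[OF assms] by blast
  then show "x \<in> span (g ` active v)" using yz by simp
qed

text \<open>The active \<open>g\<close> vectors are independent because tight indices are
  compatible, and they span \<open>V\<close> because \<open>v\<close> is extreme. This is the reason
  for the simplicity of \<open>W\<close>.\<close>

lemma card_active_extreme:
  assumes "v extreme_point_of W"
  shows "card (active v) = dim V"
proof -
  have D: "compatible_set (active v)" using assms by (intro compatible_set_active extreme_point_in_W)
  have "card (g ` active v) = dim V"
    using span_active_extreme[OF assms] independent_g[OF D] g_in active_subset by (intro basis_card_eq_dim) auto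
  then show ?thesis by (simp add: card_image inj_on_g[OF D])
qed

lemma active_extreme_maximal:
  assumes "v extreme_point_of W" "compatible_set D" "active v \<subseteq> D"
  shows "D = active v"
  using card_le_dim[OF assms(2)] card_active_extreme[OF assms(1)] assms compatible_setD(2)
  by (metis card_subset_eq card_mono le_antisym)

text \<open>A maximiser of the sum of \<open>g i\<close> over \<open>i \<in> D\<close> writes this sum as a nonnegative combination over
  its own active set, and uniqueness of compatible decompositions forces \<open>D\<close> into that set.\<close>

lemma compatible_set_subset_active:
  assumes "compatible_set D"
  obtains v where "v extreme_point_of W" "D \<subseteq> active v"
proof -
  define u where "u = (\<Sum>i\<in>D. g i)"
  have "u \<in> V" unfolding u_def using g_in compatible_setD(1)[OF assms] by (intro subspace_sum[OF subspace]) auto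
  have "\<exists>x\<in>W. \<forall>y\<in>W. u \<bullet> y \<le> u \<bullet> x"
    using compact_W zero_in_W by (intro continuous_attains_sup) (auto intro!: continuous_intros)
  then obtain x where x: "x \<in> W" "\<And>y. y \<in> W \<Longrightarrow> u \<bullet> y \<le> u \<bullet> x" by blast
  \<comment> \<open>The maximiser \<open>x\<close> need not be a vertex, but an extreme point of the
    face of all maximisers is a vertex of \<open>W\<close> with the same value.\<close>
  define F where "F = W \<inter> {y. u \<bullet> y = u \<bullet> x}"
  have F: "F face_of W" unfolding F_def
    by (intro face_of_Int_supporting_hyperplane_le convex_W x(2))
  have "x \<in> F" using x by (simp add: F_def)
  then obtain v where v: "v extreme_point_of F"
    using extreme_point_exists_convex[of F] face_of_imp_compact[OF convex_W compact_W F] face_of_imp_convex[OF F] by blast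
  then have "v \<in> F" by (simp add: extreme_point_of_def)
  have vW: "v extreme_point_of W" using v F by (simp add: extreme_point_of_face)
  have "v \<in> W" using \<open>v \<in> F\<close> by (simp add: F_def)
  have "u \<in> convex_cone hull (g ` active v)"
  proof (rule farkas[OF \<open>v \<in> W\<close> \<open>u \<in> V\<close>])
    fix y assume "y \<in> W"
    then show "u \<bullet> y \<le> u \<bullet> v" using x(2) \<open>v \<in> F\<close> by (simp add: F_def)
  qed
  then obtain c where c: "\<forall>i\<in>active v. 0 \<le> c i" "u = (\<Sum>i\<in>active v. c i *\<^sub>R g i)"
    using in_convex_cone_hull_image_iff[OF finite_active] by blast
  have "i \<in> active v" if "i \<in> D" for i
  proof (rule ccontr)
    assume "i \<notin> active v"
    then show False
      using unique_on[OF assms compatible_set_active[OF \<open>v \<in> W\<close>], of "\<lambda>_. 1" c i] c that by (simp add: u_def)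
  qed
  then show ?thesis using that[OF vW] by blast
qed

lemma active_eq_exists:
  assumes "compatible_set D"
  obtains x where "x \<in> W" "active x = D"
proof -
  obtain v where v: "v extreme_point_of W" "D \<subseteq> active v"
    using compatible_set_subset_active[OF assms] by blast
  have vW: "v \<in> W" using v(1) by (rule extreme_point_in_W)
  obtain y where y: "y \<in> V" "\<forall>i\<in>active v. g i \<bullet> y = (if i \<in> D then 0 else -1)"
    using prescribed_inner[OF compatible_set_active[OF vW], of "\<lambda>i. if i \<in> D then 0 else -1"] by auto
  obtain e where e: "0 < e" "\<forall>i\<in>I - active v. g i \<bullet> (v + e *\<^sub>R y) < \<kappa> i"
    "\<forall>i\<in>I - active v. g i \<bullet> (v - e *\<^sub>R y) < \<kappa> i" "v + e *\<^sub>R y \<in> V" "v - e *\<^sub>R y \<in> V"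
    using perturb[OF vW y(1)] by blast
  have *: "g i \<bullet> (v + e *\<^sub>R y) = \<kappa> i" if "i \<in> D" for i
    using that v(2) y(2) by (auto simp: inner_add_right active_def)
  have **: "g i \<bullet> (v + e *\<^sub>R y) < \<kappa> i" if "i \<in> I" "i \<notin> D" for i
  proof (cases "i \<in> active v")
    case True
    then show ?thesis using e(1) y(2) that by (simp add: inner_add_right active_def)
  qed (use e(2) that in auto)
  have "g i \<bullet> (v + e *\<^sub>R y) \<le> \<kappa> i" if "i \<in> I" for i
    using *[of i] **[of i] that by (cases "i \<in> D") auto
  then have "v + e *\<^sub>R y \<in> W" using e(4) by (simp add: W_def)
  moreover have "active (v + e *\<^sub>R y) = D"
    using * ** compatible_setD(1)[OF assms] unfolding active_def by fastforce
  ultimately show ?thesis using that by blast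
qed

text \<open>A single supporting hyperplane suffices: the sum of the inequalities over
  \<open>D\<close> is tight only where each of them is.\<close>

lemma face_active:
  assumes "compatible_set D"
  shows "{y \<in> W. \<forall>i\<in>D. g i \<bullet> y = \<kappa> i} face_of W"
proof -
  have D: "D \<subseteq> I" "finite D" using compatible_setD[OF assms] by auto
  have "W \<inter> {y. (\<Sum>i\<in>D. g i) \<bullet> y = (\<Sum>i\<in>D. \<kappa> i)} face_of W"
    using D in_WD(2) by (intro face_of_Int_supporting_hyperplane_le convex_W) (auto simp: inner_sum_left intro!: sum_mono)
  moreover have "W \<inter> {y. (\<Sum>i\<in>D. g i) \<bullet> y = (\<Sum>i\<in>D. \<kappa> i)} = {y \<in> W. \<forall>i\<in>D. g i \<bullet> y = \<kappa> i}"
  proof -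
    have "g i \<bullet> y = \<kappa> i" if "y \<in> W" "(\<Sum>i\<in>D. g i \<bullet> y) = (\<Sum>i\<in>D. \<kappa> i)" "i \<in> D" for y i
      using sum_mono_inv[OF that(2) _ that(3) D(2)] in_WD(2)[OF that(1)] D(1) by blast
    then show ?thesis by (auto simp: inner_sum_left)
  qed
  ultimately show ?thesis by simp
qed

section \<open>Normal fan, dimension and facets\<close>

lemma convex_cone_normal_cone: "convex_cone (normal_cone V P F)"
  using subspace unfolding convex_cone_iff normal_cone_def
  by (auto simp: subspace_0 subspace_add subspace_scale inner_add_left add_mono mult_left_mono)

text \<open>The third hypothesis makes \<open>x\<close> a generic point of \<open>F\<close>:
  whatever is tight at \<open>x\<close> is tight on all of \<open>F\<close>. The Farkas cone at
  \<open>x\<close> then consists of functionals that are maximal on the whole of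
  \<open>F\<close>.\<close>

lemma normal_cone_eq:
  assumes "x \<in> F" "F \<subseteq> W" "\<And>y i. y \<in> F \<Longrightarrow> i \<in> active x \<Longrightarrow> g i \<bullet> y = \<kappa> i"
  shows "normal_cone V W F = convex_cone hull (g ` active x)"
proof
  show "normal_cone V W F \<subseteq> convex_cone hull (g ` active x)"
    using assms farkas by (auto simp: normal_cone_def)
  have "g ` active x \<subseteq> normal_cone V W F"
    using assms g_in in_WD active_subset by (auto simp: normal_cone_def subset_iff)
  then show "convex_cone hull (g ` active x) \<subseteq> normal_cone V W F"
    by (intro hull_minimal convex_cone_normal_cone)
qed

lemma normal_fan_W: "normal_fan V W = {convex_cone hull (g ` D) |D. compatible_set D}"
proof (intro set_eqI iffI)
  fix K assume "K \<in> normal_fan V W"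
  then obtain F where F: "K = normal_cone V W F" "F face_of W" "F \<noteq> {}" by (auto simp: normal_fan_def)
  have FW: "F \<subseteq> W" using F(2) by (rule face_of_imp_subset)
  have cF: "convex F" using F(2) by (rule face_of_imp_convex)
  then obtain x where x: "x \<in> rel_interior F" using F(3) rel_interior_eq_empty by blast
  then have xF: "x \<in> F" using rel_interior_subset by blast
  have "g i \<bullet> y = \<kappa> i" if y: "y \<in> F" and i: "i \<in> active x" for y i
  proof -
    have "i \<in> I" "g i \<bullet> x = \<kappa> i" using i by (auto simp: active_def)
    \<comment> \<open>The segment from \<open>y\<close> to the relative interior point
      \<open>x\<close> can be prolonged beyond \<open>x\<close> inside \<open>F\<close>. An
      inequality tight at \<open>x\<close> and strict at \<open>y\<close> would fail at the
      prolonged point.\<close>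
    obtain e where e: "e > 1" "(1 - e) *\<^sub>R y + e *\<^sub>R x \<in> F"
      using convex_rel_interior_iff[OF cF F(3)] x y by blast
    have "(1 - e) * (g i \<bullet> y) + e * \<kappa> i \<le> \<kappa> i"
      using in_WD(2)[OF _ \<open>i \<in> I\<close>, of "(1 - e) *\<^sub>R y + e *\<^sub>R x"] e(2) FW \<open>g i \<bullet> x = \<kappa> i\<close>
      by (auto simp: inner_add_right)
    then have "(e - 1) * (\<kappa> i - g i \<bullet> y) \<le> 0" by (simp add: algebra_simps)
    then have "\<kappa> i \<le> g i \<bullet> y" using e(1) by (simp add: mult_le_0_iff)
    then show ?thesis using in_WD(2)[OF _ \<open>i \<in> I\<close>, of y] FW y by auto
  qed
  then have "K = convex_cone hull (g ` active x)" using normal_cone_eq[OF xF FW] F(1) by simp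
  then show "K \<in> {convex_cone hull (g ` D) |D. compatible_set D}"
    using compatible_set_active xF FW by blast
next
  fix K assume "K \<in> {convex_cone hull (g ` D) |D. compatible_set D}"
  then obtain D where D: "K = convex_cone hull (g ` D)" "compatible_set D" by blast
  obtain x where x: "x \<in> W" "active x = D" using active_eq_exists[OF D(2)] by blast
  let ?F = "{y \<in> W. \<forall>i\<in>D. g i \<bullet> y = \<kappa> i}"
  have "x \<in> ?F" using x by (auto simp: active_def)
  moreover from this have "K = normal_cone V W ?F"
    using normal_cone_eq[of x ?F] x D(1) by auto
  ultimately show "K \<in> normal_fan V W"
    unfolding normal_fan_def using face_active[OF D(2)] by blast
qed

text \<open>Positivity of all \<kappa> makes every inequality strict at 0, so every vector of
  \<open>V\<close> has a small positive multiple in \<open>W\<close>.\<close>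

lemma affine_hull_W: "affine hull W = V"
proof
  show "affine hull W \<subseteq> V"
    using subspace by (intro hull_minimal) (auto simp: W_def subspace_imp_affine)
  show "V \<subseteq> affine hull W"
  proof
    fix y assume "y \<in> V"
    have "active 0 = {}" using \<kappa>_pos by (force simp: active_def)
    moreover obtain e where "0 < e" "\<forall>i\<in>I - active 0. g i \<bullet> (0 + e *\<^sub>R y) < \<kappa> i" "0 + e *\<^sub>R y \<in> V"
      using perturb[OF zero_in_W \<open>y \<in> V\<close>] by blast
    ultimately have e: "0 < e" "e *\<^sub>R y \<in> W" by (simp_all add: W_def less_imp_le)
    then have "(1 - 1 / e) *\<^sub>R 0 + (1 / e) *\<^sub>R (e *\<^sub>R y) \<in> affine hull W"
      using zero_in_W e(2) by (intro mem_affine[OF affine_affine_hull]) (auto simp: hull_inc)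
    then show "y \<in> affine hull W" using e(1) by simp
  qed
qed

lemma aff_dim_W: "aff_dim W = int (dim V)"
  using aff_dim_affine_hull[of W] aff_dim_subspace[OF subspace] by (simp add: affine_hull_W)

lemma compatible_set_singleton: "i \<in> I \<Longrightarrow> compatible_set {i}"
  using compat_refl by (simp add: compatible_set_def)

lemma g_nonzero: "i \<in> I \<Longrightarrow> g i \<noteq> 0"
  using linear_independence[OF compatible_set_singleton, of i "\<lambda>_. 1" i] by auto

text \<open>No inequality is redundant: near a point where only the \<open>i\<close>-th inequality
  is tight, a small step along \<open>g i\<close> violates this one and no other.\<close>

lemma facet_of_W_iff: "C facet_of W \<longleftrightarrow> (\<exists>i\<in>I. C = W \<inter> {x. g i \<bullet> x = \<kappa> i})"
proof -
  define h where "h = (\<lambda>i. {x. g i \<bullet> x \<le> \<kappa> i})"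
  have violated_only: "\<exists>x\<in>V. x \<notin> h i \<and> (\<forall>j\<in>I - {i}. x \<in> h j)" if i: "i \<in> I" for i
  proof -
    obtain x where x: "x \<in> W" "active x = {i}"
      using active_eq_exists[OF compatible_set_singleton[OF i]] by blast
    obtain e where e: "0 < e" "\<forall>j\<in>I - {i}. g j \<bullet> (x + e *\<^sub>R g i) < \<kappa> j" "x + e *\<^sub>R g i \<in> V"
      using perturb[OF x(1) g_in[OF i]] unfolding x(2) by blast
    have "0 < e * (g i \<bullet> g i)" using e(1) g_nonzero[OF i] by simp
    moreover have "g i \<bullet> x = \<kappa> i" using x(2) by (auto simp: active_def)
    ultimately have "x + e *\<^sub>R g i \<notin> h i" by (simp add: h_def inner_add_right)
    then show ?thesis using e by (intro bexI[of _ "x + e *\<^sub>R g i"]) (auto simp: h_def less_imp_le)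
  qed
  have inj: "inj_on h I"
    using violated_only by (auto simp: inj_on_def)
  \<comment> \<open>\<open>facet_of_polyhedron_explicit\<close> is indexed by the halfspaces
    themselves, so the index has to be recovered from the halfspace; \<open>inj\<close> makes this
    possible.\<close>
  define idx where "idx = inv_into I h"
  have idx: "idx (h i) = i" if "i \<in> I" for i
    using inv_into_f_f[OF inj that] by (simp add: idx_def)
  have "C facet_of W \<longleftrightarrow> (\<exists>H. H \<in> h ` I \<and> C = W \<inter> {x. g (idx H) \<bullet> x = \<kappa> (idx H)})"
  proof (rule facet_of_polyhedron_explicit)
    show "finite (h ` I)" using finite_I by simp
    show "W = affine hull W \<inter> \<Inter> (h ` I)" unfolding affine_hull_W by (auto simp: W_def h_def)
    show "g (idx H) \<noteq> 0 \<and> H = {x. g (idx H) \<bullet> x \<le> \<kappa> (idx H)}" if "H \<in> h ` I" for H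
      using that idx g_nonzero by (auto simp: h_def)
    fix F' assume F': "F' \<subset> h ` I"
    then obtain i where i: "i \<in> I" "h i \<notin> F'" by blast
    then obtain x where x: "x \<in> V" "x \<notin> h i" "\<forall>j\<in>I - {i}. x \<in> h j" using violated_only by blast
    have "x \<in> \<Inter>F'" using F' i x(3) by blast
    moreover have "W \<subseteq> V \<inter> \<Inter>F'" using F' by (fastforce simp: W_def h_def)
    moreover have "x \<notin> W" using x i by (auto simp: W_def h_def)
    ultimately show "W \<subset> affine hull W \<inter> \<Inter>F'" unfolding affine_hull_W using x(1) by blast
  qed
  then show ?thesis using idx by auto
qed

lemma simple_polytope_W: "simple_polytope W"
  unfolding simple_polytope_def
proof (intro conjI allI impI polytope_W)
  fix v assume v: "v extreme_point_of W"
  define C where "C = (\<lambda>i. W \<inter> {x. g i \<bullet> x = \<kappa> i})"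
  have "{F. F facet_of W \<and> v \<in> F} = C ` active v"
    using extreme_point_in_W[OF v] by (auto simp: facet_of_W_iff C_def active_def)
  \<comment> \<open>Distinct indices give distinct facets, because some point of \<open>W\<close> is
    tight for one index alone.\<close>
  moreover have "inj_on C (active v)"
  proof (rule inj_onI)
    fix i j assume ij: "i \<in> active v" "j \<in> active v" "C i = C j"
    then have "i \<in> I" "j \<in> I" using active_subset by auto
    obtain x where x: "x \<in> W" "active x = {i}"
      using active_eq_exists[OF compatible_set_singleton[OF \<open>i \<in> I\<close>]] by blast
    then have "x \<in> C i" by (auto simp: C_def active_def)
    then have "j \<in> active x" using ij(3) \<open>j \<in> I\<close> by (auto simp: C_def active_def)
    then show "i = j" using x by simp
  qed
  ultimately show "int (card {F. F facet_of W \<and> v \<in> F}) = aff_dim W"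
    by (simp add: card_image card_active_extreme[OF v] aff_dim_W)
qed

section \<open>Maximal compatible sets, dual bases and the convex hull\<close>

definition maximal_compatible_set :: "'i set \<Rightarrow> bool" where
  "maximal_compatible_set D \<longleftrightarrow> compatible_set D \<and> (\<forall>E. compatible_set E \<and> D \<subseteq> E \<longrightarrow> E = D)"

text \<open>A maximal compatible set is contained in the compatible active set of a vertex, hence
  equal to it. Conversely, an active set of a vertex already has the largest size that independence
  permits.\<close>

lemma maximal_compatible_set_iff:
  "maximal_compatible_set D \<longleftrightarrow> (\<exists>v. v extreme_point_of W \<and> active v = D)"
proof
  assume D: "maximal_compatible_set D"
  then obtain v where v: "v extreme_point_of W" "D \<subseteq> active v"
    using compatible_set_subset_active[of D] by (auto simp: maximal_compatible_set_def)
  then show "\<exists>v. v extreme_point_of W \<and> active v = D"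
    using D compatible_set_active[OF extreme_point_in_W[OF v(1)]] by (auto simp: maximal_compatible_set_def)
next
  assume "\<exists>v. v extreme_point_of W \<and> active v = D"
  then show "maximal_compatible_set D"
    using compatible_set_active extreme_point_in_W active_extreme_maximal
    unfolding maximal_compatible_set_def by metis
qed

lemma extreme_eqI:
  assumes "v extreme_point_of W" "x \<in> V" "\<And>i. i \<in> active v \<Longrightarrow> g i \<bullet> x = \<kappa> i"
  shows "x = v"
proof -
  have "x - v = 0"
    using assms in_WD(1)[OF extreme_point_in_W[OF assms(1)]] subspace
    by (intro extreme_point_orthogonal[OF assms(1)]) (auto simp: subspace_diff inner_diff_right active_def)
  then show ?thesis by simp
qed

text \<open>This justifies the definite description behind the \<open>c\<close> vectors: existence
  comes from independence of the active \<open>g\<close> vectors, uniqueness from their spanning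
  \<open>V\<close>.\<close>

lemma dual_basis_ex1:
  assumes v: "v extreme_point_of W" and i: "i \<in> active v"
  shows "\<exists>!y. y \<in> V \<and> y \<bullet> g i = 1 \<and> (\<forall>j\<in>active v. j \<noteq> i \<longrightarrow> y \<bullet> g j = 0)"
proof -
  obtain y where y: "y \<in> V" "\<forall>j\<in>active v. g j \<bullet> y = (if j = i then 1 else 0)"
    using prescribed_inner[OF compatible_set_active[OF extreme_point_in_W[OF v]], of "\<lambda>j. if j = i then 1 else 0"] by auto
  show ?thesis
  proof (rule ex1I[of _ y])
    show "y \<in> V \<and> y \<bullet> g i = 1 \<and> (\<forall>j\<in>active v. j \<noteq> i \<longrightarrow> y \<bullet> g j = 0)"
      using y i by (auto simp: inner_commute)
    fix z assume z: "z \<in> V \<and> z \<bullet> g i = 1 \<and> (\<forall>j\<in>active v. j \<noteq> i \<longrightarrow> z \<bullet> g j = 0)"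
    have "z - y = 0"
    proof (rule extreme_point_orthogonal[OF v])
      show "z - y \<in> V" using z y(1) subspace by (auto simp: subspace_diff)
      show "g j \<bullet> (z - y) = 0" if "j \<in> active v" for j
        using z y(2) that by (cases "j = i") (auto simp: inner_diff_right inner_commute)
    qed
    then show "z = y" by simp
  qed
qed

text \<open>The combination satisfies the same tight equations as \<open>v\<close>, and these have
  only one solution in \<open>V\<close>.\<close>

lemma sum_dual_basis:
  assumes v: "v extreme_point_of W"
  shows "(\<Sum>i\<in>active v. \<kappa> i *\<^sub>R
    (THE y. y \<in> V \<and> y \<bullet> g i = 1 \<and> (\<forall>j\<in>active v. j \<noteq> i \<longrightarrow> y \<bullet> g j = 0))) = v"
proof (rule extreme_eqI[OF v])
  define c where "c i = (THE y. y \<in> V \<and> y \<bullet> g i = 1 \<and> (\<forall>j\<in>active v. j \<noteq> i \<longrightarrow> y \<bullet> g j = 0))" for i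
  have c: "c i \<in> V \<and> c i \<bullet> g i = 1 \<and> (\<forall>j\<in>active v. j \<noteq> i \<longrightarrow> c i \<bullet> g j = 0)" if "i \<in> active v" for i
    unfolding c_def by (rule theI'[OF dual_basis_ex1[OF v that]])
  show "(\<Sum>i\<in>active v. \<kappa> i *\<^sub>R c i) \<in> V"
    using c by (intro subspace_sum[OF subspace] subspace_scale[OF subspace]) auto
  show "g j \<bullet> (\<Sum>i\<in>active v. \<kappa> i *\<^sub>R c i) = \<kappa> j" if j: "j \<in> active v" for j
  proof -
    have "g j \<bullet> (\<Sum>i\<in>active v. \<kappa> i *\<^sub>R c i) = (\<Sum>i\<in>active v. if i = j then \<kappa> j else 0)"
      unfolding inner_sum_right using c j by (intro sum.cong) (auto simp: inner_commute)
    then show ?thesis using j finite_active by simp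
  qed
qed

lemma W_eq_convex_hull:
  "W = convex hull {(\<Sum>i\<in>D. \<kappa> i *\<^sub>R
    (THE y. y \<in> V \<and> y \<bullet> g i = 1 \<and> (\<forall>j\<in>D. j \<noteq> i \<longrightarrow> y \<bullet> g j = 0))) |D. maximal_compatible_set D}"
proof -
  have "{(\<Sum>i\<in>D. \<kappa> i *\<^sub>R
    (THE y. y \<in> V \<and> y \<bullet> g i = 1 \<and> (\<forall>j\<in>D. j \<noteq> i \<longrightarrow> y \<bullet> g j = 0))) |D. maximal_compatible_set D}
    = {v. v extreme_point_of W}"
    unfolding maximal_compatible_set_iff using sum_dual_basis by force
  then show ?thesis using Krein_Milman_Minkowski[OF compact_W convex_W] by simp
qed

end

section \<open>Exchanging incompatible arcs\<close>

definition arc_start :: "arc \<Rightarrow> nat" where "arc_start = (\<lambda>(i, j, A, B). i)"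
definition arc_end :: "arc \<Rightarrow> nat" where "arc_end = (\<lambda>(i, j, A, B). j)"
text \<open>\<open>height\<close> is 1 above the line, -1 below it and 0 elsewhere. At a point
  \<open>r\<close> with coordinates \<open>2 * r - 1\<close> and \<open>2 * r\<close>, the
  unprojected \<open>g\<close> vector has the entries \<open>height - turn\<close> and
  \<open>height + turn\<close>, so sums of heights and turns carry all linear relations between
  arcs.\<close>

definition height :: "arc \<Rightarrow> nat \<Rightarrow> real" where
  "height = (\<lambda>(i, j, A, B) r. of_bool (r \<in> A) - of_bool (r \<in> B))"
definition turn :: "arc \<Rightarrow> nat \<Rightarrow> real" where
  "turn = (\<lambda>(i, j, A, B) r. of_bool (r = j) - of_bool (r = i))"

definition is_arc :: "arc \<Rightarrow> bool" where
  "is_arc = (\<lambda>(i, j, A, B). i < j \<and> A \<union> B = {i<..<j} \<and> A \<inter> B = {})"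

lemma wiggly_arcs_iff: "\<alpha> \<in> wiggly_arcs n \<longleftrightarrow> is_arc \<alpha> \<and> arc_end \<alpha> \<le> n + 1"
  by (auto simp: wiggly_arcs_def is_arc_def arc_end_def)

lemma arc_start_less_end: "is_arc \<alpha> \<Longrightarrow> arc_start \<alpha> < arc_end \<alpha>"
  by (auto simp: is_arc_def arc_start_def arc_end_def)

text \<open>The end points have height 0, so the three parts of the definition become one strict
  comparison of heights on the common range of the arcs.\<close>

lemma above_at_eq:
  assumes "is_arc \<alpha>" "is_arc \<beta>"
  shows "above_at \<alpha> \<beta> = {r. max (arc_start \<alpha>) (arc_start \<beta>) \<le> r \<and> r \<le> min (arc_end \<alpha>) (arc_end \<beta>)
    \<and> height \<beta> r < height \<alpha> r}"
proof -
  obtain i j A B where \<alpha>: "\<alpha> = (i, j, A, B)" by (cases \<alpha>)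
  obtain i' j' A' B' where \<beta>: "\<beta> = (i', j', A', B')" by (cases \<beta>)
  have "r \<in> A \<union> B \<longleftrightarrow> i < r \<and> r < j" "\<not> (r \<in> A \<and> r \<in> B)"
    "r \<in> A' \<union> B' \<longleftrightarrow> i' < r \<and> r < j'" "\<not> (r \<in> A' \<and> r \<in> B')" "i < j" "i' < j'" for r
    using assms unfolding \<alpha> \<beta> is_arc_def by auto
  then have "r \<in> above_at \<alpha> \<beta> \<longleftrightarrow> r \<in> {r. max (arc_start \<alpha>) (arc_start \<beta>) \<le> r \<and> r \<le> min (arc_end \<alpha>) (arc_end \<beta>)
    \<and> height \<beta> r < height \<alpha> r}" for r
    unfolding \<alpha> \<beta> above_at_def arc_start_def arc_end_def height_def
    by (cases "r \<in> A"; cases "r \<in> B"; cases "r \<in> A'"; cases "r \<in> B'") (auto simp: less_le)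
  then show ?thesis by blast
qed

lemma above_at_disjoint: "is_arc \<alpha> \<Longrightarrow> is_arc \<beta> \<Longrightarrow> above_at \<alpha> \<beta> \<inter> above_at \<beta> \<alpha> = {}"
  by (auto simp: above_at_eq)

lemma finite_above_at: "is_arc \<alpha> \<Longrightarrow> is_arc \<beta> \<Longrightarrow> finite (above_at \<alpha> \<beta>)"
  by (rule finite_subset[of _ "{..arc_end \<alpha>}"]) (auto simp: above_at_eq)

definition sign_changes :: "nat set \<Rightarrow> nat set \<Rightarrow> nat set" where
  "sign_changes P N = {p. \<exists>q>p. (\<forall>r. p < r \<and> r < q \<longrightarrow> r \<notin> P \<union> N) \<and> (p \<in> P \<and> q \<in> N \<or> p \<in> N \<and> q \<in> P)}"

definition ends_in :: "nat set \<Rightarrow> nat set \<Rightarrow> bool" where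
  "ends_in P N \<longleftrightarrow> (\<exists>p\<in>P. \<forall>r\<in>P \<union> N. r \<le> p)"

definition starts_in :: "nat set \<Rightarrow> nat set \<Rightarrow> bool" where
  "starts_in P N \<longleftrightarrow> (\<exists>p\<in>P. \<forall>r\<in>P \<union> N. p \<le> r)"

text \<open>This is the additional sign change that appears when one sign pattern is followed by
  another: the last sign on the left differs from the first sign on the right.\<close>

definition junction :: "nat set \<Rightarrow> nat set \<Rightarrow> nat set \<Rightarrow> nat set \<Rightarrow> bool" where
  "junction P N P' N' \<longleftrightarrow> ends_in P N \<and> starts_in N' P' \<or> ends_in N P \<and> starts_in P' N'"

lemma sign_changes_commute: "sign_changes P N = sign_changes N P"
  by (auto simp: sign_changes_def)

lemma sign_changes_empty [simp]: "sign_changes {} N = {}" "sign_changes P {} = {}"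
  by (auto simp: sign_changes_def)

lemma sign_changes_subset: "sign_changes P N \<subseteq> P \<union> N"
  by (auto simp: sign_changes_def)

lemma card_sign_changes_Un:
  assumes fin: "finite P" "finite N" "finite P'" "finite N'"
    and less: "\<And>r r'. r \<in> P \<union> N \<Longrightarrow> r' \<in> P' \<union> N' \<Longrightarrow> r < r'"
  shows "card (sign_changes (P \<union> P') (N \<union> N'))
    = card (sign_changes P N) + card (sign_changes P' N') + of_bool (junction P N P' N')"
proof -
  \<comment> \<open>\<open>J\<close> contains the last point of the left block if the sign flips
    across the gap; it is empty or a singleton.\<close>
  define J where "J = {p. (p \<in> P \<and> starts_in N' P' \<or> p \<in> N \<and> starts_in P' N') \<and> (\<forall>r\<in>P \<union> N. r \<le> p)}"
  have eq: "sign_changes (P \<union> P') (N \<union> N') = (sign_changes P N \<union> sign_changes P' N') \<union> J"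
  proof (intro set_eqI iffI)
    fix p assume "p \<in> sign_changes (P \<union> P') (N \<union> N')"
    then obtain q where q: "p < q" "\<And>r. p < r \<Longrightarrow> r < q \<Longrightarrow> r \<notin> P \<union> N \<union> (P' \<union> N')"
      "p \<in> P \<union> P' \<and> q \<in> N \<union> N' \<or> p \<in> N \<union> N' \<and> q \<in> P \<union> P'"
      by (auto simp: sign_changes_def)
    consider "p \<in> P \<union> N" "q \<in> P \<union> N" | "p \<in> P' \<union> N'" "q \<in> P' \<union> N'" | "p \<in> P \<union> N" "q \<in> P' \<union> N'"
      | "p \<in> P' \<union> N'" "q \<in> P \<union> N"
      using q(3) by blast
    then show "p \<in> (sign_changes P N \<union> sign_changes P' N') \<union> J"
    proof cases
      case 1
      then have "p \<notin> P' \<union> N'" "q \<notin> P' \<union> N'" using less by blast+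
      then show ?thesis using q by (auto simp: sign_changes_def)
    next
      case 2
      then have "p \<notin> P \<union> N" "q \<notin> P \<union> N" using less by blast+
      then show ?thesis using q by (auto simp: sign_changes_def)
    next
      case 3
      then have "p \<notin> P' \<union> N'" "q \<notin> P \<union> N" using less by blast+
      moreover have "r \<le> p" if "r \<in> P \<union> N" for r
        using q(2)[of r] less[OF that 3(2)] that by (meson UnI1 not_le_imp_less)
      moreover have "q \<le> r" if "r \<in> P' \<union> N'" for r
        using q(2)[of r] less[OF 3(1) that] that by (meson UnI2 not_le_imp_less)
      ultimately show ?thesis using q(3) unfolding J_def starts_in_def by blast
    next
      case 4
      then show ?thesis using less q(1) by fastforce
    qed
  next
    fix p assume "p \<in> (sign_changes P N \<union> sign_changes P' N') \<union> J"
    then consider "p \<in> sign_changes P N" | "p \<in> sign_changes P' N'" | "p \<in> J" by blast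
    then show "p \<in> sign_changes (P \<union> P') (N \<union> N')"
    proof cases
      case 1
      then obtain q where q: "p < q" "\<forall>r. p < r \<and> r < q \<longrightarrow> r \<notin> P \<union> N" "p \<in> P \<and> q \<in> N \<or> p \<in> N \<and> q \<in> P"
        by (auto simp: sign_changes_def)
      moreover have "r \<notin> P' \<union> N'" if "r < q" for r using less[of q r] q(3) that by force
      ultimately show ?thesis unfolding sign_changes_def by blast
    next
      case 2
      then obtain q where q: "p < q" "\<forall>r. p < r \<and> r < q \<longrightarrow> r \<notin> P' \<union> N'" "p \<in> P' \<and> q \<in> N' \<or> p \<in> N' \<and> q \<in> P'"
        by (auto simp: sign_changes_def)
      moreover have "r \<notin> P \<union> N" if "p < r" for r using less[of r p] q(3) that by force
      ultimately show ?thesis unfolding sign_changes_def by blast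
    next
      case 3
      then obtain q where q: "p \<in> P \<and> q \<in> N' \<or> p \<in> N \<and> q \<in> P'" "\<forall>r\<in>P' \<union> N'. q \<le> r" "\<forall>r\<in>P \<union> N. r \<le> p"
        by (auto simp: J_def starts_in_def)
      then have "p < q" using less by blast
      moreover have "r \<notin> (P \<union> P') \<union> (N \<union> N')" if "p < r" "r < q" for r
        using q(2,3) that by (meson UnE UnI1 UnI2 leD)
      ultimately show ?thesis using q(1) unfolding sign_changes_def by blast
    qed
  qed
  have finc: "finite (sign_changes P N)" "finite (sign_changes P' N')"
    using fin sign_changes_subset by (meson finite_Un finite_subset)+
  have finJ: "finite J" by (rule finite_subset[of _ "P \<union> N"]) (use fin in \<open>auto simp: J_def\<close>)
  have disj: "sign_changes P N \<inter> sign_changes P' N' = {}"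
    using less sign_changes_subset by (meson disjoint_iff less_irrefl subsetD)
  have "p \<notin> J" if p: "p \<in> sign_changes P N \<union> sign_changes P' N'" for p
  proof
    assume J: "p \<in> J"
    then have "p \<notin> P' \<union> N'" using less by (fastforce simp: J_def)
    then have "p \<in> sign_changes P N" using p sign_changes_subset by blast
    then obtain q where "p < q" "q \<in> P \<union> N" by (auto simp: sign_changes_def)
    moreover from this have "q \<le> p" using J by (simp add: J_def)
    ultimately show False by simp
  qed
  then have "(sign_changes P N \<union> sign_changes P' N') \<inter> J = {}" by blast
  then have "card (sign_changes (P \<union> P') (N \<union> N')) = card (sign_changes P N) + card (sign_changes P' N') + card J"
    using finc finJ disj by (simp add: eq card_Un_disjoint)
  moreover have "card J = of_bool (junction P N P' N')"
  proof (cases "junction P N P' N'")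
    case True
    then obtain p where p: "p \<in> J" by (auto simp: junction_def J_def ends_in_def)
    have "p' = p" if "p' \<in> J" for p' using p that unfolding J_def by (blast intro: le_antisym)
    then have "J = {p}" using p by blast
    then show ?thesis using True by simp
  next
    case False
    then have "J = {}" by (auto simp: junction_def J_def ends_in_def)
    then show ?thesis using False by simp
  qed
  ultimately show ?thesis by simp
qed

lemma card_sign_changes_cut:
  assumes "finite P" "finite N"
  shows "card (sign_changes P N) = card (sign_changes (P \<inter> {..p}) (N \<inter> {..p}))
    + card (sign_changes (P \<inter> {p<..}) (N \<inter> {p<..}))
    + of_bool (junction (P \<inter> {..p}) (N \<inter> {..p}) (P \<inter> {p<..}) (N \<inter> {p<..}))"
proof -
  have "P = P \<inter> {..p} \<union> P \<inter> {p<..}" "N = N \<inter> {..p} \<union> N \<inter> {p<..}" by auto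
  then have "card (sign_changes P N)
    = card (sign_changes (P \<inter> {..p} \<union> P \<inter> {p<..}) (N \<inter> {..p} \<union> N \<inter> {p<..}))" by simp
  also have "\<dots> = card (sign_changes (P \<inter> {..p}) (N \<inter> {..p}))
    + card (sign_changes (P \<inter> {p<..}) (N \<inter> {p<..}))
    + of_bool (junction (P \<inter> {..p}) (N \<inter> {..p}) (P \<inter> {p<..}) (N \<inter> {p<..}))"
    using assms by (intro card_sign_changes_Un) auto
  finally show ?thesis .
qed

text \<open>This is the contribution of non pointed pairs to the degree, separated off because
  exchanging tails preserves its total.\<close>

definition incidences :: "arc \<Rightarrow> arc \<Rightarrow> nat" where
  "incidences \<alpha> \<beta> = of_bool (arc_start \<alpha> = arc_end \<beta>) + of_bool (arc_start \<beta> = arc_end \<alpha>)"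

lemma non_pointed_iff: "non_pointed \<alpha> \<beta> \<longleftrightarrow> arc_start \<alpha> = arc_end \<beta> \<or> arc_start \<beta> = arc_end \<alpha>"
  by (auto simp: non_pointed_def arc_start_def arc_end_def split: prod.splits)

lemma height_eq_0: "is_arc \<alpha> \<Longrightarrow> r \<le> arc_start \<alpha> \<or> arc_end \<alpha> \<le> r \<Longrightarrow> height \<alpha> r = 0"
proof -
  assume a: "is_arc \<alpha>" "r \<le> arc_start \<alpha> \<or> arc_end \<alpha> \<le> r"
  obtain i j A B where "\<alpha> = (i, j, A, B)" by (cases \<alpha>)
  moreover from this have "r \<notin> A \<union> B"
    using a by (auto simp: is_arc_def arc_start_def arc_end_def)
  ultimately show ?thesis by (auto simp: height_def)
qed

lemma height_cases: "is_arc \<alpha> \<Longrightarrow> arc_start \<alpha> < r \<Longrightarrow> r < arc_end \<alpha> \<Longrightarrow> height \<alpha> r = 1 \<or> height \<alpha> r = -1"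
proof -
  assume a: "is_arc \<alpha>" "arc_start \<alpha> < r" "r < arc_end \<alpha>"
  obtain i j A B where "\<alpha> = (i, j, A, B)" by (cases \<alpha>)
  moreover from this have "r \<in> A \<union> B" "\<not> (r \<in> A \<and> r \<in> B)"
    using a by (auto simp: is_arc_def arc_start_def arc_end_def)
  ultimately show ?thesis by (auto simp: height_def)
qed

text \<open>The common range of such arcs is the shared end point, where both heights vanish. Hence
  incidences and sign changes never occur together.\<close>

lemma above_at_non_pointed:
  assumes "is_arc \<alpha>" "is_arc \<beta>" "non_pointed \<alpha> \<beta>"
  shows "above_at \<alpha> \<beta> = {}"
proof -
  have False if r: "r \<in> above_at \<alpha> \<beta>" for r
  proof -
    have "r = arc_start \<alpha> \<and> r = arc_end \<beta> \<or> r = arc_start \<beta> \<and> r = arc_end \<alpha>"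
      using r assms by (auto simp: above_at_eq non_pointed_iff)
    then have "height \<alpha> r = 0" "height \<beta> r = 0" using assms by (auto intro: height_eq_0)
    then show False using r assms by (simp add: above_at_eq)
  qed
  then show ?thesis by blast
qed

text \<open>This removes the case distinction from the degree: compatible arcs have neither
  incidences nor sign changes, and non pointed arcs have exactly one incidence and no sign
  change.\<close>

lemma incompatibility_degree_eq:
  assumes "\<alpha> \<in> wiggly_arcs n" "\<beta> \<in> wiggly_arcs n"
  shows "incompatibility_degree n \<alpha> \<beta> = incidences \<alpha> \<beta> + card (sign_changes (above_at \<alpha> \<beta>) (above_at \<beta> \<alpha>))"
proof -
  have ar: "is_arc \<alpha>" "is_arc \<beta>" "arc_end \<alpha> \<le> n + 1" using assms by (auto simp: wiggly_arcs_iff)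
  consider "non_pointed \<alpha> \<beta>" | "\<not> non_pointed \<alpha> \<beta>" "\<not> crossing \<alpha> \<beta>" | "\<not> non_pointed \<alpha> \<beta>" "crossing \<alpha> \<beta>"
    by blast
  then show ?thesis
  proof cases
    case 1
    then have "\<not> (arc_start \<alpha> = arc_end \<beta> \<and> arc_start \<beta> = arc_end \<alpha>)"
      using arc_start_less_end[OF ar(1)] arc_start_less_end[OF ar(2)] by auto
    then have "incidences \<alpha> \<beta> = 1" using 1 by (auto simp: incidences_def non_pointed_iff)
    then show ?thesis using 1 above_at_non_pointed[OF ar(1,2) 1]
      by (simp add: incompatibility_degree_def compatible_def)
  next
    case 2
    then have "above_at \<alpha> \<beta> = {} \<or> above_at \<beta> \<alpha> = {}" by (auto simp: crossing_def)
    then have "sign_changes (above_at \<alpha> \<beta>) (above_at \<beta> \<alpha>) = {}" by auto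
    then show ?thesis using 2
      by (simp add: incompatibility_degree_def compatible_def incidences_def non_pointed_iff)
  next
    case 3
    have "sign_changes (above_at \<alpha> \<beta>) (above_at \<beta> \<alpha>) = {p \<in> {0..n}. \<exists>q>p.
        (\<forall>r. p < r \<and> r < q \<longrightarrow> r \<notin> above_at \<alpha> \<beta> \<union> above_at \<beta> \<alpha>) \<and>
        (p \<in> above_at \<alpha> \<beta> \<and> q \<in> above_at \<beta> \<alpha> \<or> p \<in> above_at \<beta> \<alpha> \<and> q \<in> above_at \<alpha> \<beta>)}"
    proof -
      \<comment> \<open>The restriction to \<open>{0..n}\<close> loses nothing, since a sign change
        at \<open>p\<close> has a later partner \<open>q\<close> that is at most
        \<open>n + 1\<close>.\<close>
      have "p \<le> n" if "p < q" "q \<in> above_at \<alpha> \<beta> \<union> above_at \<beta> \<alpha>" for p q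
        using that ar by (auto simp: above_at_eq)
      then show ?thesis unfolding sign_changes_def by auto
    qed
    then show ?thesis using 3
      by (simp add: incompatibility_degree_def compatible_def incidences_def non_pointed_iff)
  qed
qed

text \<open>A closest pair of points with opposite signs is consecutive: a separated point between
  them would form a closer such pair with one of the two.\<close>

lemma sign_changes_nonempty:
  fixes P N :: "nat set"
  assumes "x \<in> P" "y \<in> N" "P \<inter> N = {}"
  shows "\<exists>p q. p < q \<and> (\<forall>r. p < r \<and> r < q \<longrightarrow> r \<notin> P \<union> N) \<and> (p \<in> P \<and> q \<in> N \<or> p \<in> N \<and> q \<in> P)"
proof -
  define Q where "Q = (\<lambda>d. \<exists>p q. p < q \<and> q - p = d \<and> (p \<in> P \<and> q \<in> N \<or> p \<in> N \<and> q \<in> P))"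
  have "x \<noteq> y" using assms by blast
  then have "\<exists>d. Q d" using assms(1,2) unfolding Q_def by (metis linorder_neqE_nat)
  then obtain d where d: "Q d" "\<And>e. e < d \<Longrightarrow> \<not> Q e" using exists_least_iff[of Q] by blast
  then obtain p q where pq: "p < q" "q - p = d" "p \<in> P \<and> q \<in> N \<or> p \<in> N \<and> q \<in> P" unfolding Q_def by blast
  have "r \<notin> P \<union> N" if r: "p < r" "r < q" for r
  proof
    assume "r \<in> P \<union> N"
    then have "Q (q - r) \<or> Q (r - p)" unfolding Q_def using r pq(3) by blast
    moreover have "q - r < d" "r - p < d" using r pq(1,2) by auto
    ultimately show False using d(2) by blast
  qed
  then show ?thesis using pq by blast
qed

section \<open>Exchanging tails at a crossing\<close>

definition splice_arc :: "nat \<Rightarrow> arc \<Rightarrow> arc \<Rightarrow> arc" where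
  "splice_arc p = (\<lambda>(i, j, A, B) (i', j', A', B').
     (i, j', A \<inter> {..p} \<union> A' \<inter> {p<..}, B \<inter> {..p} \<union> B' \<inter> {p<..}))"

lemma splice_simps:
  "arc_start (splice_arc p \<alpha> \<beta>) = arc_start \<alpha>" "arc_end (splice_arc p \<alpha> \<beta>) = arc_end \<beta>"
  "height (splice_arc p \<alpha> \<beta>) r = (if r \<le> p then height \<alpha> r else height \<beta> r)"
  "turn (splice_arc p \<alpha> \<beta>) r = of_bool (r = arc_end \<beta>) - of_bool (r = arc_start \<alpha>)"
  by (auto simp: splice_arc_def arc_start_def arc_end_def height_def turn_def split: prod.splits)

lemma turn_eq: "turn \<alpha> r = of_bool (r = arc_end \<alpha>) - of_bool (r = arc_start \<alpha>)"
  by (auto simp: arc_start_def arc_end_def turn_def split: prod.splits)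

lemma is_arc_splice:
  assumes "is_arc \<alpha>" "is_arc \<beta>" "arc_start \<alpha> \<le> p" "p < arc_end \<alpha>" "arc_start \<beta> \<le> p" "p < arc_end \<beta>"
  shows "is_arc (splice_arc p \<alpha> \<beta>)"
proof -
  obtain i j A B where \<alpha>: "\<alpha> = (i, j, A, B)" by (cases \<alpha>)
  obtain i' j' A' B' where \<beta>: "\<beta> = (i', j', A', B')" by (cases \<beta>)
  have "r \<in> A \<union> B \<longleftrightarrow> i < r \<and> r < j" "\<not> (r \<in> A \<and> r \<in> B)"
    "r \<in> A' \<union> B' \<longleftrightarrow> i' < r \<and> r < j'" "\<not> (r \<in> A' \<and> r \<in> B')" for r
    using assms unfolding \<alpha> \<beta> is_arc_def by auto
  then have "x \<in> (A \<inter> {..p} \<union> A' \<inter> {p<..}) \<union> (B \<inter> {..p} \<union> B' \<inter> {p<..}) \<longleftrightarrow> x \<in> {i<..<j'}"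
    "x \<notin> (A \<inter> {..p} \<union> A' \<inter> {p<..}) \<inter> (B \<inter> {..p} \<union> B' \<inter> {p<..})" for x
    using assms(3-6) unfolding \<alpha> \<beta> arc_start_def arc_end_def
    by (cases "x \<le> p"; auto)+
  then have "(A \<inter> {..p} \<union> A' \<inter> {p<..}) \<union> (B \<inter> {..p} \<union> B' \<inter> {p<..}) = {i<..<j'}"
    "(A \<inter> {..p} \<union> A' \<inter> {p<..}) \<inter> (B \<inter> {..p} \<union> B' \<inter> {p<..}) = {}" by blast+
  then show ?thesis using assms(3-6) unfolding \<alpha> \<beta> is_arc_def splice_arc_def arc_start_def arc_end_def by auto
qed

lemma above_at_splice:
  assumes "is_arc \<alpha>" "is_arc \<beta>" "arc_start \<alpha> \<le> p" "p < arc_end \<alpha>" "arc_start \<beta> \<le> p" "p < arc_end \<beta>" "is_arc \<eta>"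
  shows "above_at (splice_arc p \<alpha> \<beta>) \<eta> = above_at \<alpha> \<eta> \<inter> {..p} \<union> above_at \<beta> \<eta> \<inter> {p<..}"
    "above_at \<eta> (splice_arc p \<alpha> \<beta>) = above_at \<eta> \<alpha> \<inter> {..p} \<union> above_at \<eta> \<beta> \<inter> {p<..}"
  using assms is_arc_splice[OF assms(1-6)] by (auto simp: above_at_eq splice_simps)

text \<open>The junction is submodular for the order \<open>-, 0, +\<close> on the signs next to the cut: exchanging the right
  parts of an upper left part and a lower right part does not create sign changes.\<close>

lemma card_sign_changes_exchange:
  fixes P N P' N' :: "nat set"
  assumes fin: "finite P" "finite N" "finite P'" "finite N'"
    and disj: "P \<inter> N = {}" "P' \<inter> N' = {}"
    and left: "p \<in> P \<or> p \<in> N'"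
    and agree: "\<And>r. p < r \<Longrightarrow> r < q \<Longrightarrow> (r \<in> P \<longleftrightarrow> r \<in> P') \<and> (r \<in> N \<longleftrightarrow> r \<in> N')"
    and right: "p < q" "q \<in> P' \<or> q \<in> N \<or> P \<union> N \<union> P' \<union> N' \<subseteq> {..<q}"
  shows "card (sign_changes (P \<inter> {..p} \<union> P' \<inter> {p<..}) (N \<inter> {..p} \<union> N' \<inter> {p<..}))
    + card (sign_changes (P' \<inter> {..p} \<union> P \<inter> {p<..}) (N' \<inter> {..p} \<union> N \<inter> {p<..}))
    \<le> card (sign_changes P N) + card (sign_changes P' N')"
proof -
  let ?L = "\<lambda>X. X \<inter> {..p}" and ?R = "\<lambda>X. X \<inter> {p<..}"
  \<comment> \<open>A point \<open>p\<close> in \<open>N'\<close> would be the last sign of the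
    second left part. If that part ends positively, \<open>left\<close> therefore puts
    \<open>p\<close> into \<open>P\<close>.\<close>
  have up: "ends_in (?L P) (?L N)" if "ends_in (?L P') (?L N')"
  proof -
    have "p \<in> P"
    proof (rule ccontr)
      assume "p \<notin> P"
      then have "p \<in> N'" using left by blast
      then show False using that disj(2) unfolding ends_in_def by (metis IntD1 IntD2 IntI UnI2 atMost_iff disjoint_iff le_antisym order_refl)
    qed
    then show ?thesis unfolding ends_in_def by auto
  qed
  have down: "ends_in (?L N') (?L P')" if "ends_in (?L N) (?L P)"
  proof -
    have "p \<in> N'"
    proof (rule ccontr)
      assume "p \<notin> N'"
      then have "p \<in> P" using left by blast
      then show False using that disj(1) unfolding ends_in_def by (metis IntD1 IntD2 IntI UnI2 atMost_iff disjoint_iff le_antisym order_refl)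
    qed
    then show ?thesis unfolding ends_in_def by auto
  qed
  have excl: "\<not> (ends_in (?L P) (?L N) \<and> ends_in (?L N) (?L P))"
    "\<not> (ends_in (?L P') (?L N') \<and> ends_in (?L N') (?L P'))"
    "\<not> (starts_in (?R P) (?R N) \<and> starts_in (?R N) (?R P))"
    "\<not> (starts_in (?R P') (?R N') \<and> starts_in (?R N') (?R P'))"
    using disj unfolding ends_in_def starts_in_def by (blast dest: le_antisym)+
  have start_up: "starts_in (?R P') (?R N')" if st: "starts_in (?R P) (?R N)"
  proof -
    obtain m where m: "m \<in> P" "p < m" "\<And>r. r \<in> P \<union> N \<Longrightarrow> p < r \<Longrightarrow> m \<le> r"
      using st by (auto simp: starts_in_def)
    show ?thesis
    proof (cases "m < q")
      case True
      then have "m \<in> P'" using agree m by blast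
      moreover have "m \<le> r" if "r \<in> P' \<union> N'" "p < r" for r
        using agree[of r] m(3)[of r] that True by (cases "r < q") auto
      ultimately show ?thesis using m(2) by (auto simp: starts_in_def)
    next
      case False
      \<comment> \<open>No sign of the first pattern lies between \<open>p\<close> and
        \<open>q\<close>, and a sign at \<open>q\<close> could only be the positive one at
        \<open>m\<close>. As \<open>m\<close> is not before \<open>q\<close>, the only alternative
        left in \<open>right\<close> is \<open>q \<in> P'\<close>, and \<open>q\<close> is then the
        first sign of the second pattern.\<close>
      then have "q \<notin> N" using m(1) m(3)[of q] disj(1) right(1) by (metis UnI2 disjoint_iff le_antisym not_less)
      then have "q \<in> P'" using right False m(1) by auto
      moreover have "q \<le> r" if "r \<in> P' \<union> N'" "p < r" for r
        using agree[of r] m(3)[of r] that False by (cases "r < q") auto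
      ultimately show ?thesis using right(1) by (auto simp: starts_in_def)
    qed
  qed
  have start_down: "starts_in (?R N) (?R P)" if st: "starts_in (?R N') (?R P')"
  proof -
    obtain m where m: "m \<in> N'" "p < m" "\<And>r. r \<in> P' \<union> N' \<Longrightarrow> p < r \<Longrightarrow> m \<le> r"
      using st by (auto simp: starts_in_def)
    show ?thesis
    proof (cases "m < q")
      case True
      then have "m \<in> N" using agree m by blast
      moreover have "m \<le> r" if "r \<in> P \<union> N" "p < r" for r
        using agree[of r] m(3)[of r] that True by (cases "r < q") auto
      ultimately show ?thesis using m(2) by (auto simp: starts_in_def)
    next
      case False
      then have "q \<notin> P'" using m(1) m(3)[of q] disj(2) right(1) by (metis UnI1 disjoint_iff le_antisym not_less)
      then have "q \<in> N" using right False m(1) by auto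
      moreover have "q \<le> r" if "r \<in> P \<union> N" "p < r" for r
        using agree[of r] m(3)[of r] that False by (cases "r < q") auto
      ultimately show ?thesis using right(1) by (auto simp: starts_in_def)
    qed
  qed
  have "of_bool (junction (?L P) (?L N) (?R P') (?R N')) + of_bool (junction (?L P') (?L N') (?R P) (?R N))
    \<le> (of_bool (junction (?L P) (?L N) (?R P) (?R N)) + of_bool (junction (?L P') (?L N') (?R P') (?R N')) :: nat)"
    using up down excl start_up start_down unfolding junction_def
    by (auto simp: of_bool_def)
  moreover have "card (sign_changes (?L P \<union> ?R P') (?L N \<union> ?R N'))
    = card (sign_changes (?L P) (?L N)) + card (sign_changes (?R P') (?R N')) + of_bool (junction (?L P) (?L N) (?R P') (?R N'))"
    "card (sign_changes (?L P' \<union> ?R P) (?L N' \<union> ?R N))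
    = card (sign_changes (?L P') (?L N')) + card (sign_changes (?R P) (?R N)) + of_bool (junction (?L P') (?L N') (?R P) (?R N))"
    by (rule card_sign_changes_Un; use fin in auto)+
  ultimately show ?thesis
    using card_sign_changes_cut[OF fin(1,2), of p] card_sign_changes_cut[OF fin(3,4), of p] by linarith
qed

lemma incidences_splice:
  "incidences (splice_arc p \<alpha> \<beta>) \<eta> + incidences (splice_arc p \<beta> \<alpha>) \<eta> = incidences \<alpha> \<eta> + incidences \<beta> \<eta>"
  by (simp add: incidences_def splice_simps)

text \<open>Between the consecutive points \<open>p\<close> and \<open>q\<close> the arcs \<alpha>
  and \<beta> coincide, and their order at \<open>p\<close> is opposite to that at \<open>q\<close>;
  this is the situation of \<open>card_sign_changes_exchange\<close> for every third arc \<eta>. The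
  last claim supplies the one strict inequality that the sum over \<eta> needs.\<close>

lemma degree_splice:
  assumes \<alpha>: "\<alpha> \<in> wiggly_arcs n" and \<beta>: "\<beta> \<in> wiggly_arcs n" and \<eta>: "\<eta> \<in> wiggly_arcs n"
    and pq: "p < q" "p \<in> above_at \<alpha> \<beta>" "q \<in> above_at \<beta> \<alpha>"
    and between: "\<forall>r. p < r \<and> r < q \<longrightarrow> r \<notin> above_at \<alpha> \<beta> \<union> above_at \<beta> \<alpha>"
  shows "splice_arc p \<alpha> \<beta> \<in> wiggly_arcs n"
    and "incompatibility_degree n (splice_arc p \<alpha> \<beta>) \<eta> + incompatibility_degree n (splice_arc p \<beta> \<alpha>) \<eta>
      \<le> incompatibility_degree n \<alpha> \<eta> + incompatibility_degree n \<beta> \<eta>"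
    and "incompatibility_degree n (splice_arc p \<alpha> \<beta>) \<beta> + incompatibility_degree n (splice_arc p \<beta> \<alpha>) \<beta>
      < incompatibility_degree n \<alpha> \<beta> + incompatibility_degree n \<beta> \<beta>"
proof -
  have ar: "is_arc \<alpha>" "is_arc \<beta>" "is_arc \<eta>" and ends: "arc_end \<alpha> \<le> n + 1" "arc_end \<beta> \<le> n + 1"
    using \<alpha> \<beta> \<eta> by (auto simp: wiggly_arcs_iff)
  have range: "arc_start \<alpha> \<le> p" "p < arc_end \<alpha>" "arc_start \<beta> \<le> p" "p < arc_end \<beta>"
    "q \<le> arc_end \<alpha>" "q \<le> arc_end \<beta>" "height \<beta> p < height \<alpha> p" "height \<alpha> q < height \<beta> q"
    using pq ar by (auto simp: above_at_eq)
  have S: "splice_arc p \<alpha> \<beta> \<in> wiggly_arcs n" "splice_arc p \<beta> \<alpha> \<in> wiggly_arcs n"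
    using is_arc_splice[OF ar(1,2) range(1-4)] is_arc_splice[OF ar(2,1) range(3,4,1,2)] ends
    by (auto simp: wiggly_arcs_iff splice_simps)
  then show "splice_arc p \<alpha> \<beta> \<in> wiggly_arcs n" by blast
  have same: "height \<alpha> r = height \<beta> r" if "p < r" "r < q" for r
    using between that range ar by (auto simp: above_at_eq)
  note ab = above_at_splice[OF ar(1,2) range(1-4)] above_at_splice[OF ar(2,1) range(3,4,1,2)]
  let ?P = "above_at \<alpha> \<eta>" and ?N = "above_at \<eta> \<alpha>" and ?P' = "above_at \<beta> \<eta>" and ?N' = "above_at \<eta> \<beta>"
  have fin: "finite ?P" "finite ?N" "finite ?P'" "finite ?N'" using ar by (auto intro: finite_above_at)
  have "card (sign_changes (?P \<inter> {..p} \<union> ?P' \<inter> {p<..}) (?N \<inter> {..p} \<union> ?N' \<inter> {p<..}))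
    + card (sign_changes (?P' \<inter> {..p} \<union> ?P \<inter> {p<..}) (?N' \<inter> {..p} \<union> ?N \<inter> {p<..}))
    \<le> card (sign_changes ?P ?N) + card (sign_changes ?P' ?N')"
  proof -
    \<comment> \<open>If \<eta> lies entirely on one side of \<open>p\<close>, the cut merely
      permutes the two sign patterns.\<close>
    consider "arc_start \<eta> \<le> p" "p \<le> arc_end \<eta>" | "p < arc_start \<eta>" | "arc_end \<eta> < p" by linarith
    then show ?thesis
    proof cases
      case 1
      show ?thesis
      proof (rule card_sign_changes_exchange[OF fin])
        show "?P \<inter> ?N = {}" "?P' \<inter> ?N' = {}" using ar above_at_disjoint by blast+
        \<comment> \<open>Since \<beta> is strictly below \<alpha> at \<open>p\<close>, the arc
          \<eta> is strictly below \<alpha> or strictly above \<beta> there.\<close>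
        show "p \<in> ?P \<or> p \<in> ?N'" using 1 range ar by (auto simp: above_at_eq)
        show "(r \<in> ?P \<longleftrightarrow> r \<in> ?P') \<and> (r \<in> ?N \<longleftrightarrow> r \<in> ?N')" if "p < r" "r < q" for r
          using same[OF that] that range ar by (auto simp: above_at_eq)
        \<comment> \<open>The same comparison works at \<open>q\<close> if \<eta> reaches it.
          Otherwise \<eta> ends earlier and is compared with nothing at or beyond
          \<open>q\<close>.\<close>
        show "q \<in> ?P' \<or> q \<in> ?N \<or> ?P \<union> ?N \<union> ?P' \<union> ?N' \<subseteq> {..<q}"
        proof (cases "q \<le> arc_end \<eta>")
          case True
          then show ?thesis using 1 range pq(1) ar by (auto simp: above_at_eq)
        next
          case False
          then show ?thesis using ar by (auto simp: above_at_eq)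
        qed
      qed fact
    next
      case 2
      then have "?P \<inter> {..p} = {}" "?N \<inter> {..p} = {}" "?P' \<inter> {..p} = {}" "?N' \<inter> {..p} = {}"
        "?P \<inter> {p<..} = ?P" "?N \<inter> {p<..} = ?N" "?P' \<inter> {p<..} = ?P'" "?N' \<inter> {p<..} = ?N'"
        using ar by (auto simp: above_at_eq)
      then show ?thesis by simp
    next
      case 3
      then have "?P \<inter> {..p} = ?P" "?N \<inter> {..p} = ?N" "?P' \<inter> {..p} = ?P'" "?N' \<inter> {..p} = ?N'"
        "?P \<inter> {p<..} = {}" "?N \<inter> {p<..} = {}" "?P' \<inter> {p<..} = {}" "?N' \<inter> {p<..} = {}"
        using ar by (auto simp: above_at_eq)
      then show ?thesis by simp
    qed
  qed
  then show "incompatibility_degree n (splice_arc p \<alpha> \<beta>) \<eta> + incompatibility_degree n (splice_arc p \<beta> \<alpha>) \<eta>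
      \<le> incompatibility_degree n \<alpha> \<eta> + incompatibility_degree n \<beta> \<eta>"
    using incidences_splice[of p \<alpha> \<beta> \<eta>] ab[OF ar(3)]
    by (simp add: incompatibility_degree_eq S \<alpha> \<beta> \<eta>)
  let ?A = "above_at \<alpha> \<beta>" and ?B = "above_at \<beta> \<alpha>"
  have empty: "above_at \<beta> \<beta> = {}" using ar by (auto simp: above_at_eq)
  have finA: "finite ?A" "finite ?B" using ar by (auto intro: finite_above_at)
  have "ends_in (?A \<inter> {..p}) (?B \<inter> {..p})" using pq(2) by (auto simp: ends_in_def)
  moreover have "starts_in (?B \<inter> {p<..}) (?A \<inter> {p<..})"
  proof -
    have "q \<le> r" if "r \<in> ?A \<union> ?B" "p < r" for r
      using between that by (meson not_le_imp_less)
    then show ?thesis using pq(1,3) unfolding starts_in_def by auto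
  qed
  \<comment> \<open>The sign change from \<open>p\<close> to \<open>q\<close> straddles the cut. It
    disappears because each new arc coincides with \<beta> on one side of the cut.\<close>
  ultimately have "junction (?A \<inter> {..p}) (?B \<inter> {..p}) (?A \<inter> {p<..}) (?B \<inter> {p<..})"
    by (simp add: junction_def)
  then show "incompatibility_degree n (splice_arc p \<alpha> \<beta>) \<beta> + incompatibility_degree n (splice_arc p \<beta> \<alpha>) \<beta>
      < incompatibility_degree n \<alpha> \<beta> + incompatibility_degree n \<beta> \<beta>"
    using incidences_splice[of p \<alpha> \<beta> \<beta>] ab[OF ar(2)] card_sign_changes_cut[OF finA, of p]
    by (simp add: incompatibility_degree_eq S \<alpha> \<beta> empty)
qed

lemma finite_wiggly_arcs: "finite (wiggly_arcs n)"
proof (rule finite_subset)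
  show "wiggly_arcs n \<subseteq> {..n + 1} \<times> {..n + 1} \<times> Pow {..n + 1} \<times> Pow {..n + 1}"
  proof
    fix \<alpha> assume a: "\<alpha> \<in> wiggly_arcs n"
    obtain i j A B where "\<alpha> = (i, j, A, B)" by (cases \<alpha>)
    moreover from this have "A \<union> B = {i<..<j}" "i < j" "j \<le> n + 1" using a by (auto simp: wiggly_arcs_def)
    moreover from this have "A \<subseteq> {..n + 1}" "B \<subseteq> {..n + 1}" by (simp_all add: set_eq_iff subset_iff) (meson le_trans less_imp_le)+
    ultimately show "\<alpha> \<in> {..n + 1} \<times> {..n + 1} \<times> Pow {..n + 1} \<times> Pow {..n + 1}" by auto
  qed
qed auto

lemma exchange_crossing:
  assumes \<alpha>: "\<alpha> \<in> wiggly_arcs n" and \<beta>: "\<beta> \<in> wiggly_arcs n"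
    and pq: "p < q" "p \<in> above_at \<alpha> \<beta>" "q \<in> above_at \<beta> \<alpha>"
    and between: "\<forall>r. p < r \<and> r < q \<longrightarrow> r \<notin> above_at \<alpha> \<beta> \<union> above_at \<beta> \<alpha>"
  shows "\<exists>\<gamma>\<in>wiggly_arcs n. \<exists>\<delta>\<in>wiggly_arcs n.
    (\<forall>r. height \<gamma> r + height \<delta> r = height \<alpha> r + height \<beta> r \<and> turn \<gamma> r + turn \<delta> r = turn \<alpha> r + turn \<beta> r) \<and>
    incompatibility_number n \<gamma> + incompatibility_number n \<delta> < incompatibility_number n \<alpha> + incompatibility_number n \<beta>"
proof (rule bexI[of _ "splice_arc p \<alpha> \<beta>"], rule bexI[of _ "splice_arc p \<beta> \<alpha>"], intro conjI allI)
  note * = degree_splice[OF \<alpha> \<beta> _ pq between]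
  show "splice_arc p \<alpha> \<beta> \<in> wiggly_arcs n" by (rule *(1)[OF \<alpha>])
  have ar: "is_arc \<alpha>" "is_arc \<beta>" "arc_end \<alpha> \<le> n + 1" using \<alpha> \<beta> by (auto simp: wiggly_arcs_iff)
  then have "is_arc (splice_arc p \<beta> \<alpha>)" using pq by (intro is_arc_splice) (auto simp: above_at_eq)
  then show "splice_arc p \<beta> \<alpha> \<in> wiggly_arcs n" using ar by (simp add: wiggly_arcs_iff splice_simps)
  show "height (splice_arc p \<alpha> \<beta>) r + height (splice_arc p \<beta> \<alpha>) r = height \<alpha> r + height \<beta> r"
    "turn (splice_arc p \<alpha> \<beta>) r + turn (splice_arc p \<beta> \<alpha>) r = turn \<alpha> r + turn \<beta> r" for r
    by (simp_all add: splice_simps turn_eq)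
  show "incompatibility_number n (splice_arc p \<alpha> \<beta>) + incompatibility_number n (splice_arc p \<beta> \<alpha>)
    < incompatibility_number n \<alpha> + incompatibility_number n \<beta>"
    unfolding incompatibility_number_def sum.distrib[symmetric]
  proof (intro sum_strict_mono_ex1 finite_wiggly_arcs ballI)
    show "\<exists>\<eta>\<in>wiggly_arcs n. incompatibility_degree n (splice_arc p \<alpha> \<beta>) \<eta> + incompatibility_degree n (splice_arc p \<beta> \<alpha>) \<eta>
      < incompatibility_degree n \<alpha> \<eta> + incompatibility_degree n \<beta> \<eta>"
      using *(3)[OF \<beta>] \<beta> by blast
  qed (rule *(2))
qed

section \<open>Joining arcs at a common point\<close>

definition join_arcs :: "bool \<Rightarrow> arc \<Rightarrow> arc \<Rightarrow> arc" where
  "join_arcs up = (\<lambda>(i, j, A, B) (i', j', A', B').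
     (i, j', A \<union> A' \<union> (if up then {j} else {}), B \<union> B' \<union> (if up then {} else {j})))"

lemma join_arcs_simps:
  "arc_start (join_arcs up \<alpha> \<beta>) = arc_start \<alpha>" "arc_end (join_arcs up \<alpha> \<beta>) = arc_end \<beta>"
  by (auto simp: join_arcs_def arc_start_def arc_end_def split: prod.splits)

lemma join_arcs_is_arc:
  assumes "is_arc \<alpha>" "is_arc \<beta>" "arc_end \<alpha> = arc_start \<beta>"
  shows "is_arc (join_arcs up \<alpha> \<beta>)"
    "height (join_arcs up \<alpha> \<beta>) r = (if r = arc_end \<alpha> then if up then 1 else - 1 else height \<alpha> r + height \<beta> r)"
proof -
  obtain i j A B where \<alpha>: "\<alpha> = (i, j, A, B)" by (cases \<alpha>)
  obtain i' k A' B' where \<beta>: "\<beta> = (i', k, A', B')" by (cases \<beta>)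
  have "i' = j" using assms(3) unfolding \<alpha> \<beta> by (simp add: arc_start_def arc_end_def)
  have *: "x \<in> A \<union> B \<longleftrightarrow> i < x \<and> x < j" "\<not> (x \<in> A \<and> x \<in> B)"
    "x \<in> A' \<union> B' \<longleftrightarrow> j < x \<and> x < k" "\<not> (x \<in> A' \<and> x \<in> B')" "i < j" "j < k" for x
    using assms \<open>i' = j\<close> unfolding \<alpha> \<beta> is_arc_def by auto
  let ?U = "A \<union> A' \<union> (if up then {j} else {})" and ?D = "B \<union> B' \<union> (if up then {} else {j})"
  have mem: "x \<in> ?U \<union> ?D \<longleftrightarrow> x \<in> {i<..<k}" "x \<notin> ?U \<inter> ?D" for x
    using *(1)[of x] *(2)[of x] *(3)[of x] *(4)[of x] *(5,6) by (cases "x < j"; cases "x = j"; auto)+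
  have "?U \<union> ?D = {i<..<k}" by (rule set_eqI) (rule mem(1))
  moreover have "?U \<inter> ?D = {}" by (rule equals0I) (erule mem(2)[THEN notE])
  ultimately show "is_arc (join_arcs up \<alpha> \<beta>)" using *(5,6)
    unfolding \<alpha> \<beta> is_arc_def join_arcs_def prod.case by (intro conjI) (assumption | linarith)+
  show "height (join_arcs up \<alpha> \<beta>) r = (if r = arc_end \<alpha> then if up then 1 else - 1 else height \<alpha> r + height \<beta> r)"
    using *(1)[of r] *(2)[of r] *(3)[of r] *(4)[of r] *(5,6)
    unfolding \<alpha> \<beta> join_arcs_def height_def arc_end_def prod.case
    by (cases "r < j"; cases "r = j"; auto)
qed

text \<open>A sign at \<open>j\<close> meets the last sign on its left and the first sign on its
  right independently of each other; without it these two signs meet directly.\<close>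

lemma card_sign_changes_middle:
  fixes P N P' N' :: "nat set"
  assumes fin: "finite P" "finite N" "finite P'" "finite N'"
    and less: "P \<union> N \<subseteq> {..<j}" "P' \<union> N' \<subseteq> {j<..}"
  shows "card (sign_changes (P \<union> P') (N \<union> N')) = card (sign_changes P N) + card (sign_changes P' N')
      + of_bool (ends_in P N \<and> starts_in N' P' \<or> ends_in N P \<and> starts_in P' N')"
    and "card (sign_changes (P \<union> {j} \<union> P') (N \<union> N')) = card (sign_changes P N) + card (sign_changes P' N')
      + of_bool (ends_in N P) + of_bool (starts_in N' P')"
    and "card (sign_changes (P \<union> P') (N \<union> {j} \<union> N')) = card (sign_changes P N) + card (sign_changes P' N')
      + of_bool (ends_in P N) + of_bool (starts_in P' N')"
proof -
  have lt: "r < j" if "r \<in> P \<union> N" for r using less(1) that by blast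
  have gt: "j < r" if "r \<in> P' \<union> N'" for r using less(2) that by blast
  show "card (sign_changes (P \<union> P') (N \<union> N')) = card (sign_changes P N) + card (sign_changes P' N')
      + of_bool (ends_in P N \<and> starts_in N' P' \<or> ends_in N P \<and> starts_in P' N')"
    using card_sign_changes_Un[OF fin] lt gt unfolding junction_def by (meson less_trans)
  have *: "card (sign_changes (X \<union> {j} \<union> X') (Y \<union> Y')) = card (sign_changes X Y) + card (sign_changes X' Y')
      + of_bool (ends_in Y X) + of_bool (starts_in Y' X')"
    if "finite X" "finite Y" "finite X'" "finite Y'" "\<forall>r\<in>X \<union> Y. r < j" "\<forall>r\<in>X' \<union> Y'. j < r" for X Y X' Y'
  proof -
    have "card (sign_changes (X \<union> ({j} \<union> X')) (Y \<union> ({} \<union> Y')))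
      = card (sign_changes X Y) + card (sign_changes ({j} \<union> X') ({} \<union> Y')) + of_bool (junction X Y ({j} \<union> X') ({} \<union> Y'))"
    proof (rule card_sign_changes_Un)
      fix r r' assume "r \<in> X \<union> Y" "r' \<in> {j} \<union> X' \<union> ({} \<union> Y')"
      then have "r < j" "r' = j \<or> j < r'" using that(5,6) by auto
      then show "r < r'" by auto
    qed (use that in auto)
    moreover have "card (sign_changes ({j} \<union> X') ({} \<union> Y'))
      = card (sign_changes {j} {}) + card (sign_changes X' Y') + of_bool (junction {j} {} X' Y')"
      by (rule card_sign_changes_Un) (use that in auto)
    moreover have "junction X Y ({j} \<union> X') ({} \<union> Y') \<longleftrightarrow> ends_in Y X"
    proof -
      have "starts_in ({j} \<union> X') ({} \<union> Y')"
        using that(6) unfolding starts_in_def by (auto intro: less_imp_le)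
      moreover have "\<not> starts_in ({} \<union> Y') ({j} \<union> X')"
        using that(6) unfolding starts_in_def by (metis Un_iff insertI1 leD sup_bot_left)
      ultimately show ?thesis by (simp add: junction_def)
    qed
    moreover have "junction {j} {} X' Y' \<longleftrightarrow> starts_in Y' X'"
      by (auto simp: junction_def ends_in_def)
    ultimately show ?thesis by (simp add: Un_assoc)
  qed
  show "card (sign_changes (P \<union> {j} \<union> P') (N \<union> N')) = card (sign_changes P N) + card (sign_changes P' N')
      + of_bool (ends_in N P) + of_bool (starts_in N' P')"
    using *[OF fin] lt gt by blast
  show "card (sign_changes (P \<union> P') (N \<union> {j} \<union> N')) = card (sign_changes P N) + card (sign_changes P' N')
      + of_bool (ends_in P N) + of_bool (starts_in P' N')"
    using *[OF fin(2,1,4,3)] lt gt by (metis Un_commute sign_changes_commute)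
qed

text \<open>If \<eta> passes above or below the common point, the joined arc on the opposite side
  has as many sign changes with \<eta> as \<alpha> and \<beta> together, and the one on the same
  side has at most that many. If \<eta> ends or starts at the common point, each joined arc gains at
  most one sign change there, which the lost incidence pays for when it is counted twice.\<close>

lemma degree_join:
  assumes \<alpha>: "\<alpha> \<in> wiggly_arcs n" and \<beta>: "\<beta> \<in> wiggly_arcs n" and \<eta>: "\<eta> \<in> wiggly_arcs n"
    and j: "arc_end \<alpha> = arc_start \<beta>"
  shows "join_arcs up \<alpha> \<beta> \<in> wiggly_arcs n"
    and "incompatibility_degree n (join_arcs True \<alpha> \<beta>) \<eta> + incompatibility_degree n (join_arcs False \<alpha> \<beta>) \<eta>
      \<le> 2 * (incompatibility_degree n \<alpha> \<eta> + incompatibility_degree n \<beta> \<eta>)"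
    and "incompatibility_degree n (join_arcs True \<alpha> \<beta>) \<alpha> + incompatibility_degree n (join_arcs False \<alpha> \<beta>) \<alpha>
      < 2 * (incompatibility_degree n \<alpha> \<alpha> + incompatibility_degree n \<beta> \<alpha>)"
proof -
  have ar: "is_arc \<alpha>" "is_arc \<beta>" "is_arc \<eta>" and ends: "arc_end \<alpha> \<le> n + 1" "arc_end \<beta> \<le> n + 1"
    using \<alpha> \<beta> \<eta> by (auto simp: wiggly_arcs_iff)
  have S: "join_arcs up \<alpha> \<beta> \<in> wiggly_arcs n" for up
    using join_arcs_is_arc(1)[OF ar(1,2) j] ends by (auto simp: wiggly_arcs_iff join_arcs_simps)
  then show "join_arcs up \<alpha> \<beta> \<in> wiggly_arcs n" by blast
  have isJ: "is_arc (join_arcs up \<alpha> \<beta>)" for up using S by (simp add: wiggly_arcs_iff)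
  define j where "j = arc_start \<beta>"
  have less: "arc_start \<alpha> < j" "arc_end \<alpha> = j" "arc_start \<beta> = j" "j < arc_end \<beta>"
    using arc_start_less_end[OF ar(1)] arc_start_less_end[OF ar(2)] j by (auto simp: j_def)
  have h: "height \<alpha> r = 0" "height (join_arcs up \<alpha> \<beta>) r = height \<beta> r" if "j < r" for r up
    using that less height_eq_0[OF ar(1)] join_arcs_is_arc(2)[OF ar(1,2) j] by auto
  have h': "height \<beta> r = 0" "height (join_arcs up \<alpha> \<beta>) r = height \<alpha> r" if "r < j" for r up
    using that less height_eq_0[OF ar(2)] join_arcs_is_arc(2)[OF ar(1,2) j] by auto
  have hj: "height \<alpha> j = 0" "height \<beta> j = 0" "height (join_arcs up \<alpha> \<beta>) j = (if up then 1 else -1)" for up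
    using less height_eq_0[OF ar(1)] height_eq_0[OF ar(2)] join_arcs_is_arc(2)[OF ar(1,2) j] by auto
  have main: "incompatibility_degree n (join_arcs True \<alpha> \<beta>) \<eta> + incompatibility_degree n (join_arcs False \<alpha> \<beta>) \<eta>
      \<le> 2 * (incompatibility_degree n \<alpha> \<eta> + incompatibility_degree n \<beta> \<eta>)"
    if \<eta>: "\<eta> \<in> wiggly_arcs n" for \<eta>
  proof -
    have ar\<eta>: "is_arc \<eta>" using \<eta> by (simp add: wiggly_arcs_iff)
    define P where "P = above_at \<alpha> \<eta> \<inter> {..<j}"
    define N where "N = above_at \<eta> \<alpha> \<inter> {..<j}"
    define P' where "P' = above_at \<beta> \<eta> \<inter> {j<..}"
    define N' where "N' = above_at \<eta> \<beta> \<inter> {j<..}"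
    \<comment> \<open>\<open>p t\<close> and \<open>m t\<close> give the sign at \<open>j\<close> of
      an arc of height \<open>t\<close> compared with \<eta>: \<open>t\<close> is 0 for \<alpha> and
      \<beta>, and 1 or -1 for the joined arcs.\<close>
    define p where "p t = (if arc_start \<eta> \<le> j \<and> j \<le> arc_end \<eta> \<and> height \<eta> j < t then {j} else {})" for t
    define m where "m t = (if arc_start \<eta> \<le> j \<and> j \<le> arc_end \<eta> \<and> t < height \<eta> j then {j} else {})" for t
    have fin: "finite P" "finite N" "finite P'" "finite N'"
      using ar ar\<eta> by (auto simp: P_def N_def P'_def N'_def intro: finite_above_at)
    have sets: "above_at \<alpha> \<eta> = P \<union> p 0 \<union> {}" "above_at \<eta> \<alpha> = N \<union> m 0 \<union> {}"
      "above_at \<beta> \<eta> = {} \<union> p 0 \<union> P'" "above_at \<eta> \<beta> = {} \<union> m 0 \<union> N'"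
      "above_at (join_arcs up \<alpha> \<beta>) \<eta> = P \<union> p (if up then 1 else -1) \<union> P'"
      "above_at \<eta> (join_arcs up \<alpha> \<beta>) = N \<union> m (if up then 1 else -1) \<union> N'" for up
      unfolding P_def N_def P'_def N'_def p_def m_def using ar ar\<eta> isJ less
      by (rule_tac [!] set_eqI, rename_tac [!] r, case_tac [!] "r < j", case_tac [!] "r = j")
        (simp_all add: above_at_eq join_arcs_simps h h' hj)
    have sub: "P \<union> N \<subseteq> {..<j}" "P' \<union> N' \<subseteq> {j<..}" "{} \<union> {} \<subseteq> {j<..}" "{} \<union> {} \<subseteq> {..<j}"
      by (auto simp: P_def N_def P'_def N'_def)
    note mid = card_sign_changes_middle[OF fin sub(1,2)] card_sign_changes_middle[OF fin(1,2) finite.emptyI finite.emptyI sub(1,3)]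
      card_sign_changes_middle[OF finite.emptyI finite.emptyI fin(3,4) sub(4,2)]
    have no_ends: "\<not> ends_in {} X" "\<not> starts_in {} X" for X by (auto simp: ends_in_def starts_in_def)
    consider "\<not> (arc_start \<eta> \<le> j \<and> j \<le> arc_end \<eta>)"
      | "arc_start \<eta> < j" "j < arc_end \<eta>" "height \<eta> j = 1"
      | "arc_start \<eta> < j" "j < arc_end \<eta>" "height \<eta> j = -1"
      | "arc_end \<eta> = j" | "arc_start \<eta> = j"
      using height_cases[OF ar\<eta>, of j] by linarith
    \<comment> \<open>The last summand is twice the number of incidences of \<eta> at
      \<open>j\<close>, exactly those that joining destroys.\<close>
    then have "card (sign_changes (P \<union> p 1 \<union> P') (N \<union> m 1 \<union> N')) + card (sign_changes (P \<union> p (-1) \<union> P') (N \<union> m (-1) \<union> N'))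
      \<le> 2 * (card (sign_changes (P \<union> p 0 \<union> {}) (N \<union> m 0 \<union> {})) + card (sign_changes ({} \<union> p 0 \<union> P') ({} \<union> m 0 \<union> N')))
        + 2 * (of_bool (arc_end \<eta> = j) + of_bool (arc_start \<eta> = j))"
    proof cases
      case 1
      then have "P \<union> N = {} \<or> P' \<union> N' = {}"
        using ar ar\<eta> by (auto simp: P_def N_def P'_def N'_def above_at_eq)
      moreover have "p t = {}" "m t = {}" for t using 1 by (auto simp: p_def m_def)
      ultimately show ?thesis by auto
    next
      case 2
      then have "p 0 = {}" "m 0 = {j}" "p 1 = {}" "m 1 = {}" "p (-1) = {}" "m (-1) = {j}" by (auto simp: p_def m_def)
      then show ?thesis using mid no_ends by (simp add: of_bool_def)
    next
      case 3
      then have "p 0 = {j}" "m 0 = {}" "p 1 = {j}" "m 1 = {}" "p (-1) = {}" "m (-1) = {}" by (auto simp: p_def m_def)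
      then show ?thesis using mid no_ends by (simp add: of_bool_def)
    next
      case 4
      then have "height \<eta> j = 0" using height_eq_0[OF ar\<eta>] by simp
      then have "p 0 = {}" "m 0 = {}" "p 1 = {j}" "m 1 = {}" "p (-1) = {}" "m (-1) = {j}"
        using 4 arc_start_less_end[OF ar\<eta>] by (auto simp: p_def m_def)
      moreover have "P' = {}" "N' = {}" using 4 ar ar\<eta> by (auto simp: P'_def N'_def above_at_eq)
      ultimately show ?thesis using 4 mid no_ends by (simp add: of_bool_def)
    next
      case 5
      then have "height \<eta> j = 0" using height_eq_0[OF ar\<eta>] by simp
      then have "p 0 = {}" "m 0 = {}" "p 1 = {j}" "m 1 = {}" "p (-1) = {}" "m (-1) = {j}"
        using 5 arc_start_less_end[OF ar\<eta>] by (auto simp: p_def m_def)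
      moreover have "P = {}" "N = {}" using 5 ar ar\<eta> by (auto simp: P_def N_def above_at_eq)
      ultimately show ?thesis using 5 mid no_ends by (simp add: of_bool_def)
    qed
    moreover have "incidences (join_arcs True \<alpha> \<beta>) \<eta> + incidences (join_arcs False \<alpha> \<beta>) \<eta>
        + 2 * (of_bool (arc_end \<eta> = j) + of_bool (arc_start \<eta> = j)) = 2 * (incidences \<alpha> \<eta> + incidences \<beta> \<eta>)"
      using less by (auto simp: incidences_def join_arcs_simps)
    ultimately show ?thesis
      by (simp add: incompatibility_degree_eq S \<alpha> \<beta> \<eta> sets)
  qed
  then show "incompatibility_degree n (join_arcs True \<alpha> \<beta>) \<eta> + incompatibility_degree n (join_arcs False \<alpha> \<beta>) \<eta>
      \<le> 2 * (incompatibility_degree n \<alpha> \<eta> + incompatibility_degree n \<beta> \<eta>)" using \<eta> by blast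
  \<comment> \<open>A joined arc agrees with \<alpha> before \<open>j\<close>, so the two are
    separated only at \<open>j\<close> and cannot cross. In contrast \<beta> is non pointed with
    \<alpha>, which gives strictness.\<close>
  have "incompatibility_degree n (join_arcs up \<alpha> \<beta>) \<alpha> = 0" for up
  proof -
    have "above_at (join_arcs up \<alpha> \<beta>) \<alpha> = {} \<or> above_at \<alpha> (join_arcs up \<alpha> \<beta>) = {}"
    proof -
      have "r = j" if "r \<in> above_at (join_arcs up \<alpha> \<beta>) \<alpha> \<union> above_at \<alpha> (join_arcs up \<alpha> \<beta>)" for r
        using that ar isJ less h'(2)[of r up] by (cases "r < j") (auto simp: above_at_eq)
      then have "above_at (join_arcs up \<alpha> \<beta>) \<alpha> \<subseteq> {j}" "above_at \<alpha> (join_arcs up \<alpha> \<beta>) \<subseteq> {j}" by blast+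
      moreover have "above_at (join_arcs up \<alpha> \<beta>) \<alpha> \<inter> above_at \<alpha> (join_arcs up \<alpha> \<beta>) = {}"
        using ar isJ by (intro above_at_disjoint)
      ultimately show ?thesis by blast
    qed
    then have "sign_changes (above_at (join_arcs up \<alpha> \<beta>) \<alpha>) (above_at \<alpha> (join_arcs up \<alpha> \<beta>)) = {}" by auto
    moreover have "incidences (join_arcs up \<alpha> \<beta>) \<alpha> = 0" using less by (simp add: incidences_def join_arcs_simps)
    ultimately show ?thesis by (simp add: incompatibility_degree_eq S \<alpha>)
  qed
  moreover have "0 < incompatibility_degree n \<beta> \<alpha>"
    using less by (simp add: incompatibility_degree_eq \<alpha> \<beta> incidences_def)
  ultimately show "incompatibility_degree n (join_arcs True \<alpha> \<beta>) \<alpha> + incompatibility_degree n (join_arcs False \<alpha> \<beta>) \<alpha>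
      < 2 * (incompatibility_degree n \<alpha> \<alpha> + incompatibility_degree n \<beta> \<alpha>)" by simp
qed

lemma exchange_non_pointed:
  assumes \<alpha>: "\<alpha> \<in> wiggly_arcs n" and \<beta>: "\<beta> \<in> wiggly_arcs n" and j: "arc_end \<alpha> = arc_start \<beta>"
  shows "\<exists>\<gamma>\<in>wiggly_arcs n. \<exists>\<delta>\<in>wiggly_arcs n.
    (\<forall>r. height \<gamma> r + height \<delta> r = 2 * (height \<alpha> r + height \<beta> r) \<and> turn \<gamma> r + turn \<delta> r = 2 * (turn \<alpha> r + turn \<beta> r)) \<and>
    incompatibility_number n \<gamma> + incompatibility_number n \<delta> < 2 * (incompatibility_number n \<alpha> + incompatibility_number n \<beta>)"
proof (rule bexI[of _ "join_arcs True \<alpha> \<beta>"], rule bexI[of _ "join_arcs False \<alpha> \<beta>"], intro conjI allI)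
  note * = degree_join[OF \<alpha> \<beta> _ j]
  show "join_arcs True \<alpha> \<beta> \<in> wiggly_arcs n" "join_arcs False \<alpha> \<beta> \<in> wiggly_arcs n" using *(1)[OF \<alpha>] by blast+
  have ar: "is_arc \<alpha>" "is_arc \<beta>" using \<alpha> \<beta> by (auto simp: wiggly_arcs_iff)
  show "height (join_arcs True \<alpha> \<beta>) r + height (join_arcs False \<alpha> \<beta>) r = 2 * (height \<alpha> r + height \<beta> r)" for r
    using ar j height_eq_0[OF ar(1), of "arc_end \<alpha>"] height_eq_0[OF ar(2), of "arc_end \<alpha>"]
    by (simp add: join_arcs_is_arc(2)[OF ar j])
  show "turn (join_arcs True \<alpha> \<beta>) r + turn (join_arcs False \<alpha> \<beta>) r = 2 * (turn \<alpha> r + turn \<beta> r)" for r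
    using j by (simp add: join_arcs_simps turn_eq)
  show "incompatibility_number n (join_arcs True \<alpha> \<beta>) + incompatibility_number n (join_arcs False \<alpha> \<beta>)
    < 2 * (incompatibility_number n \<alpha> + incompatibility_number n \<beta>)"
    unfolding incompatibility_number_def sum.distrib[symmetric] sum_distrib_left
  proof (intro sum_strict_mono_ex1 finite_wiggly_arcs ballI)
    show "\<exists>\<eta>\<in>wiggly_arcs n. incompatibility_degree n (join_arcs True \<alpha> \<beta>) \<eta> + incompatibility_degree n (join_arcs False \<alpha> \<beta>) \<eta>
      < 2 * (incompatibility_degree n \<alpha> \<eta> + incompatibility_degree n \<beta> \<eta>)"
      using *(3)[OF \<alpha>] \<alpha> by blast
  qed (rule *(2))
qed

lemma incompatible_exchange:
  assumes \<alpha>: "\<alpha> \<in> wiggly_arcs n" and \<beta>: "\<beta> \<in> wiggly_arcs n" and inc: "\<not> compatible \<alpha> \<beta>"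
  shows "\<exists>\<gamma>\<in>wiggly_arcs n. \<exists>\<delta>\<in>wiggly_arcs n. \<exists>c::nat.
    (\<forall>r. height \<gamma> r + height \<delta> r = c * (height \<alpha> r + height \<beta> r) \<and> turn \<gamma> r + turn \<delta> r = c * (turn \<alpha> r + turn \<beta> r)) \<and>
    incompatibility_number n \<gamma> + incompatibility_number n \<delta> < c * (incompatibility_number n \<alpha> + incompatibility_number n \<beta>)"
    (is "?goal \<alpha> \<beta>")
proof -
  have sym: "?goal \<alpha> \<beta>" if "?goal \<beta> \<alpha>" using that by (simp add: add.commute)
  consider "arc_end \<alpha> = arc_start \<beta>" | "arc_end \<beta> = arc_start \<alpha>" | "crossing \<alpha> \<beta>"
    using inc by (auto simp: compatible_def non_pointed_iff)
  then show ?thesis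
  proof cases
    case 1
    then show ?thesis using exchange_non_pointed[OF \<alpha> \<beta>] by (metis of_nat_numeral)
  next
    case 2
    then show ?thesis using exchange_non_pointed[OF \<beta> \<alpha>] by (intro sym) (metis of_nat_numeral)
  next
    case 3
    have ar: "is_arc \<alpha>" "is_arc \<beta>" using \<alpha> \<beta> by (auto simp: wiggly_arcs_iff)
    obtain x y where xy: "x \<in> above_at \<alpha> \<beta>" "y \<in> above_at \<beta> \<alpha>" using 3 by (auto simp: crossing_def)
    obtain p q where pq: "p < q" "\<forall>r. p < r \<and> r < q \<longrightarrow> r \<notin> above_at \<alpha> \<beta> \<union> above_at \<beta> \<alpha>"
      "p \<in> above_at \<alpha> \<beta> \<and> q \<in> above_at \<beta> \<alpha> \<or> p \<in> above_at \<beta> \<alpha> \<and> q \<in> above_at \<alpha> \<beta>"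
      using sign_changes_nonempty[OF xy above_at_disjoint[OF ar]] by blast
    from pq(3) show ?thesis
    proof
      assume "p \<in> above_at \<alpha> \<beta> \<and> q \<in> above_at \<beta> \<alpha>"
      then show ?thesis using exchange_crossing[OF \<alpha> \<beta> pq(1)] pq(2) by (metis mult_1 of_nat_1)
    next
      assume "p \<in> above_at \<beta> \<alpha> \<and> q \<in> above_at \<alpha> \<beta>"
      then show ?thesis using exchange_crossing[OF \<beta> \<alpha> pq(1)] pq(2) by (intro sym) (metis mult_1 of_nat_1 Un_commute)
    qed
  qed
qed

section \<open>Uniqueness of compatible decompositions\<close>

text \<open>Read \<open>m c\<close> as a capacity and \<open>x c\<close> as the filled part. For
  every pair, \<open>order\<close> fixes a priority common to \<open>x\<close> and
  \<open>x'\<close>: one class receives mass only when the other is full. If \<open>x\<close>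
  exceeds \<open>x'\<close> at \<open>c\<close>, equal sums force the opposite at some
  \<open>d\<close>, and either priority between \<open>c\<close> and \<open>d\<close> is then
  violated by one of the two fillings.\<close>

lemma threshold_le:
  fixes x x' m :: "'c \<Rightarrow> real"
  assumes fin: "finite C" and sums: "sum x C = sum x' C"
    and bounds: "\<And>c. c \<in> C \<Longrightarrow> 0 \<le> x c \<and> x c \<le> m c" "\<And>c. c \<in> C \<Longrightarrow> 0 \<le> x' c \<and> x' c \<le> m c"
    and order: "\<And>c d. \<lbrakk>c \<in> C; d \<in> C; c \<noteq> d; 0 < m c; 0 < m d\<rbrakk> \<Longrightarrow>
      \<not> (x c < m c \<and> 0 < x d) \<and> \<not> (x' c < m c \<and> 0 < x' d) \<or>
      \<not> (x d < m d \<and> 0 < x c) \<and> \<not> (x' d < m d \<and> 0 < x' c)"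
    and c: "c \<in> C"
  shows "x c \<le> x' c"
proof (rule ccontr)
  assume less: "\<not> x c \<le> x' c"
  have "\<exists>d\<in>C. x d < x' d"
  proof (rule ccontr)
    assume "\<not> ?thesis"
    then have "sum x' C < sum x C"
      using c less fin by (intro sum_strict_mono_ex1) (auto simp: not_less not_le)
    then show False using sums by simp
  qed
  then obtain d where d: "d \<in> C" "x d < x' d" by blast
  then have "c \<noteq> d" using less by auto
  then show False
    using order[OF c d(1)] bounds(1)[OF c] bounds(2)[OF c] bounds(1)[OF d(1)] bounds(2)[OF d(1)] d(2) less
    by linarith
qed

lemma threshold_unique:
  fixes x x' m :: "'c \<Rightarrow> real"
  assumes fin: "finite C" and sums: "sum x C = sum x' C"
    and bounds: "\<And>c. c \<in> C \<Longrightarrow> 0 \<le> x c \<and> x c \<le> m c" "\<And>c. c \<in> C \<Longrightarrow> 0 \<le> x' c \<and> x' c \<le> m c"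
    and order: "\<And>c d. \<lbrakk>c \<in> C; d \<in> C; c \<noteq> d; 0 < m c; 0 < m d\<rbrakk> \<Longrightarrow>
      \<not> (x c < m c \<and> 0 < x d) \<and> \<not> (x' c < m c \<and> 0 < x' d) \<or>
      \<not> (x d < m d \<and> 0 < x c) \<and> \<not> (x' d < m d \<and> 0 < x' c)"
    and c: "c \<in> C"
  shows "x c = x' c"
proof (rule antisym)
  show "x c \<le> x' c" using assms by (rule threshold_le)
  show "x' c \<le> x c"
  proof (rule threshold_le[where m = m and C = C])
    show "\<not> (x' c < m c \<and> 0 < x' d) \<and> \<not> (x c < m c \<and> 0 < x d) \<or>
      \<not> (x' d < m d \<and> 0 < x' c) \<and> \<not> (x d < m d \<and> 0 < x c)"
      if "c \<in> C" "d \<in> C" "c \<noteq> d" "0 < m c" "0 < m d" for c d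
      using order[OF that] by blast
  qed (use assms(1-4) c in auto)
qed

lemma arc_eqI:
  assumes "is_arc \<alpha>" "is_arc \<beta>" "arc_start \<alpha> = arc_start \<beta>" "arc_end \<alpha> = arc_end \<beta>" "\<And>r. height \<alpha> r = height \<beta> r"
  shows "\<alpha> = \<beta>"
proof -
  obtain i j A B where \<alpha>: "\<alpha> = (i, j, A, B)" by (cases \<alpha>)
  obtain i' j' A' B' where \<beta>: "\<beta> = (i', j', A', B')" by (cases \<beta>)
  have "A \<inter> B = {}" "A' \<inter> B' = {}" using assms(1,2) by (auto simp: \<alpha> \<beta> is_arc_def)
  then have "r \<in> A \<longleftrightarrow> r \<in> A'" "r \<in> B \<longleftrightarrow> r \<in> B'" for r
    using assms(5)[of r] by (auto simp: \<alpha> \<beta> height_def of_bool_def split: if_splits)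
  then show ?thesis using assms(3,4) by (auto simp: \<alpha> \<beta> arc_start_def arc_end_def)
qed

text \<open>Without separation the heights agree wherever both arcs are present. At the later of two
  different starts one height would be 0 and the other 1 or -1, so the starts agree too. This makes
  any two strands at a point comparable in the stack.\<close>

lemma separated_if_same_end:
  assumes "is_arc \<alpha>" "is_arc \<beta>" "arc_end \<alpha> = arc_end \<beta>" "\<alpha> \<noteq> \<beta>"
  shows "above_at \<alpha> \<beta> \<union> above_at \<beta> \<alpha> \<noteq> {}"
proof
  assume empty: "above_at \<alpha> \<beta> \<union> above_at \<beta> \<alpha> = {}"
  have eq: "height \<alpha> r = height \<beta> r" if "arc_start \<alpha> \<le> r" "arc_start \<beta> \<le> r" for r
  proof (cases "r \<le> arc_end \<alpha>")
    case True
    then have "r \<notin> above_at \<alpha> \<beta>" "r \<notin> above_at \<beta> \<alpha>" using empty by auto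
    then show ?thesis using that True assms(1-3) by (auto simp: above_at_eq)
  next
    case False
    then show ?thesis using assms(1-3) height_eq_0 by (metis nat_le_linear)
  qed
  have start: "arc_start \<alpha> = arc_start \<beta>"
  proof (rule ccontr)
    assume "arc_start \<alpha> \<noteq> arc_start \<beta>"
    then consider "arc_start \<alpha> < arc_start \<beta>" | "arc_start \<beta> < arc_start \<alpha>" by linarith
    then show False
    proof cases
      case 1
      then show False
        using eq[of "arc_start \<beta>"] height_cases[OF assms(1), of "arc_start \<beta>"] height_eq_0[OF assms(2), of "arc_start \<beta>"]
          arc_start_less_end[OF assms(2)] assms(3) by auto
    next
      case 2
      then show False
        using eq[of "arc_start \<alpha>"] height_cases[OF assms(2), of "arc_start \<alpha>"] height_eq_0[OF assms(1), of "arc_start \<alpha>"]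
          arc_start_less_end[OF assms(1)] assms(3) by auto
    qed
  qed
  have "height \<alpha> r = height \<beta> r" for r
  proof (cases "arc_start \<alpha> \<le> r")
    case False
    then show ?thesis using start assms(1,2) height_eq_0 by (metis nat_le_linear)
  qed (use eq start in auto)
  then show False using arc_eqI[OF assms(1,2) start assms(3)] assms(4) by blast
qed

section \<open>Truncation and weights of strands\<close>

text \<open>An arc going past \<open>n + 1\<close> is made to end there and its side at
  \<open>n + 1\<close> is forgotten; this side is what \<open>extend_up\<close> and
  \<open>extend_down\<close> restore.\<close>

definition truncate :: "nat \<Rightarrow> arc \<Rightarrow> arc" where
  "truncate n = (\<lambda>(i, j, A, B). (i, min j (n + 1), A \<inter> {..n}, B \<inter> {..n}))"

definition extend_up :: "arc \<Rightarrow> arc" where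
  "extend_up = (\<lambda>(i, j, A, B). (i, Suc j, insert j A, B))"

definition extend_down :: "arc \<Rightarrow> arc" where
  "extend_down = (\<lambda>(i, j, A, B). (i, Suc j, A, insert j B))"

lemma truncate_simps:
  "arc_start (truncate n \<alpha>) = arc_start \<alpha>" "arc_end (truncate n \<alpha>) = min (arc_end \<alpha>) (n + 1)"
  "height (truncate n \<alpha>) r = (if r \<le> n then height \<alpha> r else 0)"
  by (auto simp: truncate_def arc_start_def arc_end_def height_def split: prod.splits)

lemma truncate_wiggly:
  assumes "\<alpha> \<in> wiggly_arcs (Suc n)" "arc_start \<alpha> \<le> n"
  shows "truncate n \<alpha> \<in> wiggly_arcs n"
proof -
  obtain i j A B where \<alpha>: "\<alpha> = (i, j, A, B)" by (cases \<alpha>)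
  have *: "i < j" "j \<le> n + 2" "A \<union> B = {i<..<j}" "A \<inter> B = {}" "i \<le> n"
    using assms by (auto simp: \<alpha> wiggly_arcs_def arc_start_def)
  have "A \<inter> {..n} \<union> B \<inter> {..n} = (A \<union> B) \<inter> {..n}" by blast
  also have "\<dots> = {i<..<min j (n + 1)}" using * by auto
  finally show ?thesis using * by (auto simp: \<alpha> wiggly_arcs_def truncate_def)
qed

lemma truncate_self:
  assumes "is_arc \<alpha>" "arc_end \<alpha> \<le> n + 1"
  shows "truncate n \<alpha> = \<alpha>"
proof -
  obtain i j A B where \<alpha>: "\<alpha> = (i, j, A, B)" by (cases \<alpha>)
  have *: "A \<union> B = {i<..<j}" "j \<le> n + 1" using assms by (auto simp: \<alpha> is_arc_def arc_end_def)
  have "A \<union> B \<subseteq> {..n}" unfolding *(1) using *(2) by auto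
  then show ?thesis using *(2) by (auto simp: \<alpha> truncate_def)
qed

lemma extend_simps:
  "arc_start (extend_up \<alpha>) = arc_start \<alpha>" "arc_end (extend_up \<alpha>) = Suc (arc_end \<alpha>)"
  "arc_start (extend_down \<alpha>) = arc_start \<alpha>" "arc_end (extend_down \<alpha>) = Suc (arc_end \<alpha>)"
  by (auto simp: extend_up_def extend_down_def arc_start_def arc_end_def split: prod.splits)

lemma extend_arc:
  assumes "is_arc \<alpha>"
  shows "is_arc (extend_up \<alpha>)" "is_arc (extend_down \<alpha>)"
    "height (extend_up \<alpha>) r = (if r = arc_end \<alpha> then 1 else height \<alpha> r)"
    "height (extend_down \<alpha>) r = (if r = arc_end \<alpha> then - 1 else height \<alpha> r)"
proof -
  obtain i j A B where \<alpha>: "\<alpha> = (i, j, A, B)" by (cases \<alpha>)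
  have *: "A \<union> B = {i<..<j}" "A \<inter> B = {}" "i < j" using assms by (auto simp: \<alpha> is_arc_def)
  then have "j \<notin> A" "j \<notin> B" by (auto simp: set_eq_iff)
  then show "height (extend_up \<alpha>) r = (if r = arc_end \<alpha> then 1 else height \<alpha> r)"
    "height (extend_down \<alpha>) r = (if r = arc_end \<alpha> then - 1 else height \<alpha> r)"
    by (auto simp: \<alpha> extend_up_def extend_down_def height_def arc_end_def)
  have "insert j (A \<union> B) = {i<..<Suc j}" using * by auto
  then show "is_arc (extend_up \<alpha>)" "is_arc (extend_down \<alpha>)"
    using * \<open>j \<notin> A\<close> \<open>j \<notin> B\<close> by (auto simp: \<alpha> extend_up_def extend_down_def is_arc_def)
qed

text \<open>Only the behaviour at \<open>n + 1\<close> is lost, and a strand that reaches this point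
  either ends there, passes above it or passes below it.\<close>

lemma truncate_fiber:
  assumes c: "c \<in> wiggly_arcs n"
  shows "{\<alpha> \<in> wiggly_arcs (Suc n). arc_start \<alpha> \<le> n \<and> truncate n \<alpha> = c}
    = (if arc_end c = n + 1 then {c, extend_up c, extend_down c} else {c})" (is "?F = _")
proof -
  have ar: "is_arc c" "arc_end c \<le> n + 1" using c by (auto simp: wiggly_arcs_iff)
  have cF: "c \<in> ?F"
    using truncate_self[OF ar] ar arc_start_less_end[OF ar(1)] by (auto simp: wiggly_arcs_iff)
  have sub: "\<alpha> = c \<or> arc_end c = n + 1 \<and> (\<alpha> = extend_up c \<or> \<alpha> = extend_down c)" if "\<alpha> \<in> ?F" for \<alpha>
  proof (cases "arc_end \<alpha> \<le> n + 1")
    case True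
    then show ?thesis using that truncate_self[of \<alpha> n] by (auto simp: wiggly_arcs_iff)
  next
    case False
    have \<alpha>: "is_arc \<alpha>" "arc_end \<alpha> = n + 2" "arc_start \<alpha> \<le> n" "c = truncate n \<alpha>"
      using that False by (auto simp: wiggly_arcs_iff)
    have endc: "arc_end c = n + 1" "arc_start c = arc_start \<alpha>" using \<alpha> by (auto simp: truncate_simps)
    have h: "height c r = (if r \<le> n then height \<alpha> r else 0)" for r using \<alpha> by (simp add: truncate_simps)
    have big: "height \<alpha> r = 0" if "n + 1 < r" for r using height_eq_0[OF \<alpha>(1)] that \<alpha>(2) by simp
    from height_cases[OF \<alpha>(1), of "n + 1"] \<alpha>(2,3)
    consider "height \<alpha> (n + 1) = 1" | "height \<alpha> (n + 1) = -1" by fastforce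
    then show ?thesis
    proof cases
      case 1
      have "\<alpha> = extend_up c"
        by (rule arc_eqI) (use 1 \<alpha> endc h big extend_arc[OF ar(1)] in \<open>auto simp: extend_simps not_le less_Suc_eq_le elim!: le_SucE\<close>)
      then show ?thesis using endc by blast
    next
      case 2
      have "\<alpha> = extend_down c"
        by (rule arc_eqI) (use 2 \<alpha> endc h big extend_arc[OF ar(1)] in \<open>auto simp: extend_simps not_le less_Suc_eq_le elim!: le_SucE\<close>)
      then show ?thesis using endc by blast
    qed
  qed
  have ext: "extend_up c \<in> ?F" "extend_down c \<in> ?F" if e: "arc_end c = n + 1"
  proof -
    have s: "arc_start c \<le> n" using arc_start_less_end[OF ar(1)] e by simp
    have w: "extend_up c \<in> wiggly_arcs (Suc n)" "extend_down c \<in> wiggly_arcs (Suc n)"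
      using extend_arc[OF ar(1)] e by (auto simp: wiggly_arcs_iff extend_simps)
    have t: "is_arc (truncate n (extend_up c))" "is_arc (truncate n (extend_down c))"
      using truncate_wiggly[OF w(1)] truncate_wiggly[OF w(2)] s by (auto simp: wiggly_arcs_iff extend_simps)
    have hc: "height c r = 0" if "n < r" for r using height_eq_0[OF ar(1)] e that by simp
    have "truncate n (extend_up c) = c" "truncate n (extend_down c) = c"
      by (rule arc_eqI; use t ar e hc extend_arc[OF ar(1)] in \<open>auto simp: truncate_simps extend_simps\<close>)+
    then show "extend_up c \<in> ?F" "extend_down c \<in> ?F" using w s by (auto simp: extend_simps)
  qed
  show ?thesis
  proof (cases "arc_end c = n + 1")
    case True
    then have "?F = {c, extend_up c, extend_down c}" using cF sub ext by blast
    then show ?thesis using True by simp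
  next
    case False
    then have "?F = {c}" using cF sub by blast
    then show ?thesis using False by simp
  qed
qed

text \<open>Truncation only removes comparisons of heights, and the new end point
  \<open>n + 1\<close> cannot be a start, as both arcs start at \<open>n\<close> or earlier.\<close>

lemma compatible_truncate:
  assumes \<alpha>: "\<alpha> \<in> wiggly_arcs (Suc n)" "arc_start \<alpha> \<le> n" and \<beta>: "\<beta> \<in> wiggly_arcs (Suc n)" "arc_start \<beta> \<le> n"
    and "compatible \<alpha> \<beta>"
  shows "compatible (truncate n \<alpha>) (truncate n \<beta>)"
proof -
  have ar: "is_arc \<alpha>" "is_arc \<beta>" "is_arc (truncate n \<alpha>)" "is_arc (truncate n \<beta>)"
    using \<alpha> \<beta> truncate_wiggly[OF \<alpha>] truncate_wiggly[OF \<beta>] by (auto simp: wiggly_arcs_iff)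
  have "above_at (truncate n \<alpha>) (truncate n \<beta>) \<subseteq> above_at \<alpha> \<beta>"
    "above_at (truncate n \<beta>) (truncate n \<alpha>) \<subseteq> above_at \<beta> \<alpha>"
    using ar by (auto simp: above_at_eq truncate_simps split: if_splits)
  then have "\<not> crossing (truncate n \<alpha>) (truncate n \<beta>)"
    using assms(5) by (auto simp: compatible_def crossing_def)
  moreover have "\<not> non_pointed (truncate n \<alpha>) (truncate n \<beta>)"
    using assms by (auto simp: compatible_def non_pointed_iff truncate_simps)
  ultimately show ?thesis by (simp add: compatible_def)
qed

text \<open>This single arc cannot be truncated, so every sum over
  \<open>wiggly_arcs (Suc n)\<close> treats it separately.\<close>

lemma wiggly_arcs_Suc_late:
  assumes "\<alpha> \<in> wiggly_arcs (Suc n)" "\<not> arc_start \<alpha> \<le> n"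
  shows "\<alpha> = (Suc n, Suc (Suc n), {}, {})"
proof -
  obtain i j A B where \<alpha>: "\<alpha> = (i, j, A, B)" by (cases \<alpha>)
  have *: "i < j" "j \<le> Suc n + 1" "A \<union> B = {i<..<j}" "n < i"
    using assms by (auto simp: \<alpha> wiggly_arcs_def arc_start_def)
  then have ij: "i = Suc n" "j = Suc (Suc n)" by auto
  then have "A \<union> B = {}" using *(3) by auto
  then show ?thesis using ij by (simp add: \<alpha>)
qed

definition compatible_weights :: "nat \<Rightarrow> (arc \<Rightarrow> real) \<Rightarrow> bool" where
  "compatible_weights n c \<longleftrightarrow> (\<forall>\<alpha>\<in>wiggly_arcs n. 0 \<le> c \<alpha>) \<and>
    (\<forall>\<alpha>\<in>wiggly_arcs n. \<forall>\<beta>\<in>wiggly_arcs n. c \<alpha> \<noteq> 0 \<and> c \<beta> \<noteq> 0 \<longrightarrow> compatible \<alpha> \<beta>)"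

text \<open>This is the push-forward of the weights under truncation: strands that become
  indistinguishable add up.\<close>

definition truncate_weights :: "nat \<Rightarrow> (arc \<Rightarrow> real) \<Rightarrow> arc \<Rightarrow> real" where
  "truncate_weights n c \<gamma> = (\<Sum>\<alpha> | \<alpha> \<in> wiggly_arcs (Suc n) \<and> arc_start \<alpha> \<le> n \<and> truncate n \<alpha> = \<gamma>. c \<alpha>)"

lemma extend_distinct:
  assumes "is_arc \<gamma>"
  shows "extend_up \<gamma> \<noteq> \<gamma>" "extend_down \<gamma> \<noteq> \<gamma>" "extend_up \<gamma> \<noteq> extend_down \<gamma>"
proof -
  show "extend_up \<gamma> \<noteq> \<gamma>" "extend_down \<gamma> \<noteq> \<gamma>" using extend_simps[of \<gamma>] by (metis n_not_Suc_n)+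
  show "extend_up \<gamma> \<noteq> extend_down \<gamma>"
    using extend_arc(3,4)[OF assms, of "arc_end \<gamma>"] by auto
qed

lemma truncate_weights_eq:
  assumes "\<gamma> \<in> wiggly_arcs n"
  shows "truncate_weights n c \<gamma> = (if arc_end \<gamma> = n + 1 then c \<gamma> + c (extend_up \<gamma>) + c (extend_down \<gamma>) else c \<gamma>)"
  using extend_distinct[of \<gamma>] assms unfolding truncate_weights_def truncate_fiber[OF assms]
  by (auto simp: wiggly_arcs_iff)

lemma sum_truncate:
  "(\<Sum>\<gamma>\<in>wiggly_arcs n. \<Sum>\<alpha> | \<alpha> \<in> wiggly_arcs (Suc n) \<and> arc_start \<alpha> \<le> n \<and> truncate n \<alpha> = \<gamma>. f \<alpha>)
    = (\<Sum>\<alpha> | \<alpha> \<in> wiggly_arcs (Suc n) \<and> arc_start \<alpha> \<le> n. f \<alpha>)"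
proof -
  have "(\<Sum>\<gamma>\<in>wiggly_arcs n. sum f {\<alpha> \<in> {\<alpha> \<in> wiggly_arcs (Suc n). arc_start \<alpha> \<le> n}. truncate n \<alpha> = \<gamma>})
    = sum f {\<alpha> \<in> wiggly_arcs (Suc n). arc_start \<alpha> \<le> n}"
    by (rule sum.group) (auto simp: finite_wiggly_arcs truncate_wiggly)
  moreover have "{\<alpha> \<in> {\<alpha> \<in> wiggly_arcs (Suc n). arc_start \<alpha> \<le> n}. truncate n \<alpha> = \<gamma>}
    = {\<alpha>. \<alpha> \<in> wiggly_arcs (Suc n) \<and> arc_start \<alpha> \<le> n \<and> truncate n \<alpha> = \<gamma>}" for \<gamma> by blast
  ultimately show ?thesis by simp
qed

lemma sum_truncate_weights:
  "(\<Sum>\<gamma>\<in>wiggly_arcs n. truncate_weights n c \<gamma> * f \<gamma>)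
    = (\<Sum>\<alpha> | \<alpha> \<in> wiggly_arcs (Suc n) \<and> arc_start \<alpha> \<le> n. c \<alpha> * f (truncate n \<alpha>))"
  unfolding sum_truncate[symmetric] truncate_weights_def sum_distrib_right
  by (intro sum.cong) auto

lemma wiggly_arcs_Suc_split:
  fixes f :: "arc \<Rightarrow> real"
  shows "(\<Sum>\<alpha>\<in>wiggly_arcs (Suc n). f \<alpha>)
    = (\<Sum>\<alpha> | \<alpha> \<in> wiggly_arcs (Suc n) \<and> arc_start \<alpha> \<le> n. f \<alpha>) + f (Suc n, Suc (Suc n), {}, {})"
proof -
  let ?\<omega> = "(Suc n, Suc (Suc n), {}, {}) :: arc"
  define S where "S = {\<alpha> \<in> wiggly_arcs (Suc n). arc_start \<alpha> \<le> n}"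
  have "?\<omega> \<in> wiggly_arcs (Suc n)" by (auto simp: wiggly_arcs_def)
  then have eq: "wiggly_arcs (Suc n) = insert ?\<omega> S"
    using wiggly_arcs_Suc_late unfolding S_def by blast
  have "finite S" "?\<omega> \<notin> S" by (auto simp: S_def finite_wiggly_arcs arc_start_def)
  then have "sum f (insert ?\<omega> S) = sum f S + f ?\<omega>" by (simp add: add.commute)
  then have "sum f (wiggly_arcs (Suc n)) = sum f S + f ?\<omega>" by (simp only: eq)
  then show ?thesis unfolding S_def .
qed

lemma compatible_weights_truncate:
  assumes "compatible_weights (Suc n) c"
  shows "compatible_weights n (truncate_weights n c)"
  unfolding compatible_weights_def
proof (intro conjI ballI impI)
  fix \<gamma> show "0 \<le> truncate_weights n c \<gamma>"
    using assms unfolding truncate_weights_def compatible_weights_def by (auto intro: sum_nonneg)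
next
  have preimage: "\<exists>\<alpha>. \<alpha> \<in> wiggly_arcs (Suc n) \<and> arc_start \<alpha> \<le> n \<and> truncate n \<alpha> = \<gamma> \<and> c \<alpha> \<noteq> 0"
    if "truncate_weights n c \<gamma> \<noteq> 0" for \<gamma>
    using that unfolding truncate_weights_def by (rule sum.not_neutral_contains_not_neutral) blast
  fix \<gamma> \<gamma>' assume "truncate_weights n c \<gamma> \<noteq> 0 \<and> truncate_weights n c \<gamma>' \<noteq> 0"
  then obtain \<alpha> \<beta> where "\<alpha> \<in> wiggly_arcs (Suc n)" "arc_start \<alpha> \<le> n" "truncate n \<alpha> = \<gamma>" "c \<alpha> \<noteq> 0"
    "\<beta> \<in> wiggly_arcs (Suc n)" "arc_start \<beta> \<le> n" "truncate n \<beta> = \<gamma>'" "c \<beta> \<noteq> 0"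
    using preimage[of \<gamma>] preimage[of \<gamma>'] by auto
  then show "compatible \<gamma> \<gamma>'"
    using compatible_truncate[of \<alpha> n \<beta>] assms unfolding compatible_weights_def by blast
qed

text \<open>Heights and turns at points up to \<open>n\<close> survive truncation, and the arc
  starting at \<open>n + 1\<close> contributes nothing to them. The hypotheses of the uniqueness
  theorem therefore pass to the induction hypothesis.\<close>

lemma sum_height_truncate:
  assumes "r \<le> n"
  shows "(\<Sum>\<gamma>\<in>wiggly_arcs n. truncate_weights n c \<gamma> * height \<gamma> r) = (\<Sum>\<alpha>\<in>wiggly_arcs (Suc n). c \<alpha> * height \<alpha> r)"
    and "(\<Sum>\<gamma>\<in>wiggly_arcs n. truncate_weights n c \<gamma> * turn \<gamma> r) = (\<Sum>\<alpha>\<in>wiggly_arcs (Suc n). c \<alpha> * turn \<alpha> r)"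
proof -
  have "height (Suc n, Suc (Suc n), {}, {}) r = 0" by (simp add: height_def)
  then show "(\<Sum>\<gamma>\<in>wiggly_arcs n. truncate_weights n c \<gamma> * height \<gamma> r) = (\<Sum>\<alpha>\<in>wiggly_arcs (Suc n). c \<alpha> * height \<alpha> r)"
    unfolding sum_truncate_weights[of n c "\<lambda>\<gamma>. height \<gamma> r"] wiggly_arcs_Suc_split[of "\<lambda>\<alpha>. c \<alpha> * height \<alpha> r"]
    using assms by (simp add: truncate_simps)
  have "turn (truncate n \<alpha>) r = turn \<alpha> r" for \<alpha>
    using assms by (simp add: turn_eq truncate_simps min_def)
  then show "(\<Sum>\<gamma>\<in>wiggly_arcs n. truncate_weights n c \<gamma> * turn \<gamma> r) = (\<Sum>\<alpha>\<in>wiggly_arcs (Suc n). c \<alpha> * turn \<alpha> r)"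
    unfolding sum_truncate_weights[of n c "\<lambda>\<gamma>. turn \<gamma> r"] wiggly_arcs_Suc_split[of "\<lambda>\<alpha>. c \<alpha> * turn \<alpha> r"]
    using assms by (simp add: turn_def)
qed

lemma sum_fibers:
  "(\<Sum>\<alpha> | \<alpha> \<in> wiggly_arcs (Suc n) \<and> arc_start \<alpha> \<le> n. f \<alpha>)
    = (\<Sum>\<gamma> | \<gamma> \<in> wiggly_arcs n \<and> arc_end \<gamma> = n + 1. f \<gamma> + f (extend_up \<gamma>) + f (extend_down \<gamma>))
      + (\<Sum>\<gamma> | \<gamma> \<in> wiggly_arcs n \<and> arc_end \<gamma> \<noteq> n + 1. f \<gamma>)"
  for f :: "arc \<Rightarrow> real"
proof -
  have "(\<Sum>\<alpha> | \<alpha> \<in> wiggly_arcs (Suc n) \<and> arc_start \<alpha> \<le> n. f \<alpha>) = (\<Sum>\<gamma>\<in>wiggly_arcs n. truncate_weights n f \<gamma>)"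
    unfolding truncate_weights_def by (rule sum_truncate[symmetric])
  also have "\<dots> = (\<Sum>\<gamma>\<in>wiggly_arcs n. if arc_end \<gamma> = n + 1 then f \<gamma> + f (extend_up \<gamma>) + f (extend_down \<gamma>) else f \<gamma>)"
    by (intro sum.cong refl truncate_weights_eq)
  also have "\<dots> = (\<Sum>\<gamma> | \<gamma> \<in> wiggly_arcs n \<and> arc_end \<gamma> = n + 1. f \<gamma> + f (extend_up \<gamma>) + f (extend_down \<gamma>))
      + (\<Sum>\<gamma> | \<gamma> \<in> wiggly_arcs n \<and> arc_end \<gamma> \<noteq> n + 1. f \<gamma>)"
    by (simp add: sum.If_cases finite_wiggly_arcs Int_def Collect_neg_eq[symmetric])
  finally show ?thesis .
qed

text \<open>At the point \<open>n + 1\<close>, the strands of a compatible family that reach this point are stacked vertically: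
  an upper strand that does not pass above \<open>n + 1\<close> prevents every lower strand from doing so.\<close>

lemma stacked:
  assumes w: "compatible_weights (Suc n) c"
    and \<gamma>: "\<gamma> \<in> wiggly_arcs n" "arc_end \<gamma> = n + 1" and \<delta>: "\<delta> \<in> wiggly_arcs n" "arc_end \<delta> = n + 1"
    and r: "r \<in> above_at \<gamma> \<delta>"
  shows "c \<gamma> + c (extend_down \<gamma>) = 0 \<or> c (extend_up \<delta>) = 0"
    and "c (extend_down \<gamma>) = 0 \<or> c \<delta> + c (extend_up \<delta>) = 0"
proof -
  have ar: "is_arc \<gamma>" "is_arc \<delta>" using \<gamma> \<delta> by (auto simp: wiggly_arcs_iff)
  have lt: "arc_start \<gamma> < n + 1" "arc_start \<delta> < n + 1"
    using arc_start_less_end[OF ar(1)] arc_start_less_end[OF ar(2)] \<gamma> \<delta> by auto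
  have r': "r \<noteq> n + 1" using r ar \<gamma> \<delta> height_eq_0[OF ar(1)] height_eq_0[OF ar(2)] by (auto simp: above_at_eq)
  have wig: "\<zeta> \<in> wiggly_arcs (Suc n)" if "\<zeta> \<in> {\<gamma>, extend_up \<gamma>, extend_down \<gamma>, \<delta>, extend_up \<delta>, extend_down \<delta>}" for \<zeta>
    using that \<gamma> \<delta> extend_arc[OF ar(1)] extend_arc[OF ar(2)] by (auto simp: wiggly_arcs_iff extend_simps)
  \<comment> \<open>At \<open>n + 1\<close> the height of \<zeta> is 0 or -1 and that of \<xi> is 0
    or 1. The excluded pair is the one in which both strands end there and the order is not
    reversed.\<close>
  have crossing: "c \<zeta> = 0 \<or> c \<xi> = 0"
    if "\<zeta> \<in> {\<gamma>, extend_down \<gamma>}" "\<xi> \<in> {\<delta>, extend_up \<delta>}" "(\<zeta>, \<xi>) \<noteq> (\<gamma>, \<delta>)" for \<zeta> \<xi>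
  proof -
    have "r \<in> above_at \<zeta> \<xi>" "n + 1 \<in> above_at \<xi> \<zeta>"
      using that r r' ar \<gamma> \<delta> lt extend_arc[OF ar(1)] extend_arc[OF ar(2)]
        height_eq_0[OF ar(1), of "n + 1"] height_eq_0[OF ar(2), of "n + 1"]
      by (auto simp: above_at_eq extend_simps)
    then have "\<not> compatible \<zeta> \<xi>" by (auto simp: compatible_def crossing_def)
    then show ?thesis using w wig[of \<zeta>] wig[of \<xi>] that unfolding compatible_weights_def by blast
  qed
  show "c \<gamma> + c (extend_down \<gamma>) = 0 \<or> c (extend_up \<delta>) = 0"
    using crossing[of \<gamma> "extend_up \<delta>"] crossing[of "extend_down \<gamma>" "extend_up \<delta>"] extend_distinct[OF ar(2)] by auto
  show "c (extend_down \<gamma>) = 0 \<or> c \<delta> + c (extend_up \<delta>) = 0"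
    using crossing[of "extend_down \<gamma>" \<delta>] crossing[of "extend_down \<gamma>" "extend_up \<delta>"] extend_distinct[OF ar(1)] by auto
qed

text \<open>Of the strands reaching \<open>n + 1\<close>, those that end there affect only the turn
  and those that pass affect only the height; the one negative turn comes from the arc starting
  there.\<close>

lemma sum_at_last_point:
  fixes c :: "arc \<Rightarrow> real"
  shows "(\<Sum>\<alpha>\<in>wiggly_arcs (Suc n). c \<alpha> * turn \<alpha> (n + 1))
      = (\<Sum>\<gamma> | \<gamma> \<in> wiggly_arcs n \<and> arc_end \<gamma> = n + 1. c \<gamma>) - c (Suc n, Suc (Suc n), {}, {})"
    and "(\<Sum>\<alpha>\<in>wiggly_arcs (Suc n). c \<alpha> * height \<alpha> (n + 1))
      = (\<Sum>\<gamma> | \<gamma> \<in> wiggly_arcs n \<and> arc_end \<gamma> = n + 1. c (extend_up \<gamma>) - c (extend_down \<gamma>))"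
proof -
  let ?C = "{\<gamma>. \<gamma> \<in> wiggly_arcs n \<and> arc_end \<gamma> = n + 1}" and ?E = "{\<gamma>. \<gamma> \<in> wiggly_arcs n \<and> arc_end \<gamma> \<noteq> n + 1}"
  let ?\<omega> = "(Suc n, Suc (Suc n), {}, {}) :: arc"
  have C: "is_arc \<gamma>" "arc_end \<gamma> = n + 1" "arc_start \<gamma> < n + 1" if "\<gamma> \<in> ?C" for \<gamma>
    using that arc_start_less_end[of \<gamma>] by (auto simp: wiggly_arcs_iff)
  have E: "is_arc \<gamma>" "arc_end \<gamma> < n + 1" "arc_start \<gamma> < n + 1" if "\<gamma> \<in> ?E" for \<gamma>
    using that arc_start_less_end[of \<gamma>] by (auto simp: wiggly_arcs_iff)
  have "(\<Sum>\<alpha>\<in>wiggly_arcs (Suc n). c \<alpha> * turn \<alpha> (n + 1))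
    = (\<Sum>\<gamma>\<in>?C. c \<gamma> * turn \<gamma> (n + 1) + c (extend_up \<gamma>) * turn (extend_up \<gamma>) (n + 1)
        + c (extend_down \<gamma>) * turn (extend_down \<gamma>) (n + 1))
      + (\<Sum>\<gamma>\<in>?E. c \<gamma> * turn \<gamma> (n + 1)) + c ?\<omega> * turn ?\<omega> (n + 1)"
    unfolding wiggly_arcs_Suc_split sum_fibers ..
  also have "(\<Sum>\<gamma>\<in>?C. c \<gamma> * turn \<gamma> (n + 1) + c (extend_up \<gamma>) * turn (extend_up \<gamma>) (n + 1)
        + c (extend_down \<gamma>) * turn (extend_down \<gamma>) (n + 1)) = (\<Sum>\<gamma>\<in>?C. c \<gamma>)"
  proof (intro sum.cong refl)
    fix \<gamma> assume "\<gamma> \<in> ?C"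
    note C[OF this]
    then show "c \<gamma> * turn \<gamma> (n + 1) + c (extend_up \<gamma>) * turn (extend_up \<gamma>) (n + 1)
        + c (extend_down \<gamma>) * turn (extend_down \<gamma>) (n + 1) = c \<gamma>"
      by (simp add: turn_eq extend_simps)
  qed
  also have "(\<Sum>\<gamma>\<in>?E. c \<gamma> * turn \<gamma> (n + 1)) = 0"
  proof (intro sum.neutral ballI)
    fix \<gamma> assume "\<gamma> \<in> ?E"
    then show "c \<gamma> * turn \<gamma> (n + 1) = 0" using E[of \<gamma>] by (simp add: turn_eq)
  qed
  also have "turn ?\<omega> (n + 1) = -1" by (simp add: turn_def)
  finally show "(\<Sum>\<alpha>\<in>wiggly_arcs (Suc n). c \<alpha> * turn \<alpha> (n + 1)) = (\<Sum>\<gamma>\<in>?C. c \<gamma>) - c ?\<omega>" by simp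
  have "(\<Sum>\<alpha>\<in>wiggly_arcs (Suc n). c \<alpha> * height \<alpha> (n + 1))
    = (\<Sum>\<gamma>\<in>?C. c \<gamma> * height \<gamma> (n + 1) + c (extend_up \<gamma>) * height (extend_up \<gamma>) (n + 1)
        + c (extend_down \<gamma>) * height (extend_down \<gamma>) (n + 1))
      + (\<Sum>\<gamma>\<in>?E. c \<gamma> * height \<gamma> (n + 1)) + c ?\<omega> * height ?\<omega> (n + 1)"
    unfolding wiggly_arcs_Suc_split sum_fibers ..
  also have "(\<Sum>\<gamma>\<in>?C. c \<gamma> * height \<gamma> (n + 1) + c (extend_up \<gamma>) * height (extend_up \<gamma>) (n + 1)
        + c (extend_down \<gamma>) * height (extend_down \<gamma>) (n + 1)) = (\<Sum>\<gamma>\<in>?C. c (extend_up \<gamma>) - c (extend_down \<gamma>))"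
  proof (intro sum.cong refl)
    fix \<gamma> assume "\<gamma> \<in> ?C"
    note C[OF this]
    then show "c \<gamma> * height \<gamma> (n + 1) + c (extend_up \<gamma>) * height (extend_up \<gamma>) (n + 1)
        + c (extend_down \<gamma>) * height (extend_down \<gamma>) (n + 1) = c (extend_up \<gamma>) - c (extend_down \<gamma>)"
      using extend_arc(3,4)[of \<gamma> "n + 1"] height_eq_0[of \<gamma> "n + 1"] by simp
  qed
  also have "(\<Sum>\<gamma>\<in>?E. c \<gamma> * height \<gamma> (n + 1)) = 0"
  proof (intro sum.neutral ballI)
    fix \<gamma> assume "\<gamma> \<in> ?E"
    then show "c \<gamma> * height \<gamma> (n + 1) = 0" using E[of \<gamma>] height_eq_0[of \<gamma> "n + 1"] by simp
  qed
  also have "height ?\<omega> (n + 1) = 0" by (simp add: height_def)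
  finally show "(\<Sum>\<alpha>\<in>wiggly_arcs (Suc n). c \<alpha> * height \<alpha> (n + 1)) = (\<Sum>\<gamma>\<in>?C. c (extend_up \<gamma>) - c (extend_down \<gamma>))"
    by simp
qed

text \<open>By induction the total weight of each truncated strand is known. The turn and height
  sums at the new point then determine how much weight ends there, passes above and passes below,
  and the stacking decides which strands carry it.\<close>

theorem compatible_weights_unique:
  assumes "compatible_weights n c" "compatible_weights n d"
    and "\<And>r. r \<le> n \<Longrightarrow> (\<Sum>\<alpha>\<in>wiggly_arcs n. c \<alpha> * height \<alpha> r) = (\<Sum>\<alpha>\<in>wiggly_arcs n. d \<alpha> * height \<alpha> r)"
    and "\<And>r. r \<le> n \<Longrightarrow> (\<Sum>\<alpha>\<in>wiggly_arcs n. c \<alpha> * turn \<alpha> r) = (\<Sum>\<alpha>\<in>wiggly_arcs n. d \<alpha> * turn \<alpha> r)"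
    and "\<alpha> \<in> wiggly_arcs n"
  shows "c \<alpha> = d \<alpha>"
  using assms
proof (induction n arbitrary: c d \<alpha>)
  case 0
  have "\<alpha> = (0, 1, {}, {})" if "\<alpha> \<in> wiggly_arcs 0" for \<alpha>
  proof -
    obtain i j A B where \<alpha>: "\<alpha> = (i, j, A, B)" by (cases \<alpha>)
    have *: "i < j" "j \<le> 1" "A \<union> B = {i<..<j}" using that by (auto simp: \<alpha> wiggly_arcs_def)
    then have "i = 0" "j = 1" by auto
    moreover from this have "A \<union> B = {}" using *(3) by auto
    ultimately show ?thesis by (simp add: \<alpha>)
  qed
  moreover have "(0, 1, {}, {}) \<in> wiggly_arcs 0" by (auto simp: wiggly_arcs_def)
  ultimately have "wiggly_arcs 0 = {(0, 1, {}, {})}" by blast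
  then show ?case using "0.prems"(4)[of 0] "0.prems"(5) by (simp add: turn_def)
next
  case (Suc n)
  define C where "C = {\<gamma>. \<gamma> \<in> wiggly_arcs n \<and> arc_end \<gamma> = n + 1}"
  define m where "m = truncate_weights n c"
  let ?\<omega> = "(Suc n, Suc (Suc n), {}, {}) :: arc"
  have finC: "finite C" by (simp add: C_def finite_wiggly_arcs)
  have trunc: "truncate_weights n c \<gamma> = truncate_weights n d \<gamma>" if "\<gamma> \<in> wiggly_arcs n" for \<gamma>
  proof (rule Suc.IH)
    show "compatible_weights n (truncate_weights n c)" "compatible_weights n (truncate_weights n d)"
      using Suc.prems(1,2) by (auto intro: compatible_weights_truncate)
  qed (use Suc.prems(3,4) that in \<open>auto simp: sum_height_truncate\<close>)
  have m: "m \<gamma> = c \<gamma> + c (extend_up \<gamma>) + c (extend_down \<gamma>)" "m \<gamma> = d \<gamma> + d (extend_up \<gamma>) + d (extend_down \<gamma>)"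
    if "\<gamma> \<in> C" for \<gamma>
    using that trunc[of \<gamma>] truncate_weights_eq[of \<gamma> n] by (auto simp: m_def C_def)
  have wig: "\<gamma> \<in> wiggly_arcs (Suc n)" "extend_up \<gamma> \<in> wiggly_arcs (Suc n)" "extend_down \<gamma> \<in> wiggly_arcs (Suc n)"
    if "\<gamma> \<in> C" for \<gamma>
    using that extend_arc[of \<gamma>] by (auto simp: wiggly_arcs_iff extend_simps C_def)
  have \<omega>: "?\<omega> \<in> wiggly_arcs (Suc n)" by (auto simp: wiggly_arcs_def)
  \<comment> \<open>Compatibility forbids an end and a start at the same point. One of the two
    masses is thus 0, and their difference determines both.\<close>
  have pointed: "(\<Sum>\<gamma>\<in>C. x \<gamma>) = 0 \<or> x ?\<omega> = 0" "0 \<le> (\<Sum>\<gamma>\<in>C. x \<gamma>)" "0 \<le> x ?\<omega>" if x: "compatible_weights (Suc n) x" for x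
  proof -
    show "0 \<le> (\<Sum>\<gamma>\<in>C. x \<gamma>)" "0 \<le> x ?\<omega>"
      using x wig \<omega> by (auto simp: compatible_weights_def intro: sum_nonneg)
    have "x \<gamma> = 0" if "\<gamma> \<in> C" "x ?\<omega> \<noteq> 0" for \<gamma>
    proof -
      have "non_pointed \<gamma> ?\<omega>" using that by (auto simp: non_pointed_iff C_def arc_start_def)
      then have "\<not> compatible \<gamma> ?\<omega>" by (simp add: compatible_def)
      then show ?thesis using x wig(1)[OF that(1)] \<omega> that(2) unfolding compatible_weights_def by blast
    qed
    then show "(\<Sum>\<gamma>\<in>C. x \<gamma>) = 0 \<or> x ?\<omega> = 0" by (auto intro: sum.neutral)
  qed
  have "(\<Sum>\<gamma>\<in>C. c \<gamma>) - c ?\<omega> = (\<Sum>\<gamma>\<in>C. d \<gamma>) - d ?\<omega>"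
    using Suc.prems(4)[of "n + 1"] unfolding sum_at_last_point C_def by simp
  then have ends: "(\<Sum>\<gamma>\<in>C. c \<gamma>) = (\<Sum>\<gamma>\<in>C. d \<gamma>)" and late: "c ?\<omega> = d ?\<omega>"
    using pointed[OF Suc.prems(1)] pointed[OF Suc.prems(2)] by linarith+
  have diff: "(\<Sum>\<gamma>\<in>C. c (extend_up \<gamma>)) - (\<Sum>\<gamma>\<in>C. c (extend_down \<gamma>)) = (\<Sum>\<gamma>\<in>C. d (extend_up \<gamma>)) - (\<Sum>\<gamma>\<in>C. d (extend_down \<gamma>))"
    using Suc.prems(3)[of "n + 1"] unfolding sum_at_last_point C_def sum_subtractf by simp
  \<comment> \<open>The total mass reaching \<open>n + 1\<close> yields the sum of the masses
    passing above and below, whose difference is already known from \<open>diff\<close>.\<close>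
  have "(\<Sum>\<gamma>\<in>C. c \<gamma> + c (extend_up \<gamma>) + c (extend_down \<gamma>)) = (\<Sum>\<gamma>\<in>C. d \<gamma> + d (extend_up \<gamma>) + d (extend_down \<gamma>))"
    using m by (intro sum.cong) auto
  then have sums: "(\<Sum>\<gamma>\<in>C. c (extend_up \<gamma>)) = (\<Sum>\<gamma>\<in>C. d (extend_up \<gamma>))"
    "(\<Sum>\<gamma>\<in>C. c (extend_down \<gamma>)) = (\<Sum>\<gamma>\<in>C. d (extend_down \<gamma>))"
    using ends diff by (simp_all add: sum.distrib)
  have nonneg: "0 \<le> x \<gamma>" "0 \<le> x (extend_up \<gamma>)" "0 \<le> x (extend_down \<gamma>)"
    if "compatible_weights (Suc n) x" "\<gamma> \<in> C" for x \<gamma>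
    using that wig by (auto simp: compatible_weights_def)
  have sep: "(\<exists>r. r \<in> above_at \<gamma> \<delta>) \<or> (\<exists>r. r \<in> above_at \<delta> \<gamma>)" if "\<gamma> \<in> C" "\<delta> \<in> C" "\<gamma> \<noteq> \<delta>" for \<gamma> \<delta>
    using separated_if_same_end[of \<gamma> \<delta>] that by (auto simp: C_def wiggly_arcs_iff)
  have st: "x \<gamma> + x (extend_down \<gamma>) = 0 \<or> x (extend_up \<delta>) = 0" "x (extend_down \<gamma>) = 0 \<or> x \<delta> + x (extend_up \<delta>) = 0"
    if "compatible_weights (Suc n) x" "\<gamma> \<in> C" "\<delta> \<in> C" "r \<in> above_at \<gamma> \<delta>" for x \<gamma> \<delta> r
    using stacked[OF that(1) _ _ _ _ that(4)] that(2,3) by (auto simp: C_def)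
  \<comment> \<open>The mass passing above \<open>n + 1\<close> is taken from the top of the stack,
    so its total determines its distribution.\<close>
  have up: "c (extend_up \<gamma>) = d (extend_up \<gamma>)" if "\<gamma> \<in> C" for \<gamma>
  proof (rule threshold_unique[where m = m and C = C and x = "\<lambda>\<gamma>. c (extend_up \<gamma>)" and x' = "\<lambda>\<gamma>. d (extend_up \<gamma>)"])
    fix \<gamma> \<delta> assume \<gamma>\<delta>: "\<gamma> \<in> C" "\<delta> \<in> C" "\<gamma> \<noteq> \<delta>"
    from sep[OF this]
    show "\<not> (c (extend_up \<gamma>) < m \<gamma> \<and> 0 < c (extend_up \<delta>)) \<and> \<not> (d (extend_up \<gamma>) < m \<gamma> \<and> 0 < d (extend_up \<delta>)) \<or>
      \<not> (c (extend_up \<delta>) < m \<delta> \<and> 0 < c (extend_up \<gamma>)) \<and> \<not> (d (extend_up \<delta>) < m \<delta> \<and> 0 < d (extend_up \<gamma>))"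
    proof (elim disjE exE)
      fix r assume "r \<in> above_at \<gamma> \<delta>"
      then show ?thesis
        using st(1)[OF Suc.prems(1) \<gamma>\<delta>(1,2)] st(1)[OF Suc.prems(2) \<gamma>\<delta>(1,2)] m[OF \<gamma>\<delta>(1)] by fastforce
    next
      fix r assume "r \<in> above_at \<delta> \<gamma>"
      then show ?thesis
        using st(1)[OF Suc.prems(1) \<gamma>\<delta>(2,1)] st(1)[OF Suc.prems(2) \<gamma>\<delta>(2,1)] m[OF \<gamma>\<delta>(2)] by fastforce
    qed
  next
    show "0 \<le> c (extend_up \<gamma>) \<and> c (extend_up \<gamma>) \<le> m \<gamma>" if "\<gamma> \<in> C" for \<gamma>
      using nonneg[OF Suc.prems(1) that] m(1)[OF that] by simp
    show "0 \<le> d (extend_up \<gamma>) \<and> d (extend_up \<gamma>) \<le> m \<gamma>" if "\<gamma> \<in> C" for \<gamma>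
      using nonneg[OF Suc.prems(2) that] m(2)[OF that] by simp
  qed (use finC sums that in auto)
  \<comment> \<open>Symmetrically, the mass passing below is taken from the bottom of the
    stack.\<close>
  have down: "c (extend_down \<gamma>) = d (extend_down \<gamma>)" if "\<gamma> \<in> C" for \<gamma>
  proof (rule threshold_unique[where m = m and C = C and x = "\<lambda>\<gamma>. c (extend_down \<gamma>)" and x' = "\<lambda>\<gamma>. d (extend_down \<gamma>)"])
    fix \<gamma> \<delta> assume \<gamma>\<delta>: "\<gamma> \<in> C" "\<delta> \<in> C" "\<gamma> \<noteq> \<delta>"
    from sep[OF this]
    show "\<not> (c (extend_down \<gamma>) < m \<gamma> \<and> 0 < c (extend_down \<delta>)) \<and> \<not> (d (extend_down \<gamma>) < m \<gamma> \<and> 0 < d (extend_down \<delta>)) \<or>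
      \<not> (c (extend_down \<delta>) < m \<delta> \<and> 0 < c (extend_down \<gamma>)) \<and> \<not> (d (extend_down \<delta>) < m \<delta> \<and> 0 < d (extend_down \<gamma>))"
    proof (elim disjE exE)
      fix r assume "r \<in> above_at \<gamma> \<delta>"
      then show ?thesis
        using st(2)[OF Suc.prems(1) \<gamma>\<delta>(1,2)] st(2)[OF Suc.prems(2) \<gamma>\<delta>(1,2)] m[OF \<gamma>\<delta>(2)] by fastforce
    next
      fix r assume "r \<in> above_at \<delta> \<gamma>"
      then show ?thesis
        using st(2)[OF Suc.prems(1) \<gamma>\<delta>(2,1)] st(2)[OF Suc.prems(2) \<gamma>\<delta>(2,1)] m[OF \<gamma>\<delta>(1)] by fastforce
    qed
  next
    show "0 \<le> c (extend_down \<gamma>) \<and> c (extend_down \<gamma>) \<le> m \<gamma>" if "\<gamma> \<in> C" for \<gamma>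
      using nonneg[OF Suc.prems(1) that] m(1)[OF that] by simp
    show "0 \<le> d (extend_down \<gamma>) \<and> d (extend_down \<gamma>) \<le> m \<gamma>" if "\<gamma> \<in> C" for \<gamma>
      using nonneg[OF Suc.prems(2) that] m(2)[OF that] by simp
  qed (use finC sums that in auto)
  show "c \<alpha> = d \<alpha>"
  proof (cases "arc_start \<alpha> \<le> n")
    case False
    then show ?thesis using wiggly_arcs_Suc_late[OF Suc.prems(5)] late by simp
  next
    case True
    define \<gamma> where "\<gamma> = truncate n \<alpha>"
    have \<gamma>: "\<gamma> \<in> wiggly_arcs n" unfolding \<gamma>_def by (rule truncate_wiggly[OF Suc.prems(5) True])
    have fib: "\<alpha> \<in> (if arc_end \<gamma> = n + 1 then {\<gamma>, extend_up \<gamma>, extend_down \<gamma>} else {\<gamma>})"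
      unfolding truncate_fiber[OF \<gamma>, symmetric] using True Suc.prems(5) by (simp add: \<gamma>_def)
    show ?thesis
    proof (cases "arc_end \<gamma> = n + 1")
      case True
      then have "\<gamma> \<in> C" using \<gamma> by (simp add: C_def)
      then have "c \<gamma> = d \<gamma>" using m[of \<gamma>] up[of \<gamma>] down[of \<gamma>] by linarith
      then show ?thesis using fib True up[OF \<open>\<gamma> \<in> C\<close>] down[OF \<open>\<gamma> \<in> C\<close>] by auto
    next
      case False
      then show ?thesis using fib trunc[OF \<gamma>] by (simp add: truncate_weights_eq[OF \<gamma>])
    qed
  qed
qed

section \<open>The wigglyhedron\<close>

lemma incompatibility_degree_pos:
  assumes "\<alpha> \<in> wiggly_arcs n" "\<beta> \<in> wiggly_arcs n" "\<not> compatible \<alpha> \<beta>"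
  shows "0 < incompatibility_degree n \<alpha> \<beta>"
proof (cases "non_pointed \<alpha> \<beta>")
  case True
  then show ?thesis using assms by (simp add: incompatibility_degree_def)
next
  case False
  have ar: "is_arc \<alpha>" "is_arc \<beta>" using assms by (auto simp: wiggly_arcs_iff)
  obtain x y where xy: "x \<in> above_at \<alpha> \<beta>" "y \<in> above_at \<beta> \<alpha>"
    using assms(3) False by (auto simp: compatible_def crossing_def)
  have "sign_changes (above_at \<alpha> \<beta>) (above_at \<beta> \<alpha>) \<noteq> {}"
    using sign_changes_nonempty[OF xy above_at_disjoint[OF ar]] unfolding sign_changes_def by blast
  moreover have "finite (sign_changes (above_at \<alpha> \<beta>) (above_at \<beta> \<alpha>))"
    using finite_subset[OF sign_changes_subset] finite_above_at ar by blast
  ultimately show ?thesis by (simp add: incompatibility_degree_eq[OF assms(1,2)] card_gt_0_iff)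
qed

text \<open>An arc with an end strictly between 0 and \<open>n + 1\<close> is non pointed with an
  arc on the other side of that end. An internal arc from 0 to \<open>n + 1\<close> passes both
  above and below some points and crosses its mirror image.\<close>

lemma incompatibility_number_pos:
  assumes \<alpha>: "\<alpha> \<in> internal_arcs n"
  shows "0 < incompatibility_number n \<alpha>"
proof -
  obtain i j A B where \<alpha>_eq: "\<alpha> = (i, j, A, B)" by (cases \<alpha>)
  have w: "\<alpha> \<in> wiggly_arcs n" and AB: "i < j" "j \<le> n + 1" "A \<union> B = {i<..<j}" "A \<inter> B = {}"
    using \<alpha> by (auto simp: \<alpha>_eq internal_arcs_def wiggly_arcs_def)
  have "\<exists>\<beta>\<in>wiggly_arcs n. \<not> compatible \<alpha> \<beta>"
  proof -
    consider "0 < i" | "j \<le> n" | "i = 0" "j = n + 1" using AB by linarith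
    then show ?thesis
    proof cases
      case 1
      then have "(0, i, {}, {0<..<i}) \<in> wiggly_arcs n" "\<not> compatible \<alpha> (0, i, {}, {0<..<i})"
        using AB by (auto simp: wiggly_arcs_def compatible_def non_pointed_def \<alpha>_eq)
      then show ?thesis by blast
    next
      case 2
      then have "(j, n + 1, {}, {j<..<n + 1}) \<in> wiggly_arcs n" "\<not> compatible \<alpha> (j, n + 1, {}, {j<..<n + 1})"
        using AB by (auto simp: wiggly_arcs_def compatible_def non_pointed_def \<alpha>_eq)
      then show ?thesis by blast
    next
      case 3
      have int: "{0<..<n + 1} = {1..n}" by auto
      have "A \<noteq> {}" "B \<noteq> {}"
        using \<alpha> AB(3) unfolding internal_arcs_def external_arcs_def \<alpha>_eq 3 int by auto
      moreover have "(0, n + 1, B, A) \<in> wiggly_arcs n" using AB 3 by (auto simp: wiggly_arcs_def)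
      moreover have "A \<subseteq> above_at \<alpha> (0, n + 1, B, A)" "B \<subseteq> above_at (0, n + 1, B, A) \<alpha>"
        by (auto simp: above_at_def \<alpha>_eq)
      ultimately show ?thesis unfolding compatible_def crossing_def by blast
    qed
  qed
  then obtain \<beta> where \<beta>: "\<beta> \<in> wiggly_arcs n" "\<not> compatible \<alpha> \<beta>" by blast
  have "incompatibility_degree n \<alpha> \<beta> \<le> incompatibility_number n \<alpha>"
    unfolding incompatibility_number_def using \<beta> by (intro member_le_sum) (auto simp: finite_wiggly_arcs)
  then show ?thesis using incompatibility_degree_pos[OF w \<beta>] by linarith
qed

lemma external_wiggly:
  shows "(0, n + 1, {1..n}, {}) \<in> wiggly_arcs n" "(0, n + 1, {}, {1..n}) \<in> wiggly_arcs n"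
  by (auto simp: wiggly_arcs_def)

lemma wiggly_arcs_split: "wiggly_arcs n = internal_arcs n \<union> external_arcs n" "internal_arcs n \<inter> external_arcs n = {}"
  using external_wiggly by (auto simp: internal_arcs_def external_arcs_def)

lemma height_bounds: "is_arc \<alpha> \<Longrightarrow> -1 \<le> height \<alpha> r \<and> height \<alpha> r \<le> 1"
  by (auto simp: height_def of_bool_def split: prod.splits)

lemma compatible_commute: "compatible \<alpha> \<beta> \<longleftrightarrow> compatible \<beta> \<alpha>"
  by (auto simp: compatible_def crossing_def non_pointed_iff)

lemma compatible_refl: "is_arc \<alpha> \<Longrightarrow> compatible \<alpha> \<alpha>"
  using arc_start_less_end[of \<alpha>] by (auto simp: compatible_def crossing_def non_pointed_iff above_at_eq)

text \<open>The heights of an external arc are everywhere maximal or everywhere minimal, so no arc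
  passes from one side of it to the other.\<close>

lemma compatible_external:
  assumes "\<alpha> \<in> external_arcs n" "\<beta> \<in> wiggly_arcs n"
  shows "compatible \<alpha> \<beta>"
proof -
  have w: "is_arc \<alpha>" "is_arc \<beta>" "arc_end \<beta> \<le> n + 1"
    using assms wiggly_arcs_split(1)[of n] by (auto simp: wiggly_arcs_iff)
  have \<alpha>: "arc_start \<alpha> = 0" "arc_end \<alpha> = n + 1"
    using assms(1) by (auto simp: external_arcs_def arc_start_def arc_end_def)
  have "\<not> non_pointed \<alpha> \<beta>" using \<alpha> w arc_start_less_end[OF w(2)] by (auto simp: non_pointed_iff)
  moreover have "above_at \<alpha> \<beta> = {} \<or> above_at \<beta> \<alpha> = {}"
  proof -
    have "(\<forall>r. height \<beta> r \<le> height \<alpha> r) \<or> (\<forall>r. height \<alpha> r \<le> height \<beta> r)"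
    proof -
      have ends: "height \<beta> r = 0" if "r \<notin> {1..n}" for r
        using that height_eq_0[OF w(2), of r] w(3) by (cases "r = 0") auto
      from assms(1) consider "\<alpha> = (0, n + 1, {1..n}, {})" | "\<alpha> = (0, n + 1, {}, {1..n})"
        unfolding external_arcs_def by blast
      then show ?thesis
      proof cases
        case 1
        then have "height \<alpha> r = of_bool (r \<in> {1..n})" for r by (simp add: height_def)
        then have "height \<beta> r \<le> height \<alpha> r" for r using ends[of r] height_bounds[OF w(2), of r] by auto
        then show ?thesis by blast
      next
        case 2
        then have "height \<alpha> r = - of_bool (r \<in> {1..n})" for r by (simp add: height_def)
        then have "height \<alpha> r \<le> height \<beta> r" for r using ends[of r] height_bounds[OF w(2), of r] by auto
        then show ?thesis by blast
      qed
    qed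
    then show ?thesis using w by (auto simp: above_at_eq leD)
  qed
  ultimately show ?thesis by (auto simp: compatible_def crossing_def)
qed

section \<open>The space of vectors with coordinate sum zero\<close>

lemma subspace_sum_zero_space: "subspace (sum_zero_space :: (real ^ 'd) set)"
  by (auto simp: subspace_def sum_zero_space_def sum.distrib simp flip: sum_distrib_left)

lemma sum_zero_space_hyperplane: "(sum_zero_space :: (real ^ 'd::finite) set) = {x. (\<chi> k. 1) \<bullet> x = 0}"
  by (simp add: sum_zero_space_def inner_vec_def)

lemma dim_sum_zero_space: "dim (sum_zero_space :: (real ^ 'd::finite) set) = CARD('d) - 1"
proof -
  have "((\<chi> k. 1) :: real ^ 'd) \<noteq> 0" by (simp add: vec_eq_iff)
  then show ?thesis unfolding sum_zero_space_hyperplane by (simp add: dim_hyperplane)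
qed

text \<open>Subtracting the mean changes \<open>x\<close> by a multiple of the all-ones vector, the
  normal of the hyperplane. Two candidates differ by a vector of the hyperplane that is orthogonal
  to itself, so the definite description is proper.\<close>

lemma orthogonal_projection_sum_zero_space:
  fixes x :: "real ^ 'd::finite"
  shows "orthogonal_projection sum_zero_space x = x - ((\<Sum>k\<in>UNIV. x $ k) / CARD('d)) *\<^sub>R (\<chi> k. 1)"
    (is "_ = ?y")
proof -
  have y: "?y \<in> sum_zero_space" by (simp add: sum_zero_space_def sum_subtractf)
  have orth: "orthogonal (x - ?y) z" if "z \<in> sum_zero_space" for z
    using that unfolding sum_zero_space_hyperplane by (simp add: orthogonal_def)
  show ?thesis unfolding orthogonal_projection_def
  proof (rule the_equality)
    show "?y \<in> sum_zero_space \<and> (\<forall>z\<in>sum_zero_space. orthogonal (x - ?y) z)" using y orth by blast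
    fix y' assume y': "y' \<in> sum_zero_space \<and> (\<forall>z\<in>sum_zero_space. orthogonal (x - y') z)"
    define d where "d = ?y - y'"
    have d: "d \<in> sum_zero_space" unfolding d_def using subspace_diff[OF subspace_sum_zero_space y] y' by blast
    have "(x - y') - (x - ?y) = d" by (simp add: d_def)
    moreover have "(x - y') \<bullet> d = 0" "(x - ?y) \<bullet> d = 0"
      using y' orth[OF d] d unfolding orthogonal_def by auto
    ultimately have "d = 0" by (metis diff_self inner_diff_left inner_eq_zero_iff)
    then show "y' = ?y" unfolding d_def by simp
  qed
qed

section \<open>The \<open>g\<close> vectors in coordinates\<close>

locale wiggly_labelling =
  fixes n :: nat and lbl :: "'d::finite \<Rightarrow> nat"
  assumes n_pos: "n \<ge> 1" and lbl: "bij_betw lbl UNIV {1..2 * n}"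
begin

text \<open>The coordinates \<open>2 * p - 1\<close> and \<open>2 * p\<close> belong to the point
  \<open>p\<close>, and \<open>sg\<close> distinguishes them. The points 0 and \<open>n + 1\<close>
  own no coordinates, which is the effect of the indices removed in \<open>arc_plus\<close> and
  \<open>arc_minus\<close>.\<close>

definition pt :: "'d \<Rightarrow> nat" where "pt k = (lbl k + 1) div 2"
definition sg :: "'d \<Rightarrow> real" where "sg k = (if even (lbl k) then 1 else -1)"
definition raw :: "arc \<Rightarrow> real ^ 'd" where
  "raw \<alpha> = (\<chi> k. height \<alpha> (pt k) + sg k * turn \<alpha> (pt k))"

abbreviation g :: "arc \<Rightarrow> real ^ 'd" where "g \<equiv> g_vector lbl n"

lemma card_eq: "CARD('d) = 2 * n"
  using bij_betw_same_card[OF lbl] by simp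

lemma lbl_range: "1 \<le> lbl k" "lbl k \<le> 2 * n"
  using bij_betw_apply[OF lbl, of k] by auto

lemma pt_range: "1 \<le> pt k" "pt k \<le> n"
  using lbl_range[of k] by (auto simp: pt_def)

lemma lbl_eq: "lbl k = (if even (lbl k) then 2 * pt k else 2 * pt k - 1)"
  by (auto simp: pt_def elim!: evenE oddE)

lemma pair_exists:
  assumes "1 \<le> p" "p \<le> n"
  obtains k k' where "pt k = p" "sg k = 1" "pt k' = p" "sg k' = -1"
proof -
  have "2 * p \<in> lbl ` UNIV" "2 * p - 1 \<in> lbl ` UNIV"
    using assms unfolding bij_betw_imp_surj_on[OF lbl] by auto
  then obtain k k' where "lbl k = 2 * p" "lbl k' = 2 * p - 1" by (metis imageE)
  moreover from this have "pt k = p" "pt k' = p" "sg k = 1" "sg k' = -1" using assms by (auto simp: pt_def sg_def)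
  ultimately show ?thesis using that by blast
qed

lemma raw_eq:
  assumes "\<alpha> \<in> wiggly_arcs n"
  shows "indicator_vector lbl (arc_plus n \<alpha>) - indicator_vector lbl (arc_minus n \<alpha>) = raw \<alpha>"
proof -
  obtain i j A B where \<alpha>: "\<alpha> = (i, j, A, B)" by (cases \<alpha>)
  have w: "i < j" "j \<le> n + 1" "A \<union> B = {i<..<j}" "A \<inter> B = {}"
    using assms by (auto simp: \<alpha> wiggly_arcs_def)
  have not_in: "i \<notin> A" "i \<notin> B" "j \<notin> A" "j \<notin> B"
    using w(3) by (metis UnCI greaterThanLessThan_iff less_irrefl)+
  have "(indicator_vector lbl (arc_plus n \<alpha>) - indicator_vector lbl (arc_minus n \<alpha>)) $ k = raw \<alpha> $ k" for k
  proof -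
    define p where "p = pt k"
    have p: "1 \<le> p" "p \<le> n" using pt_range by (auto simp: p_def)
    show ?thesis
    proof (cases "even (lbl k)")
      case True
      then have l: "lbl k = 2 * p" using lbl_eq[of k] by (simp add: p_def)
      \<comment> \<open>The removed indices lie outside the range of \<open>lbl\<close>, so removing
        them affects no coordinate; what remains is a comparison of parities.\<close>
      have e: "lbl k = 2 * a \<longleftrightarrow> a = p" "lbl k \<noteq> 2 * a - Suc 0" "lbl k \<noteq> 0" "lbl k \<noteq> Suc (2 * n)" "lbl k \<noteq> Suc (Suc (2 * n))" for a
        using l p by (auto, presburger)
      have "lbl k \<in> arc_plus n \<alpha> \<longleftrightarrow> p = j \<or> p \<in> A" "lbl k \<in> arc_minus n \<alpha> \<longleftrightarrow> p = i \<or> p \<in> B"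
        unfolding arc_plus_def arc_minus_def \<alpha> using p by (auto simp: e)
      then show ?thesis
        using not_in w(1,4) True by (auto simp: raw_def indicator_vector_def \<alpha> height_def turn_def sg_def simp flip: p_def)
    next
      case False
      then have l: "lbl k = 2 * p - 1" using lbl_eq[of k] by (simp add: p_def)
      have e: "lbl k = 2 * a - Suc 0 \<longleftrightarrow> a = p" "lbl k \<noteq> 2 * a" "lbl k \<noteq> 0" "lbl k \<noteq> Suc (2 * n)" "lbl k \<noteq> Suc (Suc (2 * n))" for a
        using l p by (presburger, presburger, auto)
      have "lbl k \<in> arc_plus n \<alpha> \<longleftrightarrow> p = i \<or> p \<in> A" "lbl k \<in> arc_minus n \<alpha> \<longleftrightarrow> p = j \<or> p \<in> B"
        unfolding arc_plus_def arc_minus_def \<alpha> using p by (auto simp: e)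
      then show ?thesis
        using not_in w(1,4) False by (auto simp: raw_def indicator_vector_def \<alpha> height_def turn_def sg_def simp flip: p_def)
    qed
  qed
  then show ?thesis by (simp add: vec_eq_iff)
qed

lemma g_eq:
  assumes "\<alpha> \<in> wiggly_arcs n"
  shows "g \<alpha> = raw \<alpha> - ((\<Sum>k\<in>UNIV. raw \<alpha> $ k) / CARD('d)) *\<^sub>R (\<chi> k. 1)"
  unfolding g_vector_def raw_eq[OF assms] orthogonal_projection_sum_zero_space ..

lemma g_in_sum_zero_space: "\<alpha> \<in> wiggly_arcs n \<Longrightarrow> g \<alpha> \<in> sum_zero_space"
  unfolding g_eq by (simp add: sum_zero_space_def sum_subtractf)

lemma g_inner:
  assumes "\<alpha> \<in> wiggly_arcs n" "x \<in> sum_zero_space"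
  shows "g \<alpha> \<bullet> x = raw \<alpha> \<bullet> x"
  using assms(2) unfolding g_eq[OF assms(1)] sum_zero_space_hyperplane by (simp add: inner_diff_left)

text \<open>The ends 0 and \<open>n + 1\<close> own no coordinates and all heights between them
  agree, so the unprojected vector is plus or minus the all-ones vector.\<close>

lemma g_external:
  assumes "\<alpha> \<in> external_arcs n" "x \<in> sum_zero_space"
  shows "g \<alpha> \<bullet> x = 0"
proof -
  have w: "\<alpha> \<in> wiggly_arcs n" using assms(1) wiggly_arcs_split(1)[of n] by blast
  from assms(1) consider "\<alpha> = (0, n + 1, {1..n}, {})" | "\<alpha> = (0, n + 1, {}, {1..n})"
    unfolding external_arcs_def by blast
  then have "raw \<alpha> = (\<chi> k. 1) \<or> raw \<alpha> = - (\<chi> k. 1)"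
    using pt_range by cases (auto simp: raw_def vec_eq_iff height_def turn_def, (metis Suc_n_not_le_n not_one_le_zero)+)
  then show ?thesis
    using assms(2) unfolding g_inner[OF w assms(2)] sum_zero_space_hyperplane by auto
qed

text \<open>An exchange of internal arcs may lead to external ones; their inequalities hold because
  the left side is 0.\<close>

lemma g_inner_le:
  assumes "x \<in> sum_zero_space" "\<forall>\<alpha>\<in>internal_arcs n. g \<alpha> \<bullet> x \<le> real (incompatibility_number n \<alpha>)" "\<alpha> \<in> wiggly_arcs n"
  shows "g \<alpha> \<bullet> x \<le> real (incompatibility_number n \<alpha>)"
  using assms g_external[of \<alpha> x] wiggly_arcs_split(1)[of n] by (cases "\<alpha> \<in> internal_arcs n") auto

lemma raw_exchange:
  assumes "\<And>r. height \<gamma> r + height \<delta> r = c * (height \<alpha> r + height \<beta> r)" "\<And>r. turn \<gamma> r + turn \<delta> r = c * (turn \<alpha> r + turn \<beta> r)"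
  shows "raw \<gamma> + raw \<delta> = c *\<^sub>R (raw \<alpha> + raw \<beta>)"
proof -
  have "(raw \<gamma> + raw \<delta>) $ k = (height \<gamma> (pt k) + height \<delta> (pt k)) + sg k * (turn \<gamma> (pt k) + turn \<delta> (pt k))" for k
    by (simp add: raw_def algebra_simps)
  then show ?thesis unfolding assms by (simp add: vec_eq_iff raw_def algebra_simps)
qed

lemma tight_compatible:
  assumes x: "x \<in> sum_zero_space" "\<forall>\<alpha>\<in>internal_arcs n. g \<alpha> \<bullet> x \<le> real (incompatibility_number n \<alpha>)"
    and \<alpha>: "\<alpha> \<in> internal_arcs n" "g \<alpha> \<bullet> x = real (incompatibility_number n \<alpha>)"
    and \<beta>: "\<beta> \<in> internal_arcs n" "g \<beta> \<bullet> x = real (incompatibility_number n \<beta>)"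
  shows "compatible \<alpha> \<beta>"
proof (rule ccontr)
  assume "\<not> compatible \<alpha> \<beta>"
  have w: "\<alpha> \<in> wiggly_arcs n" "\<beta> \<in> wiggly_arcs n" using \<alpha>(1) \<beta>(1) by (auto simp: internal_arcs_def)
  obtain \<gamma> \<delta> and c :: nat where \<gamma>\<delta>: "\<gamma> \<in> wiggly_arcs n" "\<delta> \<in> wiggly_arcs n"
    and lin: "\<forall>r. height \<gamma> r + height \<delta> r = c * (height \<alpha> r + height \<beta> r) \<and> turn \<gamma> r + turn \<delta> r = c * (turn \<alpha> r + turn \<beta> r)"
    and less: "incompatibility_number n \<gamma> + incompatibility_number n \<delta> < c * (incompatibility_number n \<alpha> + incompatibility_number n \<beta>)"
    using incompatible_exchange[OF w \<open>\<not> compatible \<alpha> \<beta>\<close>] by blast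
  have "raw \<gamma> + raw \<delta> = real c *\<^sub>R (raw \<alpha> + raw \<beta>)"
    by (rule raw_exchange) (use lin in auto)
  then have "(raw \<gamma> + raw \<delta>) \<bullet> x = c * ((raw \<alpha> + raw \<beta>) \<bullet> x)" by simp
  then have "real c * (g \<alpha> \<bullet> x + g \<beta> \<bullet> x) = g \<gamma> \<bullet> x + g \<delta> \<bullet> x"
    using x(1) w \<gamma>\<delta> by (simp add: g_inner inner_add_left)
  also have "\<dots> \<le> real (incompatibility_number n \<gamma> + incompatibility_number n \<delta>)"
    using g_inner_le[OF x \<gamma>\<delta>(1)] g_inner_le[OF x \<gamma>\<delta>(2)] by simp
  also have "\<dots> < real (c * (incompatibility_number n \<alpha> + incompatibility_number n \<beta>))"
    using less by (simp only: of_nat_less_iff)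
  finally show False using \<alpha>(2) \<beta>(2) by simp
qed

text \<open>Explicit arcs bound, for each point, the difference and the sum of its two
  coordinates.\<close>

lemma bounded_halfspaces:
  "bounded {x \<in> sum_zero_space. \<forall>\<alpha>\<in>internal_arcs n. g \<alpha> \<bullet> x \<le> real (incompatibility_number n \<alpha>)}"
proof -
  define K where "K = (\<Sum>\<alpha>\<in>wiggly_arcs n. real (incompatibility_number n \<alpha>))"
  \<comment> \<open>In the coordinates \<open>2 * p - 1\<close> and \<open>2 * p\<close>, the vector
    \<open>D p\<close> is (-1, 1) and \<open>H p\<close> is (1, 1).\<close>
  define D :: "nat \<Rightarrow> real ^ 'd" where "D p = (\<chi> k. sg k * of_bool (pt k = p))" for p
  define H :: "nat \<Rightarrow> real ^ 'd" where "H p = (\<chi> k. of_bool (pt k = p))" for p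
  have main: "\<bar>x $ k\<bar> \<le> 2 * K"
    if x: "x \<in> sum_zero_space" "\<forall>\<alpha>\<in>internal_arcs n. g \<alpha> \<bullet> x \<le> real (incompatibility_number n \<alpha>)" for x k
  proof -
    have le: "raw \<alpha> \<bullet> x \<le> K" if "\<alpha> \<in> wiggly_arcs n" for \<alpha>
    proof -
      have "raw \<alpha> \<bullet> x \<le> real (incompatibility_number n \<alpha>)"
        using g_inner_le[OF x that] g_inner[OF that x(1)] by simp
      also have "\<dots> \<le> K" unfolding K_def using that by (intro member_le_sum) (auto simp: finite_wiggly_arcs)
      finally show ?thesis .
    qed
    have ne: "pt k \<noteq> 0" "pt k \<noteq> Suc n" for k using pt_range[of k] by auto
    have K: "0 \<le> K" unfolding K_def by (intro sum_nonneg) auto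
    have boundD: "\<bar>D p \<bullet> x\<bar> \<le> K" for p
    proof (cases "1 \<le> p \<and> p \<le> n")
      case False
      then have "D p = 0" using pt_range by (auto simp: D_def vec_eq_iff)
      then show ?thesis using K by simp
    next
      case True
      \<comment> \<open>In each pair the heights cancel and only the end at \<open>p\<close>
        remains, positively for arcs ending there and negatively for arcs starting there. This
        bounds \<open>D p\<close> from both sides.\<close>
      have "raw (0, p, {}, {0<..<p}) \<bullet> x \<le> K" "raw (0, p, {0<..<p}, {}) \<bullet> x \<le> K"
        "raw (p, n + 1, {}, {p<..<n + 1}) \<bullet> x \<le> K" "raw (p, n + 1, {p<..<n + 1}, {}) \<bullet> x \<le> K"
        using True by (intro le; auto simp: wiggly_arcs_def)+
      moreover have "raw (0, p, {}, {0<..<p}) + raw (0, p, {0<..<p}, {}) = 2 *\<^sub>R D p"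
        "raw (p, n + 1, {}, {p<..<n + 1}) + raw (p, n + 1, {p<..<n + 1}, {}) = - 2 *\<^sub>R D p"
        by (auto simp: ne raw_def D_def vec_eq_iff height_def turn_def)
      then have "raw (0, p, {}, {0<..<p}) \<bullet> x + raw (0, p, {0<..<p}, {}) \<bullet> x = 2 * (D p \<bullet> x)"
        "raw (p, n + 1, {}, {p<..<n + 1}) \<bullet> x + raw (p, n + 1, {p<..<n + 1}, {}) \<bullet> x = - 2 * (D p \<bullet> x)"
        by (simp_all flip: inner_add_left)
      ultimately show ?thesis by linarith
    qed
    have boundH: "\<bar>H p \<bullet> x\<bar> \<le> 3 * K" if p: "1 \<le> p" "p \<le> n" for p
    proof -
      \<comment> \<open>An arc from \<open>p - 1\<close> to \<open>p + 1\<close> has nonzero height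
        only at \<open>p\<close>. Its two ends contribute \<open>D\<close> terms, which
        \<open>boundD\<close> controls even at the border, where they vanish; together this makes
        \<open>3 * K\<close>.\<close>
      have "{p - 1<..<p + 1} = {p}" using p by auto
      then have "raw (p - 1, p + 1, {p}, {}) \<bullet> x \<le> K" "raw (p - 1, p + 1, {}, {p}) \<bullet> x \<le> K"
        using p by (intro le; auto simp: wiggly_arcs_def)+
      moreover have "raw (p - 1, p + 1, {p}, {}) = H p + D (p + 1) - D (p - 1)"
        "raw (p - 1, p + 1, {}, {p}) = - H p + D (p + 1) - D (p - 1)"
        by (auto simp: raw_def D_def H_def vec_eq_iff height_def turn_def)
      ultimately show ?thesis
        using boundD[of "p + 1"] boundD[of "p - 1"] by (simp add: inner_add_left inner_diff_left)
    qed
    \<comment> \<open>Half the sum or half the difference of \<open>H\<close> and \<open>D\<close>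
      isolates one coordinate, hence the final bound \<open>(3 * K + K) / 2\<close>.\<close>
    have "axis k 1 = (1 / 2) *\<^sub>R (H (pt k) + sg k *\<^sub>R D (pt k))"
    proof -
      have sg_cases: "sg k' = 1 \<or> sg k' = -1" for k' by (auto simp: sg_def)
      have inj: "pt k' = pt k \<and> sg k' = sg k \<longleftrightarrow> k' = k" for k'
        using lbl_eq[of k] lbl_eq[of k'] bij_betw_imp_inj_on[OF lbl] unfolding sg_def inj_on_def
        by (metis UNIV_I one_neq_neg_one)
      have "axis k 1 $ k' = (1 / 2) * (of_bool (pt k' = pt k) + sg k * (sg k' * of_bool (pt k' = pt k)))" for k'
        using inj[of k'] sg_cases[of k] sg_cases[of k'] unfolding axis_def
        by (cases "k' = k"; cases "pt k' = pt k") auto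
      then show ?thesis by (simp add: vec_eq_iff H_def D_def)
    qed
    then have "axis k 1 \<bullet> x = (1 / 2) * (H (pt k) \<bullet> x + sg k * (D (pt k) \<bullet> x))"
      by (simp add: inner_add_left)
    then have "x $ k = (1 / 2) * (H (pt k) \<bullet> x + sg k * (D (pt k) \<bullet> x))"
      by (simp add: inner_axis')
    moreover have "sg k = 1 \<or> sg k = -1" by (auto simp: sg_def)
    ultimately show ?thesis using boundH[OF pt_range, of k] boundD[of "pt k"] by auto
  qed
  show ?thesis
  proof (rule boundedI)
    fix x assume "x \<in> {x \<in> sum_zero_space. \<forall>\<alpha>\<in>internal_arcs n. g \<alpha> \<bullet> x \<le> real (incompatibility_number n \<alpha>)}"
    then have "(\<Sum>k\<in>UNIV. \<bar>x $ k\<bar>) \<le> (\<Sum>k\<in>(UNIV :: 'd set). 2 * K)" by (intro sum_mono main) auto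
    then show "norm x \<le> (\<Sum>k\<in>(UNIV :: 'd set). 2 * K)" using norm_le_l1_cart[of x] by linarith
  qed
qed

text \<open>A relation between the \<open>g\<close> vectors holds for the unprojected vectors up to a multiple of the all-ones
  vector. Suitable weights on the two external arcs absorb this multiple and make the two total weights at
  the point 0 equal.\<close>

lemma g_combination_unique:
  assumes nonneg: "\<forall>\<alpha>\<in>internal_arcs n. 0 \<le> c \<alpha>" "\<forall>\<alpha>\<in>internal_arcs n. 0 \<le> d \<alpha>"
    and compat: "\<forall>\<alpha>\<in>internal_arcs n. \<forall>\<beta>\<in>internal_arcs n. c \<alpha> \<noteq> 0 \<and> c \<beta> \<noteq> 0 \<longrightarrow> compatible \<alpha> \<beta>"
      "\<forall>\<alpha>\<in>internal_arcs n. \<forall>\<beta>\<in>internal_arcs n. d \<alpha> \<noteq> 0 \<and> d \<beta> \<noteq> 0 \<longrightarrow> compatible \<alpha> \<beta>"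
    and eq: "(\<Sum>\<alpha>\<in>internal_arcs n. c \<alpha> *\<^sub>R g \<alpha>) = (\<Sum>\<alpha>\<in>internal_arcs n. d \<alpha> *\<^sub>R g \<alpha>)"
    and \<alpha>: "\<alpha> \<in> internal_arcs n"
  shows "c \<alpha> = d \<alpha>"
proof -
  let ?I = "internal_arcs n"
  have I: "\<alpha> \<in> wiggly_arcs n" if "\<alpha> \<in> ?I" for \<alpha> using that by (simp add: internal_arcs_def)
  have finI: "finite ?I" using finite_wiggly_arcs by (auto simp: internal_arcs_def)
  define e where "e \<alpha> = c \<alpha> - d \<alpha>" for \<alpha>
  define t where "t = (\<Sum>\<alpha>\<in>?I. e \<alpha> * ((\<Sum>k\<in>UNIV. raw \<alpha> $ k) / CARD('d)))"
  have "(\<Sum>\<alpha>\<in>?I. e \<alpha> *\<^sub>R g \<alpha>) = 0"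
    using eq by (simp add: e_def scaleR_diff_left sum_subtractf)
  moreover have "(\<Sum>\<alpha>\<in>?I. e \<alpha> *\<^sub>R g \<alpha>) = (\<Sum>\<alpha>\<in>?I. e \<alpha> *\<^sub>R raw \<alpha>) - t *\<^sub>R (\<chi> k. 1)"
    unfolding t_def scaleR_sum_left sum_subtractf[symmetric]
    by (intro sum.cong refl) (simp add: g_eq I scaleR_diff_right)
  ultimately have "(\<Sum>\<alpha>\<in>?I. e \<alpha> *\<^sub>R raw \<alpha>) $ k = t" for k by (simp add: vec_eq_iff)
  then have comp: "(\<Sum>\<alpha>\<in>?I. e \<alpha> * height \<alpha> (pt k)) + sg k * (\<Sum>\<alpha>\<in>?I. e \<alpha> * turn \<alpha> (pt k)) = t" for k
    by (simp add: raw_def sum_distrib_left sum.distrib[symmetric] algebra_simps)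
  have coords: "(\<Sum>\<alpha>\<in>?I. e \<alpha> * height \<alpha> r) = t" "(\<Sum>\<alpha>\<in>?I. e \<alpha> * turn \<alpha> r) = 0" if r: "1 \<le> r" "r \<le> n" for r
  proof -
    obtain k k' where "pt k = r" "sg k = 1" "pt k' = r" "sg k' = -1" using pair_exists[OF r] .
    then show "(\<Sum>\<alpha>\<in>?I. e \<alpha> * height \<alpha> r) = t" "(\<Sum>\<alpha>\<in>?I. e \<alpha> * turn \<alpha> r) = 0"
      using comp[of k] comp[of k'] by auto
  qed
  define u where "u = (\<Sum>\<alpha>\<in>?I. e \<alpha> * turn \<alpha> 0)"
  let ?t = "(0, n + 1, {1..n}, {}) :: arc" and ?b = "(0, n + 1, {}, {1..n}) :: arc"
  \<comment> \<open>Giving \<open>x\<close>, \<open>y\<close> to the first family and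
    \<open>- x\<close>, \<open>- y\<close> to the second keeps all weights nonnegative, while the
    external weights of the two families differ by exactly \<open>x\<close> and
    \<open>y\<close>.\<close>
  define ext :: "(arc \<Rightarrow> real) \<Rightarrow> real \<Rightarrow> real \<Rightarrow> arc \<Rightarrow> real" where
    "ext = (\<lambda>w x y \<alpha>. if \<alpha> = ?t then max x 0 else if \<alpha> = ?b then max y 0 else w \<alpha>)"
  have tb: "?t \<noteq> ?b" using n_pos by auto
  have ext_I: "ext w x y \<alpha> = w \<alpha>" if "\<alpha> \<in> ?I" for w x y \<alpha>
    using that by (auto simp: ext_def internal_arcs_def external_arcs_def)
  have sum_ext: "(\<Sum>\<alpha>\<in>wiggly_arcs n. ext w x y \<alpha> * f \<alpha>) = (\<Sum>\<alpha>\<in>?I. w \<alpha> * f \<alpha>) + max x 0 * f ?t + max y 0 * f ?b"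
    for w x y f
  proof -
    have "(\<Sum>\<alpha>\<in>wiggly_arcs n. ext w x y \<alpha> * f \<alpha>) = (\<Sum>\<alpha>\<in>?I. ext w x y \<alpha> * f \<alpha>) + (\<Sum>\<alpha>\<in>external_arcs n. ext w x y \<alpha> * f \<alpha>)"
      unfolding wiggly_arcs_split(1)[of n]
      using finI wiggly_arcs_split(2)[of n] by (intro sum.union_disjoint) (auto simp: external_arcs_def)
    also have "(\<Sum>\<alpha>\<in>?I. ext w x y \<alpha> * f \<alpha>) = (\<Sum>\<alpha>\<in>?I. w \<alpha> * f \<alpha>)"
      by (intro sum.cong refl) (simp add: ext_I)
    also have "(\<Sum>\<alpha>\<in>external_arcs n. ext w x y \<alpha> * f \<alpha>) = max x 0 * f ?t + max y 0 * f ?b"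
      using tb unfolding external_arcs_def by (simp add: ext_def)
    finally show ?thesis by simp
  qed
  have weights: "compatible_weights n (ext w x y)"
    if "\<forall>\<alpha>\<in>?I. 0 \<le> w \<alpha>" "\<forall>\<alpha>\<in>?I. \<forall>\<beta>\<in>?I. w \<alpha> \<noteq> 0 \<and> w \<beta> \<noteq> 0 \<longrightarrow> compatible \<alpha> \<beta>" for w x y
    unfolding compatible_weights_def
  proof (intro conjI ballI impI)
    fix \<alpha> assume "\<alpha> \<in> wiggly_arcs n"
    then show "0 \<le> ext w x y \<alpha>"
      using that(1) by (auto simp: ext_def internal_arcs_def external_arcs_def)
  next
    fix \<alpha> \<beta> assume ab: "\<alpha> \<in> wiggly_arcs n" "\<beta> \<in> wiggly_arcs n" "ext w x y \<alpha> \<noteq> 0 \<and> ext w x y \<beta> \<noteq> 0"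
    then consider "\<alpha> \<in> external_arcs n" | "\<beta> \<in> external_arcs n" | "\<alpha> \<in> ?I" "\<beta> \<in> ?I"
      by (auto simp: internal_arcs_def)
    then show "compatible \<alpha> \<beta>"
    proof cases
      case 1
      then show ?thesis using compatible_external ab by blast
    next
      case 2
      then show ?thesis using compatible_external ab compatible_commute by blast
    next
      case 3
      then show ?thesis using that(2) ab(3) by (simp add: ext_I)
    qed
  qed
  \<comment> \<open>These solve \<open>x - y = - t\<close>, which cancels the heights
    \<open>t\<close> at all points from 1 to \<open>n\<close>, and \<open>x + y = u\<close>, which
    cancels the turn at 0.\<close>
  define x where "x = (u - t) / 2"
  define y where "y = (u + t) / 2"
  have max_diff: "max z 0 - max (- z) 0 = z" for z :: real by (simp add: max_def)
  have "ext c x y \<alpha> = ext d (- x) (- y) \<alpha>"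
  proof (rule compatible_weights_unique[OF weights weights])
    fix r assume r: "r \<le> n"
    have split: "(\<Sum>\<alpha>\<in>?I. c \<alpha> * f \<alpha>) = (\<Sum>\<alpha>\<in>?I. d \<alpha> * f \<alpha>) + (\<Sum>\<alpha>\<in>?I. e \<alpha> * f \<alpha>)" for f
      by (simp add: e_def left_diff_distrib sum_subtractf)
    have "(\<Sum>\<alpha>\<in>?I. e \<alpha> * height \<alpha> r) + x * height ?t r + y * height ?b r = 0"
    proof (cases "r = 0")
      case True
      have "height \<alpha> 0 = 0" if "\<alpha> \<in> ?I" for \<alpha> using I[OF that] height_eq_0 by (auto simp: wiggly_arcs_iff)
      then show ?thesis using True by (simp add: height_def)
    next
      case False
      then show ?thesis using coords(1)[of r] r by (simp add: height_def x_def y_def field_simps)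
    qed
    then show "(\<Sum>\<alpha>\<in>wiggly_arcs n. ext c x y \<alpha> * height \<alpha> r) = (\<Sum>\<alpha>\<in>wiggly_arcs n. ext d (- x) (- y) \<alpha> * height \<alpha> r)"
      using max_diff[of x] max_diff[of y] unfolding sum_ext split[of "\<lambda>\<alpha>. height \<alpha> r"] by algebra
    have "(\<Sum>\<alpha>\<in>?I. e \<alpha> * turn \<alpha> r) + x * turn ?t r + y * turn ?b r = 0"
    proof (cases "r = 0")
      case True
      moreover have "turn ?t 0 = -1" "turn ?b 0 = -1" by (simp_all add: turn_def)
      ultimately show ?thesis by (simp add: x_def y_def field_simps flip: u_def)
    next
      case False
      then show ?thesis using coords(2)[of r] r by (simp add: turn_def)
    qed
    then show "(\<Sum>\<alpha>\<in>wiggly_arcs n. ext c x y \<alpha> * turn \<alpha> r) = (\<Sum>\<alpha>\<in>wiggly_arcs n. ext d (- x) (- y) \<alpha> * turn \<alpha> r)"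
      using max_diff[of x] max_diff[of y] unfolding sum_ext split[of "\<lambda>\<alpha>. turn \<alpha> r"] by algebra
  qed (use assms I in auto)
  then show ?thesis using \<alpha> by (simp add: ext_I)
qed

sublocale exchange_fan sum_zero_space "internal_arcs n" g "\<lambda>\<alpha>. real (incompatibility_number n \<alpha>)" compatible
proof
  show "subspace (sum_zero_space :: (real ^ 'd) set)" by (rule subspace_sum_zero_space)
  show "finite (internal_arcs n)" using finite_wiggly_arcs by (auto simp: internal_arcs_def)
  show "g \<alpha> \<in> sum_zero_space" if "\<alpha> \<in> internal_arcs n" for \<alpha>
    using that by (intro g_in_sum_zero_space) (simp add: internal_arcs_def)
  show "0 < real (incompatibility_number n \<alpha>)" if "\<alpha> \<in> internal_arcs n" for \<alpha>
    using incompatibility_number_pos[OF that] by simp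
  show "compatible \<alpha> \<alpha>" if "\<alpha> \<in> internal_arcs n" for \<alpha>
    using that by (intro compatible_refl) (simp add: internal_arcs_def wiggly_arcs_iff)
  show "compatible \<alpha> \<beta>"
    if "x \<in> sum_zero_space" "\<forall>\<alpha>\<in>internal_arcs n. g \<alpha> \<bullet> x \<le> real (incompatibility_number n \<alpha>)"
      "\<alpha> \<in> internal_arcs n" "\<beta> \<in> internal_arcs n"
      "g \<alpha> \<bullet> x = real (incompatibility_number n \<alpha>)" "g \<beta> \<bullet> x = real (incompatibility_number n \<beta>)" for x \<alpha> \<beta>
    using that(1,2,3,5,4,6) by (rule tight_compatible)
  show "c \<alpha> = d \<alpha>"
    if "\<forall>\<alpha>\<in>internal_arcs n. 0 \<le> c \<alpha>" "\<forall>\<alpha>\<in>internal_arcs n. 0 \<le> d \<alpha>"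
      "\<forall>\<alpha>\<in>internal_arcs n. \<forall>\<beta>\<in>internal_arcs n. c \<alpha> \<noteq> 0 \<and> c \<beta> \<noteq> 0 \<longrightarrow> compatible \<alpha> \<beta>"
      "\<forall>\<alpha>\<in>internal_arcs n. \<forall>\<beta>\<in>internal_arcs n. d \<alpha> \<noteq> 0 \<and> d \<beta> \<noteq> 0 \<longrightarrow> compatible \<alpha> \<beta>"
      "(\<Sum>\<alpha>\<in>internal_arcs n. c \<alpha> *\<^sub>R g \<alpha>) = (\<Sum>\<alpha>\<in>internal_arcs n. d \<alpha> *\<^sub>R g \<alpha>)" "\<alpha> \<in> internal_arcs n" for c d \<alpha>
    using that by (rule g_combination_unique)
qed (fact bounded_halfspaces)

section \<open>Translation to wiggly pseudotriangulations\<close>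

lemma compatible_set_iff: "compatible_set D \<longleftrightarrow> D \<subseteq> internal_arcs n \<and> pairwise_compatible D"
  by (simp add: compatible_set_def pairwise_compatible_def)

lemma pairwise_compatible_Un_external:
  assumes "D \<subseteq> wiggly_arcs n"
  shows "pairwise_compatible (D \<union> external_arcs n) \<longleftrightarrow> pairwise_compatible D"
proof -
  have "external_arcs n \<subseteq> wiggly_arcs n" using wiggly_arcs_split(1)[of n] by blast
  then have "compatible \<alpha> \<beta> \<and> compatible \<beta> \<alpha>" if "\<alpha> \<in> external_arcs n" "\<beta> \<in> D \<union> external_arcs n" for \<alpha> \<beta>
    using compatible_external[of \<alpha> n \<beta>] compatible_commute that assms by blast
  then show ?thesis unfolding pairwise_compatible_def by blast
qed

lemma internal_part: "T \<subseteq> wiggly_arcs n \<Longrightarrow> external_arcs n \<subseteq> T \<Longrightarrow> (T \<inter> internal_arcs n) \<union> external_arcs n = T"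
  using wiggly_arcs_split(1)[of n] by blast

text \<open>External arcs are compatible with everything, so adding or removing both preserves
  compatibility and, with it, maximality.\<close>

lemma pseudotriangulations:
  "{T \<inter> internal_arcs n |T. wiggly_pseudotriangulation n T} = {D. maximal_compatible_set D}"
proof (intro set_eqI iffI)
  fix D assume "D \<in> {T \<inter> internal_arcs n |T. wiggly_pseudotriangulation n T}"
  then obtain T where D: "D = T \<inter> internal_arcs n" and wT: "wiggly_pseudotriangulation n T" by blast
  have T: "T \<subseteq> wiggly_arcs n" "external_arcs n \<subseteq> T" "pairwise_compatible T"
    using wT by (simp_all add: wiggly_pseudotriangulation_def)
  have max: "T' = T" if "T' \<subseteq> wiggly_arcs n" "external_arcs n \<subseteq> T'" "pairwise_compatible T'" "T \<subseteq> T'" for T'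
    using wT that by (simp add: wiggly_pseudotriangulation_def)
  have "E = D" if E: "compatible_set E" "D \<subseteq> E" for E
  proof -
    have Ew: "E \<subseteq> internal_arcs n" "E \<subseteq> wiggly_arcs n"
      using E(1) wiggly_arcs_split(1)[of n] unfolding compatible_set_iff by blast+
    have "E \<union> external_arcs n = T"
    proof (rule max)
      show "E \<union> external_arcs n \<subseteq> wiggly_arcs n" using Ew wiggly_arcs_split(1)[of n] by blast
      show "pairwise_compatible (E \<union> external_arcs n)"
        using E(1) by (simp add: pairwise_compatible_Un_external[OF Ew(2)] compatible_set_iff)
      show "T \<subseteq> E \<union> external_arcs n" using internal_part[OF T(1,2)] E(2) D by blast
    qed blast
    then show ?thesis using D Ew(1) wiggly_arcs_split(2)[of n] by blast
  qed
  moreover have "compatible_set D" using T(3) D by (auto simp: compatible_set_iff pairwise_compatible_def)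
  ultimately show "D \<in> {D. maximal_compatible_set D}" by (simp add: maximal_compatible_set_def)
next
  fix D assume "D \<in> {D. maximal_compatible_set D}"
  then have D: "D \<subseteq> internal_arcs n" "pairwise_compatible D" and max: "\<And>E. compatible_set E \<Longrightarrow> D \<subseteq> E \<Longrightarrow> E = D"
    by (auto simp: maximal_compatible_set_def compatible_set_iff)
  have Dw: "D \<subseteq> wiggly_arcs n" using D(1) wiggly_arcs_split(1)[of n] by blast
  have "T' = D \<union> external_arcs n"
    if T': "T' \<subseteq> wiggly_arcs n" "external_arcs n \<subseteq> T'" "pairwise_compatible T'" "D \<union> external_arcs n \<subseteq> T'" for T'
  proof -
    have "T' \<inter> internal_arcs n = D"
      using T' D(1) by (intro max) (auto simp: compatible_set_iff pairwise_compatible_def)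
    then show ?thesis using internal_part[OF T'(1,2)] by blast
  qed
  then have "wiggly_pseudotriangulation n (D \<union> external_arcs n)"
    using Dw D(2) wiggly_arcs_split(1)[of n]
    unfolding wiggly_pseudotriangulation_def pairwise_compatible_Un_external[OF Dw] by blast
  moreover have "(D \<union> external_arcs n) \<inter> internal_arcs n = D"
    using D(1) wiggly_arcs_split(2)[of n] by blast
  ultimately show "D \<in> {T \<inter> internal_arcs n |T. wiggly_pseudotriangulation n T}" by blast
qed

text \<open>\<open>p_point\<close> and \<open>c_vector\<close> see \<open>T\<close> only through its
  internal arcs, so the points can be indexed by maximal compatible sets, as
  \<open>W_eq_convex_hull\<close> requires.\<close>

lemma p_points:
  "{p_point lbl n T |T. wiggly_pseudotriangulation n T}
    = {(\<Sum>\<alpha>\<in>D. real (incompatibility_number n \<alpha>) *\<^sub>R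
        (THE y. y \<in> sum_zero_space \<and> y \<bullet> g \<alpha> = 1 \<and> (\<forall>\<beta>\<in>D. \<beta> \<noteq> \<alpha> \<longrightarrow> y \<bullet> g \<beta> = 0))) |D. maximal_compatible_set D}"
proof -
  define f where "f D = (\<Sum>\<alpha>\<in>D. real (incompatibility_number n \<alpha>) *\<^sub>R
        (THE y. y \<in> sum_zero_space \<and> y \<bullet> g \<alpha> = 1 \<and> (\<forall>\<beta>\<in>D. \<beta> \<noteq> \<alpha> \<longrightarrow> y \<bullet> g \<beta> = 0)))" for D
  have "p_point lbl n T = f (T \<inter> internal_arcs n)" for T
    unfolding p_point_def c_vector_def f_def ..
  then have "{p_point lbl n T |T. wiggly_pseudotriangulation n T} = f ` {T \<inter> internal_arcs n |T. wiggly_pseudotriangulation n T}"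
    by auto
  also have "\<dots> = {f D |D. maximal_compatible_set D}" unfolding pseudotriangulations by blast
  finally show ?thesis unfolding f_def .
qed

end

theorem theorem3p19:
  fixes n :: nat and lbl :: "'d::finite \<Rightarrow> nat"
  assumes "n \<ge> 1"
    and "bij_betw lbl UNIV {1..2 * n}"
  shows "\<exists>W :: (real ^ 'd) set.
    W \<subseteq> sum_zero_space \<and>
    simple_polytope W \<and>
    aff_dim W = 2 * int n - 1 \<and>
    normal_fan sum_zero_space W = wiggly_fan lbl n \<and>
    W = {x \<in> sum_zero_space. \<forall>\<alpha>\<in>internal_arcs n.
           g_vector lbl n \<alpha> \<bullet> x \<le> real (incompatibility_number n \<alpha>)} \<and>
    W = convex hull {p_point lbl n T |T. wiggly_pseudotriangulation n T}"
proof -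
  interpret wiggly_labelling n lbl using assms by unfold_locales
  have "aff_dim W = 2 * int n - 1"
    using aff_dim_W n_pos by (simp add: dim_sum_zero_space card_eq of_nat_diff)
  moreover have "normal_fan sum_zero_space W = wiggly_fan lbl n"
    unfolding normal_fan_W wiggly_fan_def compatible_set_iff ..
  moreover have "W = convex hull {p_point lbl n T |T. wiggly_pseudotriangulation n T}"
    unfolding p_points by (rule W_eq_convex_hull)
  moreover have "W \<subseteq> sum_zero_space" using in_WD(1) by blast
  ultimately show ?thesis using simple_polytope_W W_def by blast
qed

end
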